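(* Let $H=-I_1+I_2+\eta I_3^2+F$ with $\eta\ne0$ be as in the context, let $\mathbf\Gamma^{\pm}\sim\hat{\mathbf\Gamma}$ be stable and unstable parameterizations with the same formal separatrix $\hat{\mathbf\Gamma}$, and let $\mathbf U\sim\hat{\mathbf U}$ be a normalized fundamental solution of the variational equation along $\mathbf\Gamma^-$. Given $\epsilon>0$, there exists a vector $\Theta^-\in\mathbb{C}^4$ such that $$\mathbf\Gamma^+(\varphi,\tau)-\mathbf\Gamma^-(\varphi,\tau)=e^{-i(\tau-\varphi)}\,\mathbf U(\varphi,\tau)\,\Theta^-+O\!\left(e^{-(2-\epsilon)i(\tau-\varphi)}\right)$$ as $\tau\to\infty$ in $D_r^\wedge$.
   Context: Coordinates on $\mathbb{C}^4$ are $(\mathbf q,\mathbf p)=(q_1,q_2,p_1,p_2)$; $X_H=(\partial H/\partial\mathbf p,-\partial H/\partial\mathbf q)$, $J=\begin{pmatrix}0&\mathrm{Id}\\-\mathrm{Id}&0\end{pmatrix}$, $\mathcal{D}=\partial_\varphi+\partial_\tau$. Set $I_1=q_2p_1-q_1p_2$, $I_2=\frac12(q_1^2+q_2^2)$, $I_3=\frac12(p_1^2+p_2^2)$. The (weighted) order of a monomial is computed by giving each $q_i$ order $2$ and each $p_i$ order $1$. Standing assumption: $H=-I_1+I_2+\eta I_3^2+F$, where $\eta\in\mathbb{C}\setminus\{0\}$ and $F$ is a bounded analytic complex-valued function on an open neighbourhood of the origin in $\mathbb{C}^4$ containing only monomials of weighted order $\geq5$. Fixed parameters: $h>0$, $0<\theta<\pi/4$.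 $\mathbb{T}_h=\{\varphi\in\mathbb{C}/2\pi\mathbb{Z}:|\mathrm{Im}\,\varphi|<h\}$; $D_r^-=\{\tau:|\arg(\tau+r)|>\theta\}$, $D_r^+=\{\tau:-\tau\in D_r^-\}$. $D_r^+\cap D_r^-$ has two connected components; $D_r^\wedge$ is the lower one. Here $r$ is large enough that $\mathbf\Gamma^\pm$ and $\mathbf U$ are defined on $\mathbb{T}_h\times D_r^\pm$ and $\mathbb{T}_h\times D_r^-$. $f=O(g)$ as $\tau\to\infty$ means $|f(\varphi,\tau)|\le C|g(\varphi,\tau)|$ for all $\varphi\in\mathbb{T}_h$ and all $\tau$ in the region with $|\tau|$ large. Asymptotic expansions $\sim$ in powers of $\tau^{-1}$ (finitely many positive powers of $\tau$ allowed) are uniform in $\varphi\in\mathbb{T}_h$. $\mathsf{T}$: trigonometric polynomials in $\varphi$ with complex coefficients. A formal separatrix is a non-zero formal solution $\hat{\mathbf\Gamma}=(\tau^{-2}\hat\Gamma_1,\tau^{-2}\hat\Gamma_2,\tau^{-1}\hat\Gamma_3,\tau^{-1}\hat\Gamma_4)^T$, $\hat\Gamma_i\in\mathsf{T}[[\tau^{-1}]]$, of $\mathcal{D}\hat{\mathbf\Gamma}=X_H(\hat{\mathbf\Gamma})$. The unstable (resp. stable) parameterization $\mathbf\Gamma^-$ (resp. $\mathbf\Gamma^+$) is the analytic solution of $\mathcal{D}\mathbf\Gamma^\pm=X_H(\mathbf\Gamma^\pm)$ on $\mathbb{T}_h\times D_r^-$ (resp. $\mathbb{T}_h\times D_r^+$),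 for $r$ large, with $\mathbf\Gamma^\pm\sim\hat{\mathbf\Gamma}$ as $\tau\to\infty$ in $D_r^\pm$. A formal fundamental solution $\hat{\mathbf U}$ is a formal $4\times4$ matrix solution of $\mathcal{D}\mathbf u=DX_H(\hat{\mathbf\Gamma})\mathbf u$ with first column in $(\tau\mathsf{T}[[\tau^{-1}]])^2\times(\tau^2\mathsf{T}[[\tau^{-1}]])^2$, second column in $(\tau^2\mathsf{T}[[\tau^{-1}]])^2\times(\tau^3\mathsf{T}[[\tau^{-1}]])^2$, third column $\partial_\varphi\hat{\mathbf\Gamma}$, fourth column $\partial_\tau\hat{\mathbf\Gamma}$, and $\hat{\mathbf U}^TJ\hat{\mathbf U}=J$. A normalized fundamental solution $\mathbf U\sim\hat{\mathbf U}$ is an analytic matrix solution $\mathbf U:\mathbb{T}_h\times D_r^-\to\mathbb{C}^{4\times4}$ of $\mathcal{D}\mathbf u=DX_H(\mathbf\Gamma^-)\mathbf u$, continuous on the closure of its domain, with third and fourth columns $\partial_\varphi\mathbf\Gamma^-$, $\partial_\tau\mathbf\Gamma^-$, with $\mathbf U^TJ\mathbf U=J$, and with $\mathbf U\sim\hat{\mathbf U}$ as $\tau\to\infty$ in $D_r^-$. *)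

theory Defs
  imports
    "HOL-Analysis.Analysis"
    "HOL-Library.Poly_Mapping"
    "HOL-Computational_Algebra.Formal_Laurent_Series"
begin

no_notation fps_nth (infixl "$" 75)

section \<open>Analytic functions of several complex variables\<close>

definition monomial :: "nat ^ 'n \<Rightarrow> complex ^ 'n \<Rightarrow> complex" where
  "monomial \<alpha> x = (\<Prod>i\<in>UNIV. (x $ i) ^ (\<alpha> $ i))"

definition has_power_series ::
    "(complex ^ 'n \<Rightarrow> complex) \<Rightarrow> complex ^ 'n \<Rightarrow> (nat ^ 'n \<Rightarrow> complex) \<Rightarrow> bool" where
  "has_power_series f x0 a \<longleftrightarrow>
     (\<exists>e>0. \<forall>x\<in>ball x0 e. ((\<lambda>\<alpha>. a \<alpha> * monomial \<alpha> (x - x0)) has_sum f x) UNIV)"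

definition analytic_Cn :: "(complex ^ 'n \<Rightarrow> complex) \<Rightarrow> (complex ^ 'n) set \<Rightarrow> bool" where
  "analytic_Cn f S \<longleftrightarrow> (\<forall>x0\<in>S. \<exists>a. has_power_series f x0 a)"

text \<open>Coefficients of the Taylor series at the origin; meaningful for \<open>f\<close> analytic there.\<close>

definition taylor_coeff :: "(complex ^ 'n \<Rightarrow> complex) \<Rightarrow> nat ^ 'n \<Rightarrow> complex" where
  "taylor_coeff f = (THE a. has_power_series f 0 a)"

definition partial :: "'n \<Rightarrow> (complex ^ 'n \<Rightarrow> complex) \<Rightarrow> complex ^ 'n \<Rightarrow> complex" where
  "partial j f x = deriv (\<lambda>t. f (x + t *s axis j 1)) 0"


section \<open>The Hamiltonian\<close>

text \<open>
  A point of \<open>complex ^ 4\<close> has the coordinates \<open>(q\<^sub>1, q\<^sub>2, p\<^sub>1, p\<^sub>2)\<close>, in this order.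
\<close>

definition I1 :: "complex ^ 4 \<Rightarrow> complex" where
  "I1 x = x $ 2 * x $ 3 - x $ 1 * x $ 4"

definition I2 :: "complex ^ 4 \<Rightarrow> complex" where
  "I2 x = ((x $ 1)\<^sup>2 + (x $ 2)\<^sup>2) / 2"

definition I3 :: "complex ^ 4 \<Rightarrow> complex" where
  "I3 x = ((x $ 3)\<^sup>2 + (x $ 4)\<^sup>2) / 2"

definition weighted_order :: "nat ^ 4 \<Rightarrow> nat" where
  "weighted_order \<alpha> = 2 * \<alpha> $ 1 + 2 * \<alpha> $ 2 + \<alpha> $ 3 + \<alpha> $ 4"

definition Ham :: "complex \<Rightarrow> (complex ^ 4 \<Rightarrow> complex) \<Rightarrow> complex ^ 4 \<Rightarrow> complex" where
  "Ham \<eta> F x = - I1 x + I2 x + \<eta> * (I3 x)\<^sup>2 + F x"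

definition X_H :: "(complex ^ 4 \<Rightarrow> complex) \<Rightarrow> complex ^ 4 \<Rightarrow> complex ^ 4" where
  "X_H H x = vector [partial 3 H x, partial 4 H x, - partial 1 H x, - partial 2 H x]"

definition DX_H :: "(complex ^ 4 \<Rightarrow> complex) \<Rightarrow> complex ^ 4 \<Rightarrow> complex ^ 4 ^ 4" where
  "DX_H H x = (\<chi> i j. partial j (\<lambda>y. X_H H y $ i) x)"

definition J :: "'a::ring_1 ^ 4 ^ 4" where
  "J = vector [vector [0, 0, 1, 0], vector [0, 0, 0, 1],
               vector [- 1, 0, 0, 0], vector [0, - 1, 0, 0]]"


section \<open>Domains\<close>

text \<open>
  Functions on \<open>\<complex>/2\<pi>\<int>\<close> are represented by \<open>2\<pi>\<close>-periodic functions on \<open>\<complex>\<close>, so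
  \<open>T_strip h\<close> is the preimage in \<open>\<complex>\<close> of the set \<open>\<bar>Im \<phi>\<bar> < h\<close>.
\<close>

definition T_strip :: "real \<Rightarrow> complex set" where
  "T_strip h = {\<phi>. \<bar>Im \<phi>\<bar> < h}"

definition D_minus :: "real \<Rightarrow> real \<Rightarrow> complex set" where
  "D_minus \<theta> r = {\<tau>. \<bar>Arg (\<tau> + of_real r)\<bar> > \<theta>}"

definition D_plus :: "real \<Rightarrow> real \<Rightarrow> complex set" where
  "D_plus \<theta> r = {\<tau>. - \<tau> \<in> D_minus \<theta> r}"

text \<open>
  For \<open>r > 0\<close> the intersection \<open>D_plus \<theta> r \<inter> D_minus \<theta> r\<close> does not meet the real axis, and its
  part in the lower half-plane is one of its two connected components (lemma \<open>D_wedge_component\<close>).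
\<close>

definition D_wedge :: "real \<Rightarrow> real \<Rightarrow> complex set" where
  "D_wedge \<theta> r = {\<tau> \<in> D_plus \<theta> r \<inter> D_minus \<theta> r. Im \<tau> < 0}"

lemma abs_Arg_gt_lower:
  assumes "Im z < 0" "0 < \<theta>" "\<theta> < pi / 4"
  shows "\<bar>Arg z\<bar> > \<theta> \<longleftrightarrow> cos \<theta> * Im z + sin \<theta> * Re z < 0"
proof -
  define a where "a = - Arg z"
  have z: "z \<noteq> 0" using assms by auto
  have "Arg z < 0" using assms(1) by (simp add: Arg_neg_iff)
  moreover have "- pi < Arg z" using mpi_less_Arg by blast
  ultimately have a: "0 < a" "a < pi" by (auto simp: a_def)
  have "Re z = norm z * cos a" "Im z = - norm z * sin a"
    using z cos_Arg[of z] sin_Arg[of z] by (auto simp: a_def)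
  then have "cos \<theta> * Im z + sin \<theta> * Re z = norm z * sin (\<theta> - a)"
    by (simp add: sin_diff algebra_simps)
  moreover have "sin (\<theta> - a) < 0 \<longleftrightarrow> a > \<theta>"
  proof -
    have "sin (a - \<theta>) > 0" if "a > \<theta>" using that a assms by (intro sin_gt_zero) auto
    moreover have "sin (\<theta> - a) \<ge> 0" if "a \<le> \<theta>" using that a assms by (intro sin_ge_zero) auto
    moreover have "sin (\<theta> - a) = - sin (a - \<theta>)" by (simp add: sin_diff)
    ultimately show ?thesis by linarith
  qed
  ultimately show ?thesis using z a \<open>Arg z < 0\<close> by (auto simp: a_def mult_less_0_iff)
qed

lemma abs_Arg_uminus_lower:
  assumes "Im z < 0" "0 < \<theta>" "\<theta> < pi / 4"
  shows "\<bar>Arg (- z)\<bar> > \<theta> \<longleftrightarrow> cos \<theta> * Im z - sin \<theta> * Re z < 0"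
proof -
  have "\<bar>Arg (- z)\<bar> = \<bar>Arg (cnj (- z))\<bar>"
    by (simp add: Arg_cnj del: complex_cnj_minus)
  then show ?thesis
    using abs_Arg_gt_lower[of "cnj (- z)" \<theta>] assms by simp
qed

lemma D_wedge_component:
  assumes "r > 0" "0 < \<theta>" "\<theta> < pi / 4"
  shows "D_wedge \<theta> r \<in> components (D_plus \<theta> r \<inter> D_minus \<theta> r)"
proof -
  let ?S = "D_plus \<theta> r \<inter> D_minus \<theta> r"
  have trig: "sin \<theta> > 0" "cos \<theta> > 0"
    using assms by (auto intro!: sin_gt_zero cos_gt_zero)
  have mem: "\<tau> \<in> D_wedge \<theta> r \<longleftrightarrow> Im \<tau> < 0 \<and>
      cos \<theta> * Im \<tau> + sin \<theta> * (Re \<tau> + r) < 0 \<and> cos \<theta> * Im \<tau> - sin \<theta> * (Re \<tau> - r) < 0" for \<tau>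
  proof (cases "Im \<tau> < 0")
    case True
    then show ?thesis
      using abs_Arg_gt_lower[of "\<tau> + of_real r" \<theta>] abs_Arg_uminus_lower[of "\<tau> - of_real r" \<theta>] assms
      by (auto simp: D_wedge_def D_plus_def D_minus_def add.commute)
  qed (auto simp: D_wedge_def)
  have eq: "D_wedge \<theta> r = {\<tau>. Im \<tau> < 0}
      \<inter> {\<tau>. Complex (sin \<theta>) (cos \<theta>) \<bullet> \<tau> < - (r * sin \<theta>)}
      \<inter> {\<tau>. Complex (- sin \<theta>) (cos \<theta>) \<bullet> \<tau> < - (r * sin \<theta>)}"
    by (auto simp: mem inner_complex_def algebra_simps)
  have conn: "connected (D_wedge \<theta> r)"
    unfolding eq by (intro convex_connected convex_Int convex_halfspace_lt convex_halfspace_Im_lt)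
  have "cos \<theta> * (r * (sin \<theta> + 1) / cos \<theta>) = r * (sin \<theta> + 1)"
    using trig by simp
  then have "Complex 0 (- (r * (sin \<theta> + 1) / cos \<theta>)) \<in> D_wedge \<theta> r"
    using trig assms by (simp add: mem algebra_simps add_pos_pos)
  then have ne: "D_wedge \<theta> r \<noteq> {}" by blast
  have real: "Im \<tau> \<noteq> 0" if "\<tau> \<in> ?S" for \<tau>
  proof
    assume Im: "Im \<tau> = 0"
    have neg: "Re z < 0" if "\<bar>Arg z\<bar> > \<theta>" "Im z = 0" for z
      using that assms Arg_eq_0[of z] by (force simp: complex_is_Real_iff)
    show False
      using neg[of "\<tau> + of_real r"] neg[of "- \<tau> + of_real r"] that Im assms
      by (auto simp: D_plus_def D_minus_def)
  qed
  have "d = D_wedge \<theta> r"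
    if d: "D_wedge \<theta> r \<subseteq> d" "d \<subseteq> ?S" "connected d" for d
  proof -
    have "{\<tau>. Im \<tau> < 0} \<inter> d = {} \<or> {\<tau>. Im \<tau> > 0} \<inter> d = {}"
      using d real by (intro connectedD open_halfspace_Im_lt open_halfspace_Im_gt) force+
    moreover have "{\<tau>. Im \<tau> < 0} \<inter> d \<noteq> {}" using ne d by (force simp: D_wedge_def)
    ultimately have up: "{\<tau>. Im \<tau> > 0} \<inter> d = {}" by blast
    have "Im \<tau> < 0" if "\<tau> \<in> d" for \<tau>
    proof -
      have "Im \<tau> \<noteq> 0" using real d that by blast
      moreover have "\<not> Im \<tau> > 0" using up that by blast
      ultimately show ?thesis by linarith
    qed
    then show ?thesis using d by (auto simp: D_wedge_def)
  qed
  moreover have "D_wedge \<theta> r \<subseteq> ?S" by (auto simp: D_wedge_def)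
  ultimately show ?thesis
    unfolding in_components_maximal using ne conn by blast
qed

definition periodic_on_strip :: "real \<Rightarrow> complex set \<Rightarrow> (complex \<Rightarrow> complex \<Rightarrow> 'a) \<Rightarrow> bool" where
  "periodic_on_strip h D f \<longleftrightarrow>
     (\<forall>\<phi>\<in>T_strip h. \<forall>\<tau>\<in>D. f (\<phi> + of_real (2 * pi)) \<tau> = f \<phi> \<tau>)"

definition analytic_strip :: "real \<Rightarrow> complex set \<Rightarrow> (complex \<Rightarrow> complex \<Rightarrow> complex) \<Rightarrow> bool" where
  "analytic_strip h D f \<longleftrightarrow>
     analytic_Cn (\<lambda>z::complex ^ 2. f (z $ 1) (z $ 2)) {z. z $ 1 \<in> T_strip h \<and> z $ 2 \<in> D}"

definition d_phi :: "(complex \<Rightarrow> complex \<Rightarrow> complex) \<Rightarrow> complex \<Rightarrow> complex \<Rightarrow> complex" where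
  "d_phi f \<phi> \<tau> = deriv (\<lambda>s. f s \<tau>) \<phi>"

definition d_tau :: "(complex \<Rightarrow> complex \<Rightarrow> complex) \<Rightarrow> complex \<Rightarrow> complex \<Rightarrow> complex" where
  "d_tau f \<phi> \<tau> = deriv (\<lambda>s. f \<phi> s) \<tau>"

definition D_op :: "(complex \<Rightarrow> complex \<Rightarrow> complex) \<Rightarrow> complex \<Rightarrow> complex \<Rightarrow> complex" where
  "D_op f \<phi> \<tau> = d_phi f \<phi> \<tau> + d_tau f \<phi> \<tau>"

definition bigO_strip :: "real \<Rightarrow> complex set \<Rightarrow> (complex \<Rightarrow> complex \<Rightarrow> 'a::real_normed_vector)
    \<Rightarrow> (complex \<Rightarrow> complex \<Rightarrow> 'b::real_normed_vector) \<Rightarrow> bool" where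
  "bigO_strip h D f g \<longleftrightarrow>
     (\<exists>C R. \<forall>\<phi>\<in>T_strip h. \<forall>\<tau>\<in>D. norm \<tau> \<ge> R \<longrightarrow> norm (f \<phi> \<tau>) \<le> C * norm (g \<phi> \<tau>))"


section \<open>Formal series\<close>

text \<open>
  A trigonometric polynomial \<open>\<Sum>k. c k * exp (\<i> * k * \<phi>)\<close> is represented by its finitely
  supported coefficient family \<open>c\<close>; the product on \<^typ>\<open>int \<Rightarrow>\<^sub>0 complex\<close> is the convolution.
  A formal series in \<open>\<tau>\<^sup>-\<^sup>1\<close>, finitely many positive powers of \<open>\<tau>\<close> allowed, is a formal Laurent
  series with \<open>fls_X\<close> standing for \<open>\<tau>\<^sup>-\<^sup>1\<close>: the coefficient of \<open>\<tau>\<^sup>-\<^sup>n\<close> in \<open>f\<close> is \<open>fls_nth f n\<close>.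
\<close>

type_synonym trig = "int \<Rightarrow>\<^sub>0 complex"

definition trig_eval :: "trig \<Rightarrow> complex \<Rightarrow> complex" where
  "trig_eval c \<phi> = (\<Sum>k\<in>Poly_Mapping.keys c. Poly_Mapping.lookup c k * exp (\<i> * of_int k * \<phi>))"

definition trig_deriv :: "trig \<Rightarrow> trig" where
  "trig_deriv c = Poly_Mapping.mapp (\<lambda>k a. \<i> * of_int k * a) c"

text \<open>\<open>tau_T m\<close> is \<open>\<tau>\<^sup>m T[[\<tau>\<^sup>-\<^sup>1]]\<close>.\<close>

definition tau_T :: "int \<Rightarrow> trig fls set" where
  "tau_T m = range (\<lambda>g. fls_shift m (fps_to_fls g))"

lemma tau_T_iff: "f \<in> tau_T m \<longleftrightarrow> (\<forall>n < - m. fls_nth f n = 0)"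
proof
  assume "f \<in> tau_T m"
  then show "\<forall>n < - m. fls_nth f n = 0" by (auto simp: tau_T_def)
next
  assume f: "\<forall>n < - m. fls_nth f n = 0"
  have "f = fls_shift m (fps_to_fls (Abs_fps (\<lambda>n. fls_nth f (int n - m))))"
    by (rule fls_eqI) (use f in auto)
  then show "f \<in> tau_T m" by (auto simp: tau_T_def)
qed

lemma lookup_trig_deriv:
  "Poly_Mapping.lookup (trig_deriv c) k = \<i> * of_int k * Poly_Mapping.lookup c k"
  by (simp add: trig_deriv_def lookup_mapp in_keys_iff when_def)

lemma trig_deriv_0 [simp]: "trig_deriv 0 = 0"
  by (rule poly_mapping_eqI) (simp add: lookup_trig_deriv)

lift_definition fd_phi :: "trig fls \<Rightarrow> trig fls" is "\<lambda>f n. trig_deriv (f n)"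
  by (erule MOST_mono) simp

text \<open>Chain rule for \<open>X = \<tau>\<^sup>-\<^sup>1\<close>: \<open>d/d\<tau> = - X\<^sup>2 d/dX\<close>.\<close>

definition fd_tau :: "trig fls \<Rightarrow> trig fls" where
  "fd_tau f = - (fls_X\<^sup>2 * fls_deriv f)"

lemma fd_tau_nth: "fls_nth (fd_tau f) n = - (of_int (n - 1) * fls_nth f (n - 1))"
  by (simp add: fd_tau_def fls_X_power_times_conv_shift)

definition fD_op :: "trig fls \<Rightarrow> trig fls" where
  "fD_op f = fd_phi f + fd_tau f"

text \<open>
  Substitution of a vector \<open>G\<close> of series without \<open>\<tau>\<^sup>0\<close> and positive powers of \<open>\<tau>\<close> into the
  Taylor series of \<open>f\<close> at the origin. The power \<open>G\<^sup>\<alpha>\<close> then only contains powers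
  \<open>\<tau>\<^sup>-\<^sup>n\<close> with \<open>n \<ge> \<bar>\<alpha>\<bar>\<close>, so that the coefficient of \<open>\<tau>\<^sup>-\<^sup>n\<close> in the composition is a
  finite sum over \<open>\<bar>\<alpha>\<bar> \<le> n\<close>.
\<close>

definition formal_subst :: "(complex ^ 4 \<Rightarrow> complex) \<Rightarrow> trig fls ^ 4 \<Rightarrow> trig fls" where
  "formal_subst f G = fps_to_fls (Abs_fps (\<lambda>n.
     \<Sum>\<alpha> | (\<Sum>i\<in>UNIV. \<alpha> $ i) \<le> n.
       Poly_Mapping.single 0 (taylor_coeff f \<alpha>) * fls_nth (\<Prod>i\<in>UNIV. (G $ i) ^ (\<alpha> $ i)) (int n)))"

text \<open>Asymptotic expansion as \<open>\<tau> \<rightarrow> \<infinity>\<close> in \<open>D\<close>, uniformly in \<open>\<phi>\<close>.\<close>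

definition asymp_exp ::
    "real \<Rightarrow> complex set \<Rightarrow> (complex \<Rightarrow> complex \<Rightarrow> complex) \<Rightarrow> trig fls \<Rightarrow> bool" where
  "asymp_exp h D f fhat \<longleftrightarrow>
     (\<forall>N::int. bigO_strip h D
        (\<lambda>\<phi> \<tau>. f \<phi> \<tau> - (\<Sum>n = fls_subdegree fhat..N. trig_eval (fls_nth fhat n) \<phi> * \<tau> powi (- n)))
        (\<lambda>\<phi> \<tau>. \<tau> powi (- (N + 1))))"


section \<open>Separatrices and fundamental solutions\<close>

definition formal_separatrix :: "(complex ^ 4 \<Rightarrow> complex) \<Rightarrow> trig fls ^ 4 \<Rightarrow> bool" where
  "formal_separatrix H G \<longleftrightarrow>
     G \<noteq> 0 \<and>
     G $ 1 \<in> tau_T (- 2) \<and> G $ 2 \<in> tau_T (- 2) \<and> G $ 3 \<in> tau_T (- 1) \<and> G $ 4 \<in> tau_T (- 1) \<and>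
     (\<forall>i. fD_op (G $ i) = formal_subst (\<lambda>x. X_H H x $ i) G)"

text \<open>
  \<open>V\<close> is the domain of \<open>H\<close>. With \<open>D = D_minus \<theta> r\<close> this describes the unstable, with
  \<open>D = D_plus \<theta> r\<close> the stable parameterization.
\<close>

definition parameterization ::
    "(complex ^ 4 \<Rightarrow> complex) \<Rightarrow> (complex ^ 4) set \<Rightarrow> real \<Rightarrow> complex set \<Rightarrow> trig fls ^ 4
      \<Rightarrow> (complex \<Rightarrow> complex \<Rightarrow> complex ^ 4) \<Rightarrow> bool" where
  "parameterization H V h D Ghat G \<longleftrightarrow>
     periodic_on_strip h D G \<and>
     (\<forall>i. analytic_strip h D (\<lambda>\<phi> \<tau>. G \<phi> \<tau> $ i)) \<and>
     (\<forall>\<phi>\<in>T_strip h. \<forall>\<tau>\<in>D. G \<phi> \<tau> \<in> V \<and>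
        (\<forall>i. D_op (\<lambda>\<phi> \<tau>. G \<phi> \<tau> $ i) \<phi> \<tau> = X_H H (G \<phi> \<tau>) $ i)) \<and>
     (\<forall>i. asymp_exp h D (\<lambda>\<phi> \<tau>. G \<phi> \<tau> $ i) (Ghat $ i))"

text \<open>In a matrix \<open>U\<close>, \<open>U $ i $ j\<close> is the entry in row \<open>i\<close> and column \<open>j\<close>.\<close>

definition formal_fundamental_solution ::
    "(complex ^ 4 \<Rightarrow> complex) \<Rightarrow> trig fls ^ 4 \<Rightarrow> trig fls ^ 4 ^ 4 \<Rightarrow> bool" where
  "formal_fundamental_solution H G U \<longleftrightarrow>
     (\<chi> i j. fD_op (U $ i $ j)) =
       (\<chi> i j. formal_subst (\<lambda>x. DX_H H x $ i $ j) G) ** U \<and>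
     U $ 1 $ 1 \<in> tau_T 1 \<and> U $ 2 $ 1 \<in> tau_T 1 \<and> U $ 3 $ 1 \<in> tau_T 2 \<and> U $ 4 $ 1 \<in> tau_T 2 \<and>
     U $ 1 $ 2 \<in> tau_T 2 \<and> U $ 2 $ 2 \<in> tau_T 2 \<and> U $ 3 $ 2 \<in> tau_T 3 \<and> U $ 4 $ 2 \<in> tau_T 3 \<and>
     (\<forall>i. U $ i $ 3 = fd_phi (G $ i)) \<and>
     (\<forall>i. U $ i $ 4 = fd_tau (G $ i)) \<and>
     transpose U ** J ** U = J"

definition normalized_fundamental_solution ::
    "(complex ^ 4 \<Rightarrow> complex) \<Rightarrow> real \<Rightarrow> complex set \<Rightarrow> (complex \<Rightarrow> complex \<Rightarrow> complex ^ 4)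
      \<Rightarrow> trig fls ^ 4 ^ 4 \<Rightarrow> (complex \<Rightarrow> complex \<Rightarrow> complex ^ 4 ^ 4) \<Rightarrow> bool" where
  "normalized_fundamental_solution H h D G Uhat U \<longleftrightarrow>
     periodic_on_strip h D U \<and>
     (\<forall>i j. analytic_strip h D (\<lambda>\<phi> \<tau>. U \<phi> \<tau> $ i $ j)) \<and>
     continuous_on (closure (T_strip h \<times> D)) (\<lambda>(\<phi>, \<tau>). U \<phi> \<tau>) \<and>
     (\<forall>\<phi>\<in>T_strip h. \<forall>\<tau>\<in>D.
        (\<chi> i j. D_op (\<lambda>\<phi> \<tau>. U \<phi> \<tau> $ i $ j) \<phi> \<tau>) = DX_H H (G \<phi> \<tau>) ** U \<phi> \<tau> \<and>
        (\<forall>i. U \<phi> \<tau> $ i $ 3 = d_phi (\<lambda>\<phi> \<tau>. G \<phi> \<tau> $ i) \<phi> \<tau>) \<and>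
        (\<forall>i. U \<phi> \<tau> $ i $ 4 = d_tau (\<lambda>\<phi> \<tau>. G \<phi> \<tau> $ i) \<phi> \<tau>) \<and>
        transpose (U \<phi> \<tau>) ** J ** U \<phi> \<tau> = J) \<and>
     (\<forall>i j. asymp_exp h D (\<lambda>\<phi> \<tau>. U \<phi> \<tau> $ i $ j) (Uhat $ i $ j))"

end

theory Submission
  imports Defs "HOL-Complex_Analysis.Residue_Theorem"
begin

text \<open>
  Let \<open>\<Delta>\<close> be the difference of the stable and the unstable parameterization. The two have the same
  asymptotic expansion, so on their common domain \<open>\<Delta>\<close> is smaller than every power of
  \<open>1 / \<tau>\<close>. Subtracting the two differential equations gives
  \<open>\<D> \<Delta> = DX\<^sub>H(\<Gamma>\<^sup>-) \<Delta> + Q\<close>, where \<open>Q\<close> is the Taylor remainder of the vector field and is quadratic in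
  \<open>\<Delta>\<close> (lemma \<open>X_H_quadratic_remainder\<close>). In the coordinates \<open>\<Delta> = U c\<close> the linear part disappears and
  \<open>\<D> c = U\<^sup>-\<^sup>1 Q\<close> (lemma \<open>variation_of_constants\<close>). As \<open>U\<close> and \<open>U\<^sup>-\<^sup>1\<close> grow at most polynomially, the right-hand
  side is bounded by a power of \<open>- Im \<tau>\<close> times \<open>\<parallel>c\<parallel>\<^sup>2\<close>.

  If the right-hand side were 0, \<open>c\<close> would be a function of \<open>\<psi> = \<tau> - \<phi>\<close> that is \<open>2 \<pi>\<close>-periodic, since \<open>c\<close> is periodic in
  \<open>\<phi>\<close>; and as it tends to 0 for \<open>Im \<psi> \<rightarrow> - \<infinity>\<close>, its Fourier series would consist of the modes
  \<open>exp (- \<i> n \<psi>)\<close> with \<open>n \<ge> 1\<close>. The coefficient of the first of them is \<open>\<Theta>\<^sup>-\<close>.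

  In general \<open>c\<close> is constant along the characteristics only up to the square of its size
  (lemma \<open>quadratic_ode_increment\<close>), and its restriction \<open>g\<close> to \<open>\<phi> = 0\<close> is periodic only up to such terms. The
  Cauchy integral with a periodic kernel over a rectangle one period wide (lemma \<open>cylinder_representation\<close>)
  replaces the Fourier series. It expresses \<open>g\<close> by its mean over the bottom side, by the top side, which contributes
  an exponentially small term, and by the jump of \<open>g\<close> between the vertical sides. This is used twice. At first the jump is only
  known to be a small multiple of \<open>g\<close>, and an absorption argument in a weighted supremum norm yields \<open>g = O(exp (Im \<psi>))\<close>
  (lemma \<open>almost_periodic_exp_decay\<close>). Then the jump of \<open>exp (\<i> \<psi>) g\<close> is at most a power of \<open>- Im \<psi>\<close> times
  \<open>exp (Im \<psi>)\<close>, so that this function converges to a constant with almost this rate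
  (lemma \<open>almost_periodic_limit\<close>). The powers are what \<open>\<epsilon>\<close> pays for. Finally the expansion is carried from the slice to the
  whole wedge along the characteristics (lemma \<open>quadratic_transport_expansion\<close>).
\<close>

section \<open>Power series of several variables\<close>

definition mdeg :: "nat ^ 'n \<Rightarrow> nat" where
  "mdeg \<alpha> = (\<Sum>i\<in>UNIV. \<alpha> $ i)"

lemma monomial_const: "monomial \<alpha> (\<chi> i. c) = c ^ mdeg \<alpha>"
  by (simp add: monomial_def mdeg_def power_sum)

lemma norm_monomial_le:
  assumes "\<And>i. norm (y $ i) \<le> \<rho>"
  shows "norm (monomial \<alpha> y) \<le> \<rho> ^ mdeg \<alpha>"
  unfolding monomial_def mdeg_def power_sum prod_norm[symmetric]
  by (intro prod_mono) (auto simp: norm_power intro!: power_mono assms)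

lemma norm_le_sum_norm_vec: "norm x \<le> (\<Sum>i\<in>UNIV. norm (x $ i))"
  unfolding norm_vec_def by (rule L2_set_le_sum) simp

text \<open>
  Unconditional summability in \<open>\<complex>\<close> is absolute summability; at the point whose coordinates all equal
  \<open>\<rho>\<close> every monomial of degree \<open>d\<close> has the value \<open>\<rho>\<^sup>d\<close>, and this gives a majorant on the whole
  polydisc.
\<close>

lemma has_power_series_polydisc:
  fixes f :: "complex ^ 'n \<Rightarrow> complex"
  assumes "has_power_series f x0 a"
  obtains \<rho> where "\<rho> > 0" "(\<lambda>\<alpha>. norm (a \<alpha>) * \<rho> ^ mdeg \<alpha>) summable_on UNIV"
    "\<And>x. \<forall>i. norm ((x - x0) $ i) \<le> \<rho> \<Longrightarrow> ((\<lambda>\<alpha>. a \<alpha> * monomial \<alpha> (x - x0)) has_sum f x) UNIV"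
proof -
  obtain e where e: "e > 0" and
    sums: "\<And>x. x \<in> ball x0 e \<Longrightarrow> ((\<lambda>\<alpha>. a \<alpha> * monomial \<alpha> (x - x0)) has_sum f x) UNIV"
    using assms unfolding has_power_series_def by blast
  define \<rho> where "\<rho> = e / (2 * real CARD('n))"
  have \<rho>: "\<rho> > 0" using e by (simp add: \<rho>_def)
  have near: "x \<in> ball x0 e" if "\<And>i. norm ((x - x0) $ i) \<le> \<rho>" for x
  proof -
    have "norm (x - x0) \<le> (\<Sum>i\<in>(UNIV::'n set). norm ((x - x0) $ i))"
      by (rule norm_le_sum_norm_vec)
    also have "\<dots> \<le> (\<Sum>i\<in>(UNIV::'n set). \<rho>)" by (intro sum_mono that)
    also have "\<dots> < e" using e by (simp add: \<rho>_def)
    finally show ?thesis by (simp add: dist_norm norm_minus_commute)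
  qed
  show ?thesis
  proof (rule that[OF \<rho>])
    have "((\<lambda>\<alpha>. a \<alpha> * monomial \<alpha> ((x0 + (\<chi> i. of_real \<rho>)) - x0)) has_sum f (x0 + (\<chi> i. of_real \<rho>))) UNIV"
      by (intro sums near) (use \<rho> in auto)
    then have "(\<lambda>\<alpha>. norm (a \<alpha> * monomial \<alpha> (\<chi> i. of_real \<rho>))) summable_on UNIV"
      unfolding summable_on_iff_abs_summable_on_complex[symmetric]
      by (auto dest: has_sum_imp_summable)
    then show "(\<lambda>\<alpha>. norm (a \<alpha>) * \<rho> ^ mdeg \<alpha>) summable_on UNIV"
      using \<rho> by (simp add: monomial_const norm_mult norm_power)
  qed (use sums near in blast)
qed

lemma has_power_series_bounded_near:
  fixes f :: "complex ^ 'n \<Rightarrow> complex"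
  assumes "has_power_series f x0 a"
  obtains \<rho> where "\<rho> > 0" "bounded (f ` ball x0 \<rho>)"
proof -
  obtain \<rho> where \<rho>: "\<rho> > 0" and S: "(\<lambda>\<alpha>. norm (a \<alpha>) * \<rho> ^ mdeg \<alpha>) summable_on UNIV"
    and sums: "\<And>x. \<forall>i. norm ((x - x0) $ i) \<le> \<rho> \<Longrightarrow> ((\<lambda>\<alpha>. a \<alpha> * monomial \<alpha> (x - x0)) has_sum f x) UNIV"
    by (rule has_power_series_polydisc[OF assms]) (rule that)
  have "norm (f x) \<le> (\<Sum>\<^sub>\<infinity>\<alpha>. norm (a \<alpha>) * \<rho> ^ mdeg \<alpha>)" if "x \<in> ball x0 \<rho>" for x
  proof -
    have le: "norm ((x - x0) $ i) \<le> \<rho>" for i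
      using that Finite_Cartesian_Product.norm_nth_le[of "x - x0" i] by (simp add: dist_norm norm_minus_commute)
    have term_le: "norm (a \<alpha> * monomial \<alpha> (x - x0)) \<le> norm (a \<alpha>) * \<rho> ^ mdeg \<alpha>" for \<alpha>
      by (auto simp: norm_mult intro!: mult_left_mono norm_monomial_le le)
    have abs: "(\<lambda>\<alpha>. norm (a \<alpha> * monomial \<alpha> (x - x0))) summable_on UNIV"
      unfolding summable_on_iff_abs_summable_on_complex[symmetric]
      by (rule has_sum_imp_summable[OF sums[OF allI[OF le]]])
    have "norm (f x) \<le> (\<Sum>\<^sub>\<infinity>\<alpha>. norm (a \<alpha> * monomial \<alpha> (x - x0)))"
      using norm_has_sum_bound[OF has_sum_infsum[OF abs] sums[OF allI[OF le]]] .
    also have "\<dots> \<le> (\<Sum>\<^sub>\<infinity>\<alpha>. norm (a \<alpha>) * \<rho> ^ mdeg \<alpha>)"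
      by (intro infsum_mono abs S term_le)
    finally show ?thesis .
  qed
  then show ?thesis using that \<rho> by (force simp: bounded_iff)
qed

definition monomial_partial :: "'n \<Rightarrow> nat ^ 'n \<Rightarrow> complex ^ 'n \<Rightarrow> complex" where
  "monomial_partial k \<alpha> y = of_nat (\<alpha> $ k) * (y $ k) ^ (\<alpha> $ k - 1) * (\<Prod>i\<in>UNIV - {k}. (y $ i) ^ (\<alpha> $ i))"

lemma monomial_line_deriv:
  "((\<lambda>t. monomial \<alpha> (y + t *s v)) has_field_derivative (\<Sum>k\<in>UNIV. v $ k * monomial_partial k \<alpha> (y + z *s v))) (at z)"
proof -
  have "((\<lambda>t. \<Prod>k\<in>UNIV. (y $ k + t * v $ k) ^ (\<alpha> $ k)) has_field_derivative
      (\<Sum>k\<in>UNIV. (of_nat (\<alpha> $ k) * (v $ k * (y $ k + z * v $ k) ^ (\<alpha> $ k - Suc 0)))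
         * (\<Prod>i\<in>UNIV - {k}. (y $ i + z * v $ i) ^ (\<alpha> $ i)))) (at z)"
    by (rule has_field_derivative_prod) (auto intro!: derivative_eq_intros)
  then show ?thesis
    unfolding monomial_def monomial_partial_def
    by (simp add: mult_ac)
qed

lemma monomial_partial_shift:
  "monomial_partial k (\<beta> + axis k 1) y = of_nat (\<beta> $ k + 1) * monomial \<beta> y"
proof -
  have "(\<Prod>i\<in>UNIV - {k}. (y $ i) ^ ((\<beta> + axis k 1) $ i)) = (\<Prod>i\<in>UNIV - {k}. (y $ i) ^ (\<beta> $ i))"
    by (rule prod.cong) (auto simp: axis_def)
  moreover have "monomial \<beta> y = (y $ k) ^ (\<beta> $ k) * (\<Prod>i\<in>UNIV - {k}. (y $ i) ^ (\<beta> $ i))"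
    unfolding monomial_def by (subst prod.remove[of _ k]) auto
  ultimately show ?thesis by (simp add: monomial_partial_def axis_def)
qed

text \<open>
  A power series may be differentiated term by term along complex lines: by the Weierstrass
  M-test its partial sums converge uniformly on a disc in the line, and then their derivatives
  converge inside the disc.
\<close>

lemma has_power_series_termwise_deriv:
  fixes f :: "complex ^ 'n \<Rightarrow> complex"
  assumes "has_power_series f x0 a"
  obtains \<rho> where "\<rho> > 0"
    "\<And>x v. x \<in> ball x0 \<rho> \<Longrightarrow> \<exists>D. ((\<lambda>t. f (x + t *s v)) has_field_derivative D) (at 0)
       \<and> ((\<lambda>\<alpha>. \<Sum>k\<in>UNIV. a \<alpha> * (v $ k * monomial_partial k \<alpha> (x - x0))) has_sum D) UNIV"
proof -
  obtain \<rho> where \<rho>: "\<rho> > 0" and S: "(\<lambda>\<alpha>. norm (a \<alpha>) * \<rho> ^ mdeg \<alpha>) summable_on UNIV"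
    and sums: "\<And>x. \<forall>i. norm ((x - x0) $ i) \<le> \<rho> \<Longrightarrow> ((\<lambda>\<alpha>. a \<alpha> * monomial \<alpha> (x - x0)) has_sum f x) UNIV"
    by (rule has_power_series_polydisc[OF assms]) (rule that)
  show ?thesis
  proof (rule that[of "\<rho> / 2"])
    fix x v :: "complex ^ 'n" assume x: "x \<in> ball x0 (\<rho> / 2)"
    define d where "d = \<rho> / (2 * (norm v + 1))"
    have d: "d > 0" using \<rho> by (auto simp: d_def add_nonneg_pos intro!: divide_pos_pos mult_pos_pos)
    define y where "y = x - x0"
    have le: "norm ((y + t *s v) $ i) \<le> \<rho>" if "t \<in> cball 0 d" for t i
    proof -
      have 1: "norm (y $ i) \<le> \<rho> / 2"
        using x Finite_Cartesian_Product.norm_nth_le[of y i] by (simp add: y_def dist_norm norm_minus_commute)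
      have 2: "norm t * norm (v $ i) \<le> d * (norm v + 1)"
        using that Finite_Cartesian_Product.norm_nth_le[of v i] d by (intro mult_mono) auto
      have "norm v + 1 > 0" by (simp add: add_nonneg_pos)
      then have "d * (norm v + 1) = \<rho> / 2" by (simp add: d_def field_simps)
      then show ?thesis
        using 1 2 norm_triangle_ineq[of "y $ i" "t * v $ i"] by (simp add: norm_mult)
    qed
    define f' where "f' = (\<lambda>A w. \<Sum>\<alpha>\<in>A. a \<alpha> * (\<Sum>k\<in>UNIV. v $ k * monomial_partial k \<alpha> (y + w *s v)))"
    have ulim: "uniform_limit (cball 0 d) (\<lambda>A t. \<Sum>\<alpha>\<in>A. a \<alpha> * monomial \<alpha> (y + t *s v))
         (\<lambda>t. f (x + t *s v)) (finite_subsets_at_top UNIV)"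
    proof (rule Weierstrass_m_test_general'[OF _ _ S])
      fix \<alpha> :: "nat ^ 'n" and t :: complex assume "t \<in> cball 0 d"
      then show "norm (a \<alpha> * monomial \<alpha> (y + t *s v)) \<le> norm (a \<alpha>) * \<rho> ^ mdeg \<alpha>"
        by (auto simp: norm_mult simp del: mem_cball vector_add_component intro!: mult_left_mono norm_monomial_le le)
    next
      fix t :: complex assume "t \<in> cball 0 d"
      then show "((\<lambda>\<alpha>. a \<alpha> * monomial \<alpha> (y + t *s v)) has_sum f (x + t *s v)) UNIV"
        using sums[of "x + t *s v"] le[of t] by (simp add: y_def algebra_simps)
    qed
    have D: "((\<lambda>t. \<Sum>\<alpha>\<in>A. a \<alpha> * monomial \<alpha> (y + t *s v)) has_field_derivative f' A w) (at w)" for A w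
      unfolding f'_def by (intro DERIV_sum DERIV_cmult monomial_line_deriv)
    obtain g' where "\<And>w. w \<in> ball 0 d \<Longrightarrow> ((\<lambda>t. f (x + t *s v)) has_field_derivative (g' w)) (at w)
        \<and> ((\<lambda>A. f' A w) \<longlongrightarrow> g' w) (finite_subsets_at_top UNIV)"
    proof (rule has_complex_derivative_uniform_limit[OF _ ulim _ d])
      show "\<forall>\<^sub>F A in finite_subsets_at_top UNIV. continuous_on (cball 0 d)
          (\<lambda>t. \<Sum>\<alpha>\<in>A. a \<alpha> * monomial \<alpha> (y + t *s v)) \<and>
          (\<forall>w\<in>ball 0 d. ((\<lambda>t. \<Sum>\<alpha>\<in>A. a \<alpha> * monomial \<alpha> (y + t *s v)) has_field_derivative f' A w) (at w))"
        by (intro always_eventually allI conjI ballI D DERIV_continuous_on[where D="f' _"])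
           (auto intro: has_field_derivative_at_within D)
    qed auto
    then have "((\<lambda>t. f (x + t *s v)) has_field_derivative (g' 0)) (at 0)"
        "((\<lambda>A. f' A 0) \<longlongrightarrow> g' 0) (finite_subsets_at_top UNIV)"
      using d by auto
    then show "\<exists>D. ((\<lambda>t. f (x + t *s v)) has_field_derivative D) (at 0)
       \<and> ((\<lambda>\<alpha>. \<Sum>k\<in>UNIV. a \<alpha> * (v $ k * monomial_partial k \<alpha> (x - x0))) has_sum D) UNIV"
      by (intro exI[of _ "g' 0"]) (simp add: has_sum_def f'_def y_def sum_distrib_left)
  qed (use \<rho> in auto)
qed

lemma has_sum_finite_sum:
  fixes g :: "'a \<Rightarrow> 'b \<Rightarrow> complex"
  assumes "finite K" "\<And>k. k \<in> K \<Longrightarrow> ((\<lambda>x. g x k) has_sum s k) A"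
  shows "((\<lambda>x. \<Sum>k\<in>K. g x k) has_sum (\<Sum>k\<in>K. s k)) A"
  using assms by (induction K rule: finite_induct) (auto intro!: has_sum_add)

text \<open>
  Basis vectors as directions identify the termwise derivatives with the partial derivatives; the
  derivative in a general direction is linear in the direction because each of its terms is.
\<close>

lemma has_power_series_partial_sum:
  fixes f :: "complex ^ 'n \<Rightarrow> complex"
  assumes "has_power_series f x0 a"
  obtains \<rho> where "\<rho> > 0"
    "\<And>x k. x \<in> ball x0 \<rho> \<Longrightarrow> ((\<lambda>\<alpha>. a \<alpha> * monomial_partial k \<alpha> (x - x0)) has_sum partial k f x) UNIV"
    "\<And>x v. x \<in> ball x0 \<rho> \<Longrightarrow>
       ((\<lambda>t. f (x + t *s v)) has_field_derivative (\<Sum>k\<in>UNIV. v $ k * partial k f x)) (at 0)"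
proof -
  obtain \<rho> where \<rho>: "\<rho> > 0" and
    D: "\<And>x v. x \<in> ball x0 \<rho> \<Longrightarrow> \<exists>D. ((\<lambda>t. f (x + t *s v)) has_field_derivative D) (at 0)
       \<and> ((\<lambda>\<alpha>. \<Sum>k\<in>UNIV. a \<alpha> * (v $ k * monomial_partial k \<alpha> (x - x0))) has_sum D) UNIV"
    by (rule has_power_series_termwise_deriv[OF assms]) (rule that)
  have P: "((\<lambda>\<alpha>. a \<alpha> * monomial_partial k \<alpha> (x - x0)) has_sum partial k f x) UNIV"
    if x: "x \<in> ball x0 \<rho>" for x k
  proof -
    obtain E where E: "((\<lambda>t. f (x + t *s axis k 1)) has_field_derivative E) (at 0)"
      "((\<lambda>\<alpha>. \<Sum>j\<in>UNIV. a \<alpha> * (axis k 1 $ j * monomial_partial j \<alpha> (x - x0))) has_sum E) UNIV"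
      using D[OF x, of "axis k 1"] by blast
    have "(\<Sum>j\<in>UNIV. a \<alpha> * (axis k 1 $ j * monomial_partial j \<alpha> (x - x0)))
        = a \<alpha> * monomial_partial k \<alpha> (x - x0)" for \<alpha>
      by (subst sum.remove[of _ k]) (auto simp: axis_def intro!: sum.neutral)
    moreover have "partial k f x = E"
      unfolding partial_def using E(1) by (rule DERIV_imp_deriv)
    ultimately show ?thesis using E(2) by simp
  qed
  show ?thesis
  proof (rule that[OF \<rho> P])
    fix x v :: "complex ^ 'n" assume x: "x \<in> ball x0 \<rho>"
    obtain E where E: "((\<lambda>t. f (x + t *s v)) has_field_derivative E) (at 0)"
      "((\<lambda>\<alpha>. \<Sum>k\<in>UNIV. a \<alpha> * (v $ k * monomial_partial k \<alpha> (x - x0))) has_sum E) UNIV"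
      using D[OF x] by blast
    have "((\<lambda>\<alpha>. \<Sum>k\<in>UNIV. v $ k * (a \<alpha> * monomial_partial k \<alpha> (x - x0))) has_sum
        (\<Sum>k\<in>UNIV. v $ k * partial k f x)) UNIV"
      by (intro has_sum_finite_sum has_sum_cmult_right P x) auto
    then have "E = (\<Sum>k\<in>UNIV. v $ k * partial k f x)"
      by (intro has_sum_unique[OF E(2)]) (simp add: mult.left_commute)
    then show "((\<lambda>t. f (x + t *s v)) has_field_derivative (\<Sum>k\<in>UNIV. v $ k * partial k f x)) (at 0)"
      using E(1) by simp
  qed
qed

lemma analytic_Cn_line_deriv:
  assumes "analytic_Cn f S" "x \<in> S"
  shows "((\<lambda>t. f (x + t *s v)) has_field_derivative (\<Sum>k\<in>UNIV. v $ k * partial k f x)) (at 0)"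
proof -
  obtain a where "has_power_series f x a" using assms by (auto simp: analytic_Cn_def)
  then show ?thesis
    by (rule has_power_series_partial_sum) (use centre_in_ball in blast)
qed

text \<open>
  The terms of the differentiated series that contain no \<open>x\<^sub>k\<close> vanish, and the others are
  reindexed by lowering the exponent of \<open>x\<^sub>k\<close> by one.
\<close>

lemma analytic_Cn_partial:
  fixes f :: "complex ^ 'n \<Rightarrow> complex"
  assumes "analytic_Cn f S"
  shows "analytic_Cn (partial k f) S"
  unfolding analytic_Cn_def
proof
  fix x0 assume "x0 \<in> S"
  then obtain a where "has_power_series f x0 a" using assms by (auto simp: analytic_Cn_def)
  then obtain \<rho> where \<rho>: "\<rho> > 0" and
    P: "\<And>x. x \<in> ball x0 \<rho> \<Longrightarrow> ((\<lambda>\<alpha>. a \<alpha> * monomial_partial k \<alpha> (x - x0)) has_sum partial k f x) UNIV"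
    by (rule has_power_series_partial_sum) blast
  define b where "b = (\<lambda>\<beta>. a (\<beta> + axis k 1) * of_nat (\<beta> $ k + 1))"
  have "((\<lambda>\<beta>. b \<beta> * monomial \<beta> (x - x0)) has_sum partial k f x) UNIV" if "x \<in> ball x0 \<rho>" for x
  proof -
    let ?h = "\<lambda>\<beta> :: nat ^ 'n. \<beta> + axis k 1"
    have zero: "monomial_partial k \<alpha> (x - x0) = 0" if "\<alpha> \<notin> range ?h" for \<alpha>
    proof -
      have "\<alpha> $ k = 0"
      proof (rule ccontr)
        assume "\<alpha> $ k \<noteq> 0"
        then have "\<alpha> = ?h (\<chi> i. \<alpha> $ i - (if i = k then 1 else 0))"
          by (auto simp: vec_eq_iff axis_def)
        then show False using that by blast
      qed
      then show ?thesis by (simp add: monomial_partial_def)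
    qed
    have "((\<lambda>\<alpha>. a \<alpha> * monomial_partial k \<alpha> (x - x0)) has_sum partial k f x) (range ?h)"
      using P[OF that] by (subst has_sum_cong_neutral[where T=UNIV]) (auto simp: zero)
    moreover have "inj ?h" by (auto simp: inj_def)
    ultimately show ?thesis
      by (subst (asm) has_sum_reindex) (simp_all add: o_def monomial_partial_shift b_def mult_ac del: One_nat_def)
  qed
  then show "\<exists>b. has_power_series (partial k f) x0 b"
    unfolding has_power_series_def using \<rho> by blast
qed

section \<open>Bounded partial derivatives and the Hamiltonian vector field\<close>

text \<open>
  Complex differentiability in every direction with a derivative that is linear in the direction.
  In this form analyticity enters, both for the vector field along segments and for the
  solutions along characteristics.
\<close>

definition partials_along_lines :: "(complex ^ 'n \<Rightarrow> complex) \<Rightarrow> complex ^ 'n \<Rightarrow> bool" where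
  "partials_along_lines f x \<longleftrightarrow>
     (\<forall>v. ((\<lambda>t. f (x + t *s v)) has_field_derivative (\<Sum>k\<in>UNIV. v $ k * partial k f x)) (at 0))"

lemma partials_along_lines_at:
  assumes "partials_along_lines f (x + z *s v)"
  shows "((\<lambda>t. f (x + t *s v)) has_field_derivative (\<Sum>k\<in>UNIV. v $ k * partial k f (x + z *s v))) (at z)"
proof -
  have "((\<lambda>t. f (x + z *s v + t *s v)) has_field_derivative (\<Sum>k\<in>UNIV. v $ k * partial k f (x + z *s v))) (at 0)"
    using assms by (simp add: partials_along_lines_def)
  moreover have "x + z *s v + t *s v = x + (t + z) *s v" for t
    by (simp add: vec_eq_iff algebra_simps)
  ultimately show ?thesis
    using DERIV_shift[of "\<lambda>t. f (x + t *s v)" _ 0 z] by simp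
qed

lemma eventually_line_in_open:
  fixes x v :: "complex ^ 'n"
  assumes "open S" "x \<in> S"
  shows "\<forall>\<^sub>F t in nhds 0. x + t *s v \<in> S"
proof -
  have "continuous_on UNIV (\<lambda>t. x + t *s v)"
    unfolding vector_scalar_mult_def by (intro continuous_intros continuous_on_vec_lambda)
  then have "open ((\<lambda>t. x + t *s v) -` S)" using assms by (intro open_vimage)
  moreover have "0 \<in> (\<lambda>t. x + t *s v) -` S" using assms by simp
  ultimately have "\<forall>\<^sub>F t in nhds 0. t \<in> (\<lambda>t. x + t *s v) -` S" by (rule eventually_nhds_in_open)
  then show ?thesis by simp
qed

text \<open>
  The functions with bounded partial derivatives up to order \<open>m\<close>. Unlike the existence of a
  power series about each point, this property passes to sums and products by the
  Leibniz rule alone, so that it is easily inherited by the Hamiltonian.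
\<close>

primrec bounded_partials :: "nat \<Rightarrow> (complex ^ 'n \<Rightarrow> complex) \<Rightarrow> (complex ^ 'n) set \<Rightarrow> bool" where
  "bounded_partials 0 f S \<longleftrightarrow> bounded (f ` S)"
| "bounded_partials (Suc m) f S \<longleftrightarrow> bounded (f ` S) \<and> (\<forall>x\<in>S. partials_along_lines f x) \<and>
     (\<forall>k. bounded_partials m (partial k f) S)"

lemma bounded_partials_bounded: "bounded_partials m f S \<Longrightarrow> bounded (f ` S)"
  by (cases m) auto

lemma bounded_partials_SucD: "bounded_partials (Suc m) f S \<Longrightarrow> bounded_partials m f S"
  by (induction m arbitrary: f) auto

lemma bounded_partials_mono: "bounded_partials m f S \<Longrightarrow> T \<subseteq> S \<Longrightarrow> bounded_partials m f T"
  by (induction m arbitrary: f) (auto intro: bounded_subset image_mono)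

lemma partials_along_lines_cong:
  fixes f g :: "complex ^ 'n \<Rightarrow> complex"
  assumes "open S" "x \<in> S" "\<And>x. x \<in> S \<Longrightarrow> f x = g x"
  shows "partial k f x = partial k g x" "partials_along_lines f x \<longleftrightarrow> partials_along_lines g x"
proof -
  have ev: "\<forall>\<^sub>F t in nhds 0. f (x + t *s v) = g (x + t *s v)" for v
    by (rule eventually_mono[OF eventually_line_in_open[OF assms(1,2)]]) (rule assms(3))
  then have p: "partial k f x = partial k g x" for k
    unfolding partial_def by (intro deriv_cong_ev) auto
  show "partial k f x = partial k g x" by (rule p)
  show "partials_along_lines f x \<longleftrightarrow> partials_along_lines g x"
    unfolding partials_along_lines_def p using DERIV_cong_ev[OF refl ev refl] by simp
qed

lemma bounded_partials_cong:
  assumes "open S" "\<And>x. x \<in> S \<Longrightarrow> f x = g x" "bounded_partials m f S"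
  shows "bounded_partials m g S"
  using assms
proof (induction m arbitrary: f g)
  case 0
  then show ?case by (metis bounded_partials.simps(1) image_cong)
next
  case (Suc m)
  have "bounded_partials m (partial k g) S" for k
    by (rule Suc.IH[of "partial k f"])
       (use Suc.prems partials_along_lines_cong(1)[OF Suc.prems(1) _ Suc.prems(2)] in auto)
  moreover have "f ` S = g ` S" using Suc.prems(2) by (rule image_cong[OF refl])
  ultimately show ?case
    using Suc.prems partials_along_lines_cong(2)[OF Suc.prems(1) _ Suc.prems(2)] by auto
qed

lemma partial_eqI:
  assumes "((\<lambda>t. f (x + t *s axis k 1)) has_field_derivative D) (at 0)"
  shows "partial k f x = D"
  unfolding partial_def using assms by (rule DERIV_imp_deriv)

lemma sum_axis_1: "(\<Sum>j\<in>UNIV. axis k 1 $ j * g j) = (g k :: complex)"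
  by (subst sum.remove[of _ k]) (auto simp: axis_def intro!: sum.neutral)

lemma partials_along_lines_add:
  assumes "partials_along_lines f x" "partials_along_lines g x"
  shows "partial k (\<lambda>x. f x + g x) x = partial k f x + partial k g x"
    "partials_along_lines (\<lambda>x. f x + g x) x"
proof -
  have D: "((\<lambda>t. f (x + t *s v) + g (x + t *s v)) has_field_derivative
      (\<Sum>k\<in>UNIV. v $ k * (partial k f x + partial k g x))) (at 0)" for v
    using DERIV_add[of "\<lambda>t. f (x + t *s v)" _ 0 UNIV "\<lambda>t. g (x + t *s v)"] assms
    by (simp add: partials_along_lines_def sum.distrib distrib_left)
  have p: "partial k (\<lambda>x. f x + g x) x = partial k f x + partial k g x" for k
    using D[of "axis k 1"] by (intro partial_eqI) (simp only: sum_axis_1)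
  then show "partial k (\<lambda>x. f x + g x) x = partial k f x + partial k g x" .
  show "partials_along_lines (\<lambda>x. f x + g x) x"
    unfolding partials_along_lines_def p using D by blast
qed

lemma partials_along_lines_mult:
  assumes "partials_along_lines f x" "partials_along_lines g x"
  shows "partial k (\<lambda>x. f x * g x) x = partial k f x * g x + f x * partial k g x"
    "partials_along_lines (\<lambda>x. f x * g x) x"
proof -
  have D: "((\<lambda>t. f (x + t *s v) * g (x + t *s v)) has_field_derivative
      (\<Sum>k\<in>UNIV. v $ k * (partial k f x * g x + f x * partial k g x))) (at 0)" for v
  proof (rule DERIV_cong[OF DERIV_mult])
    show "((\<lambda>t. f (x + t *s v)) has_field_derivative (\<Sum>k\<in>UNIV. v $ k * partial k f x)) (at 0)"
      "((\<lambda>t. g (x + t *s v)) has_field_derivative (\<Sum>k\<in>UNIV. v $ k * partial k g x)) (at 0)"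
      using assms by (auto simp: partials_along_lines_def)
  qed (simp add: sum.distrib distrib_left sum_distrib_left mult_ac)
  have p: "partial k (\<lambda>x. f x * g x) x = partial k f x * g x + f x * partial k g x" for k
    using D[of "axis k 1"] by (intro partial_eqI) (simp only: sum_axis_1)
  then show "partial k (\<lambda>x. f x * g x) x = partial k f x * g x + f x * partial k g x" .
  show "partials_along_lines (\<lambda>x. f x * g x) x"
    unfolding partials_along_lines_def p using D by blast
qed

lemma bounded_image_mult:
  fixes f g :: "'a \<Rightarrow> complex"
  assumes "bounded (f ` S)" "bounded (g ` S)"
  shows "bounded ((\<lambda>x. f x * g x) ` S)"
proof -
  obtain A B where "\<forall>x\<in>S. norm (f x) \<le> A" "\<forall>x\<in>S. norm (g x) \<le> B"
    using assms by (auto simp: bounded_iff)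
  then have "\<forall>x\<in>S. norm (f x * g x) \<le> A * B"
    by (metis mult_mono' norm_ge_zero norm_mult)
  then show ?thesis by (auto simp: bounded_iff)
qed

lemma bounded_partials_add:
  assumes "open S" "bounded_partials m f S" "bounded_partials m g S"
  shows "bounded_partials m (\<lambda>x. f x + g x) S"
  using assms(2,3)
proof (induction m arbitrary: f g)
  case (Suc m)
  have "bounded_partials m (partial k (\<lambda>x. f x + g x)) S" for k
  proof (rule bounded_partials_cong[OF assms(1)])
    show "bounded_partials m (\<lambda>x. partial k f x + partial k g x) S"
      using Suc by simp
  qed (use Suc.prems in \<open>simp add: partials_along_lines_add\<close>)
  then show ?case using Suc.prems by (simp add: partials_along_lines_add bounded_plus_comp)
qed (simp add: bounded_plus_comp)

lemma bounded_partials_mult: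
  assumes "open S" "bounded_partials m f S" "bounded_partials m g S"
  shows "bounded_partials m (\<lambda>x. f x * g x) S"
  using assms(2,3)
proof (induction m arbitrary: f g)
  case (Suc m)
  have "bounded_partials m (partial k (\<lambda>x. f x * g x)) S" for k
  proof (rule bounded_partials_cong[OF assms(1)])
    show "bounded_partials m (\<lambda>x. partial k f x * g x + f x * partial k g x) S"
      using Suc bounded_partials_SucD[OF Suc.prems(1)] bounded_partials_SucD[OF Suc.prems(2)]
      by (intro bounded_partials_add[OF assms(1)] Suc.IH) auto
  qed (use Suc.prems in \<open>simp add: partials_along_lines_mult\<close>)
  then show ?case using Suc.prems by (simp add: partials_along_lines_mult bounded_image_mult)
qed (simp add: bounded_image_mult)

lemma bounded_partials_const: "bounded_partials m (\<lambda>x. c) S"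
proof (induction m arbitrary: c)
  case (Suc m)
  have p: "partial k (\<lambda>x::complex^'n. c) = (\<lambda>x. 0)" for k by (auto simp: partial_def)
  show ?case using Suc by (auto simp: p partials_along_lines_def image_constant_conv)
qed (auto simp: image_constant_conv)

lemma bounded_partials_coord:
  fixes S :: "(complex ^ 'n) set"
  assumes "bounded S"
  shows "bounded_partials m (\<lambda>x. x $ i) S"
proof -
  have b: "bounded ((\<lambda>x. x $ i) ` S)"
    using assms Finite_Cartesian_Product.norm_nth_le order_trans unfolding bounded_iff by blast
  have D: "((\<lambda>t. (x + t *s v) $ i) has_field_derivative v $ i) (at 0)" for x v :: "complex ^ 'n"
    by (auto intro!: derivative_eq_intros)
  have p: "partial k (\<lambda>x::complex^'n. x $ i) = (\<lambda>x. axis k 1 $ i)" for k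
    by (rule ext, rule partial_eqI, rule D)
  have "(\<Sum>k\<in>UNIV. v $ k * (axis k 1 :: complex ^ 'n) $ i) = v $ i" for v :: "complex ^ 'n"
    by (subst sum.remove[of _ i]) (auto simp: axis_def intro!: sum.neutral)
  then have "partials_along_lines (\<lambda>x. x $ i) x" for x :: "complex ^ 'n"
    unfolding partials_along_lines_def p using D by simp
  then show ?thesis using b by (cases m) (auto simp: p bounded_partials_const)
qed

lemma analytic_Cn_bounded_partials:
  fixes f :: "complex ^ 'n \<Rightarrow> complex"
  assumes "open V" "x0 \<in> V" "analytic_Cn f V"
  obtains \<rho> where "\<rho> > 0" "bounded_partials m f (ball x0 \<rho>)"
proof -
  have "\<exists>\<rho>>0. ball x0 \<rho> \<subseteq> V \<and> bounded_partials m f (ball x0 \<rho>)"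
    using assms(3)
  proof (induction m arbitrary: f)
    case (0 f)
    obtain a where "has_power_series f x0 a" using 0 assms by (auto simp: analytic_Cn_def)
    then obtain \<rho> where \<rho>: "\<rho> > 0" "bounded (f ` ball x0 \<rho>)" by (rule has_power_series_bounded_near)
    obtain e where e: "e > 0" "ball x0 e \<subseteq> V" using assms openE by blast
    have "bounded (f ` ball x0 (min \<rho> e))"
      by (rule bounded_subset[OF \<rho>(2)]) auto
    moreover have "ball x0 (min \<rho> e) \<subseteq> V" using e by auto
    ultimately show ?case using \<rho> e by (intro exI[of _ "min \<rho> e"]) auto
  next
    case (Suc m)
    have "\<forall>k. \<exists>\<rho>>0. ball x0 \<rho> \<subseteq> V \<and> bounded_partials m (partial k f) (ball x0 \<rho>)"
      using Suc.IH[OF analytic_Cn_partial[OF Suc.prems]] by blast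
    then obtain R where R: "\<And>k. R k > 0" "\<And>k. bounded_partials m (partial k f) (ball x0 (R k))"
      by metis
    obtain \<rho> where \<rho>: "\<rho> > 0" "ball x0 \<rho> \<subseteq> V" "bounded_partials m f (ball x0 \<rho>)"
      using Suc.IH[OF Suc.prems] by blast
    define e where "e = Min (insert \<rho> (range R))"
    have e: "e > 0" "e \<le> \<rho>" "e \<le> R k" for k
      using R(1) \<rho>(1) unfolding e_def by (auto intro: Min_le simp del: Min_insert simp: Min_gr_iff)
    have "bounded (f ` ball x0 e)"
      using bounded_partials_bounded[OF \<rho>(3)] by (rule bounded_subset) (use e in auto)
    moreover have V: "ball x0 e \<subseteq> V" using \<rho>(2) e(2) by force
    moreover have "partials_along_lines f x" if "x \<in> ball x0 e" for x
      unfolding partials_along_lines_def using analytic_Cn_line_deriv[OF Suc.prems] V that by blast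
    moreover have "bounded_partials m (partial k f) (ball x0 e)" for k
      by (rule bounded_partials_mono[OF R(2)]) (rule subset_ball[OF e(3)])
    ultimately show ?case using e(1) by auto
  qed
  then show ?thesis using that by blast
qed

text \<open>
  One-variable Taylor expansion along the segment from \<open>x\<close> to \<open>y\<close>, whose second derivative is a
  quadratic form in \<open>y - x\<close> with bounded coefficients.
\<close>

lemma bounded_partials_Taylor1:
  fixes f :: "complex ^ 'n \<Rightarrow> complex"
  assumes "bounded_partials 2 f S" "convex S"
  obtains C where "\<And>x y. x \<in> S \<Longrightarrow> y \<in> S \<Longrightarrow>
    norm (f y - f x - (\<Sum>k\<in>UNIV. (y - x) $ k * partial k f x)) \<le> C * (norm (y - x))\<^sup>2"
proof -
  have P: "\<And>x. x \<in> S \<Longrightarrow> partials_along_lines f x"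
    "\<And>x k. x \<in> S \<Longrightarrow> partials_along_lines (partial k f) x"
    "\<And>k l. bounded (partial l (partial k f) ` S)"
    using assms(1) by (auto simp: numeral_2_eq_2)
  have "\<forall>k l. \<exists>B. \<forall>x\<in>S. norm (partial l (partial k f) x) \<le> B"
    using P(3) by (auto simp: bounded_iff)
  then obtain B where B: "\<And>k l x. x \<in> S \<Longrightarrow> norm (partial l (partial k f) x) \<le> B k l"
    by metis
  define C where "C = (\<Sum>k\<in>UNIV. \<Sum>l\<in>UNIV. B k l)"
  show ?thesis
  proof (rule that[of C])
    fix x y assume xy: "x \<in> S" "y \<in> S"
    define v where "v = y - x"
    define F where "F = (\<lambda>i::nat. if i = 0 then (\<lambda>t. f (x + t *s v))
      else if i = 1 then (\<lambda>t. \<Sum>k\<in>UNIV. v $ k * partial k f (x + t *s v))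
      else (\<lambda>t. \<Sum>k\<in>UNIV. v $ k * (\<Sum>l\<in>UNIV. v $ l * partial l (partial k f) (x + t *s v))))"
    have inS: "x + t *s v \<in> S" if t: "t \<in> closed_segment 0 1" for t
    proof -
      obtain u where u: "0 \<le> u" "u \<le> 1" "t = of_real u" using t that by (auto simp: in_segment scaleR_conv_of_real)
      have "x + t *s v = (1 - u) *\<^sub>R x + u *\<^sub>R y"
        by (simp add: vec_eq_iff v_def u(3)) (simp add: scaleR_conv_of_real algebra_simps)
      then show ?thesis using convexD_alt[OF assms(2) xy u(1,2)] by simp
    qed
    have "norm (F 0 1 - (\<Sum>i\<le>1. F i 0 * (1 - 0) ^ i / fact i)) \<le> (C * (norm v)\<^sup>2) * norm (1 - 0 :: complex) ^ Suc 1 / fact 1"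
    proof (rule complex_Taylor)
      show "convex (closed_segment (0::complex) 1)" by simp
      fix i :: nat and t :: complex assume t: "t \<in> closed_segment 0 1"
      show "(F i has_field_derivative F (Suc i) t) (at t within closed_segment 0 1)" if "i \<le> 1"
      proof (rule has_field_derivative_at_within, cases "i = 0")
        case True
        then show "(F i has_field_derivative F (Suc i) t) (at t)"
          unfolding F_def using partials_along_lines_at[OF P(1)[OF inS[OF t]]] by simp
      next
        case False
        then have "i = 1" using that by simp
        then show "(F i has_field_derivative F (Suc i) t) (at t)"
          unfolding F_def
          by (auto intro!: DERIV_sum DERIV_cmult partials_along_lines_at[OF P(2)[OF inS[OF t]]])
      qed
      have "norm (F (Suc 1) t) \<le> (\<Sum>k\<in>UNIV. norm v * (\<Sum>l\<in>UNIV. norm v * B k l))"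
        unfolding F_def
        by (auto simp: norm_mult intro!: sum_norm_le mult_mono B inS t Finite_Cartesian_Product.norm_nth_le)
      also have "\<dots> = C * (norm v)\<^sup>2"
        by (simp add: C_def power2_eq_square sum_distrib_left sum_distrib_right mult_ac)
      finally show "norm (F (Suc 1) t) \<le> C * (norm v)\<^sup>2" .
    qed auto
    moreover have "x + v = y" by (simp add: v_def)
    ultimately show "norm (f y - f x - (\<Sum>k\<in>UNIV. (y - x) $ k * partial k f x)) \<le> C * (norm (y - x))\<^sup>2"
      by (simp add: F_def v_def[symmetric] algebra_simps)
  qed
qed

text \<open>
  The polynomial part of the Hamiltonian is assembled from coordinates by sums and products, the rest
  is analytic near the origin.
\<close>

lemma bounded_partials_Ham:
  assumes "open V" "0 \<in> V" "analytic_Cn F V"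
  obtains \<rho> where "\<rho> > 0" "bounded_partials m (Ham \<eta> F) (ball 0 \<rho>)"
proof -
  obtain \<rho> where \<rho>: "\<rho> > 0" "bounded_partials m F (ball 0 \<rho>)"
    using analytic_Cn_bounded_partials[OF assms] .
  have *: "Ham \<eta> F = (\<lambda>x. (- 1) * (x $ 2 * x $ 3) + x $ 1 * x $ 4 + (1 / 2) * (x $ 1 * x $ 1 + x $ 2 * x $ 2)
     + (\<eta> / 4) * ((x $ 3 * x $ 3 + x $ 4 * x $ 4) * (x $ 3 * x $ 3 + x $ 4 * x $ 4)) + F x)"
    by (auto simp: Ham_def I1_def I2_def I3_def power2_eq_square algebra_simps add_divide_distrib)
  have "bounded_partials m (Ham \<eta> F) (ball 0 \<rho>)"
    unfolding * by (intro bounded_partials_add bounded_partials_mult bounded_partials_const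
      bounded_partials_coord \<rho> bounded_ball open_ball)
  then show ?thesis using that \<rho>(1) by blast
qed

lemma vector_4_nth:
  "(vector [a, b, c, d] :: ('a::zero) ^ 4) $ 1 = a" "(vector [a, b, c, d] :: 'a ^ 4) $ 2 = b"
  "(vector [a, b, c, d] :: 'a ^ 4) $ 3 = c" "(vector [a, b, c, d] :: 'a ^ 4) $ 4 = d"
  unfolding vector_def by simp_all

lemma X_H_nth:
  "X_H H x $ 1 = partial 3 H x" "X_H H x $ 2 = partial 4 H x"
  "X_H H x $ 3 = - partial 1 H x" "X_H H x $ 4 = - partial 2 H x"
  by (simp_all add: X_H_def vector_4_nth)

text \<open>
  The components of \<open>X\<^sub>H\<close> are first derivatives of \<open>H\<close>, so three bounded derivatives of \<open>H\<close>
  control the second-order Taylor remainder of the vector field.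
\<close>

lemma X_H_quadratic_remainder:
  assumes "open V" "0 \<in> V" "analytic_Cn F V"
  obtains \<rho> C where "\<rho> > 0" "C \<ge> 0" "\<And>x y. x \<in> ball 0 \<rho> \<Longrightarrow> y \<in> ball 0 \<rho> \<Longrightarrow>
    norm (X_H (Ham \<eta> F) y - X_H (Ham \<eta> F) x - DX_H (Ham \<eta> F) x *v (y - x)) \<le> C * (norm (y - x))\<^sup>2"
proof -
  let ?H = "Ham \<eta> F"
  obtain \<rho> where \<rho>: "\<rho> > 0" "bounded_partials 3 ?H (ball 0 \<rho>)"
    using bounded_partials_Ham[OF assms] .
  then have P: "bounded_partials 2 (partial k ?H) (ball 0 \<rho>)" for k
    by (simp add: numeral_3_eq_3 numeral_2_eq_2)
  have Pm: "bounded_partials 2 (\<lambda>x. - partial k ?H x) (ball 0 \<rho>)" for k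
    using bounded_partials_mult[OF open_ball bounded_partials_const[of 2 "-1"] P] by simp
  have X: "bounded_partials 2 (\<lambda>x. X_H ?H x $ i) (ball 0 \<rho>)" for i
    using exhaust_4[of i] P Pm by (auto simp: X_H_nth)
  have "\<exists>C. \<forall>x\<in>ball 0 \<rho>. \<forall>y\<in>ball 0 \<rho>. norm (X_H ?H y $ i - X_H ?H x $ i
     - (\<Sum>k\<in>UNIV. (y - x) $ k * partial k (\<lambda>x. X_H ?H x $ i) x)) \<le> C * (norm (y - x))\<^sup>2" for i
    by (rule bounded_partials_Taylor1[OF X[of i] convex_ball]) blast
  then have "\<exists>C. \<forall>i. \<forall>x\<in>ball 0 \<rho>. \<forall>y\<in>ball 0 \<rho>. norm (X_H ?H y $ i - X_H ?H x $ i
     - (\<Sum>k\<in>UNIV. (y - x) $ k * partial k (\<lambda>x. X_H ?H x $ i) x)) \<le> C i * (norm (y - x))\<^sup>2"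
    by (intro choice allI)
  then obtain C where C: "\<And>i x y. x \<in> ball 0 \<rho> \<Longrightarrow> y \<in> ball 0 \<rho> \<Longrightarrow> norm (X_H ?H y $ i - X_H ?H x $ i
     - (\<Sum>k\<in>UNIV. (y - x) $ k * partial k (\<lambda>x. X_H ?H x $ i) x)) \<le> C i * (norm (y - x))\<^sup>2"
    by blast
  show ?thesis
  proof (rule that[of \<rho> "\<Sum>i\<in>UNIV. \<bar>C i\<bar>"])
    fix x y :: "complex ^ 4" assume xy: "x \<in> ball 0 \<rho>" "y \<in> ball 0 \<rho>"
    have "norm (X_H ?H y - X_H ?H x - DX_H ?H x *v (y - x))
       \<le> (\<Sum>i\<in>UNIV. norm ((X_H ?H y - X_H ?H x - DX_H ?H x *v (y - x)) $ i))"
      by (rule norm_le_sum_norm_vec)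
    also have "\<dots> \<le> (\<Sum>i\<in>UNIV. \<bar>C i\<bar> * (norm (y - x))\<^sup>2)"
    proof (rule sum_mono)
      fix i
      have "(X_H ?H y - X_H ?H x - DX_H ?H x *v (y - x)) $ i = X_H ?H y $ i - X_H ?H x $ i
         - (\<Sum>k\<in>UNIV. (y - x) $ k * partial k (\<lambda>x. X_H ?H x $ i) x)"
        by (simp add: DX_H_def matrix_vector_mult_def mult.commute)
      also have "norm \<dots> \<le> C i * (norm (y - x))\<^sup>2" by (rule C[OF xy])
      also have "\<dots> \<le> \<bar>C i\<bar> * (norm (y - x))\<^sup>2" by (intro mult_right_mono) auto
      finally show "norm ((X_H ?H y - X_H ?H x - DX_H ?H x *v (y - x)) $ i) \<le> \<bar>C i\<bar> * (norm (y - x))\<^sup>2" .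
    qed
    finally show "norm (X_H ?H y - X_H ?H x - DX_H ?H x *v (y - x)) \<le> (\<Sum>i\<in>UNIV. \<bar>C i\<bar>) * (norm (y - x))\<^sup>2"
      by (simp only: sum_distrib_right)
  qed (auto intro!: sum_nonneg \<rho>)
qed

section \<open>Small solutions of quadratic differential inequalities\<close>

text \<open>
  Let \<open>M\<close> be the maximum of \<open>\<parallel>y\<parallel>\<close>. Any two values of \<open>y\<close> differ by at most \<open>B M\<^sup>2 \<le> M / 2\<close>, so that
  \<open>M\<close> is at most twice the norm of \<open>y\<close> at either end. A small solution of a quadratic
  differential inequality is therefore constant up to the square of any one of its values.
\<close>

lemma quadratic_ode_increment:
  fixes y :: "real \<Rightarrow> 'a::real_normed_vector"
  assumes deriv: "\<And>x. x \<in> {0..1} \<Longrightarrow> (y has_vector_derivative y' x) (at x within {0..1})"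
    and bound: "\<And>x. x \<in> {0..1} \<Longrightarrow> norm (y' x) \<le> B * (norm (y x))\<^sup>2"
    and small: "\<And>x. x \<in> {0..1} \<Longrightarrow> B * norm (y x) \<le> 1 / 2" and "B \<ge> 0"
  shows "norm (y 1 - y 0) \<le> 4 * B * (norm (y 0))\<^sup>2" "norm (y 1 - y 0) \<le> 4 * B * (norm (y 1))\<^sup>2"
proof -
  have "continuous_on {0..1} (\<lambda>x. norm (y x))"
    by (intro continuous_on_norm continuous_on_vector_derivative[of "{0..1}" y y'] deriv)
  then have "\<exists>c\<in>{0..1}. \<forall>x\<in>{0..1}. norm (y x) \<le> norm (y c)"
    by (intro continuous_attains_sup) auto
  then obtain c where c: "c \<in> {0..1}" "\<And>x. x \<in> {0..1} \<Longrightarrow> norm (y x) \<le> norm (y c)"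
    by blast
  define M where "M = norm (y c)"
  have M: "0 \<le> M" by (simp add: M_def)
  have lip: "norm (y a - y b) \<le> B * M\<^sup>2" if ab: "a \<in> {0..1}" "b \<in> {0..1}" for a b
  proof -
    have "norm (y a - y b) \<le> (B * M\<^sup>2) * norm (a - b)"
    proof (rule differentiable_bound[where S = "{0..1}" and f' = "\<lambda>x t. t *\<^sub>R y' x"])
      fix x :: real assume x: "x \<in> {0..1}"
      show "(y has_derivative (\<lambda>t. t *\<^sub>R y' x)) (at x within {0..1})"
        using deriv[OF x] by (simp add: has_vector_derivative_def)
      have "norm (y' x) \<le> B * M\<^sup>2"
        by (rule order_trans[OF bound[OF x]])
           (use c(2)[OF x] assms(4) in \<open>simp add: M_def mult_left_mono power_mono\<close>)
      then show "onorm (\<lambda>t. t *\<^sub>R y' x) \<le> B * M\<^sup>2"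
        by (intro onorm_le) (metis abs_ge_zero mult.commute mult_left_mono norm_scaleR real_norm_def)
    qed (use ab in auto)
    also have "\<dots> \<le> (B * M\<^sup>2) * 1"
      using ab assms(4) by (intro mult_left_mono) auto
    finally show ?thesis by simp
  qed
  have half: "B * M\<^sup>2 \<le> M / 2"
    using mult_right_mono[OF small[OF c(1)] M] by (simp add: M_def power2_eq_square mult_ac)
  have main: "norm (y 1 - y 0) \<le> 4 * B * (norm (y a))\<^sup>2" if a: "a \<in> {0..1}" for a
  proof -
    have "M \<le> norm (y a) + norm (y c - y a)"
      unfolding M_def by (metis add.commute norm_triangle_sub)
    then have "M \<le> 2 * norm (y a)" using lip[OF c(1) a] half by linarith
    then have "M\<^sup>2 \<le> (2 * norm (y a))\<^sup>2" using M by (intro power_mono)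
    then have "B * M\<^sup>2 \<le> B * (2 * norm (y a))\<^sup>2" using assms(4) by (rule mult_left_mono)
    moreover have "norm (y 1 - y 0) \<le> B * M\<^sup>2" by (rule lip) auto
    ultimately show ?thesis by (simp add: power_mult_distrib mult_ac)
  qed
  show "norm (y 1 - y 0) \<le> 4 * B * (norm (y 0))\<^sup>2" "norm (y 1 - y 0) \<le> 4 * B * (norm (y 1))\<^sup>2"
    by (rule main; simp)+
qed

section \<open>An integral formula on the cylinder\<close>

abbreviation period_segment :: "real \<Rightarrow> real \<Rightarrow> complex set" where
  "period_segment x0 y \<equiv> closed_segment (Complex (x0 - pi) y) (Complex (x0 + pi) y)"

abbreviation period_path :: "real \<Rightarrow> real \<Rightarrow> real \<Rightarrow> complex" where
  "period_path x0 y \<equiv> linepath (Complex (x0 - pi) y) (Complex (x0 + pi) y)"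

definition mean_at_depth :: "(complex \<Rightarrow> complex) \<Rightarrow> real \<Rightarrow> real \<Rightarrow> complex" where
  "mean_at_depth F x0 S =
     contour_integral (period_path x0 (- S)) F / of_real (2 * pi)"

text \<open>
  The Cauchy kernel of the cylinder \<open>\<complex>/2\<pi>\<int>\<close>, with residue 1 at 0, normalized to vanish at the upper
  end. At the lower end it tends to \<open>\<i>\<close>, so that there the Cauchy integral becomes a mean over a period.
\<close>

definition cyl_kernel :: "complex \<Rightarrow> complex" where
  "cyl_kernel w = \<i> * exp (\<i> * w) / (exp (\<i> * w) - 1)"

lemma cyl_kernel_periodic: "cyl_kernel (w + of_real (2 * pi)) = cyl_kernel w"
proof -
  have "\<i> * (w + of_real (2 * pi)) = \<i> * w + 2 * of_real pi * \<i>"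
    by (simp add: algebra_simps)
  then have "exp (\<i> * (w + of_real (2 * pi))) = exp (\<i> * w)"
    by (simp only: exp_add exp_two_pi_i mult_1_right)
  then show ?thesis by (simp add: cyl_kernel_def)
qed

lemma exp_i_minus_1_ne_0:
  assumes "w \<noteq> 0" "\<bar>Re w\<bar> < 2 * pi"
  shows "exp (\<i> * w) - 1 \<noteq> 0"
proof
  assume "exp (\<i> * w) - 1 = 0"
  then obtain n :: int where n: "Im w = 0" "Re w = of_int (2 * n) * pi"
    by (auto simp: exp_eq_1)
  then have "\<bar>of_int (2 * n)\<bar> * pi < 2 * pi" using assms(2) by (simp add: abs_mult)
  then have "\<bar>of_int (2 * n) :: real\<bar> < 2" by (simp only: mult_less_cancel_right) (auto simp: pi_gt_zero)
  then have "n = 0" by linarith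
  then show False using n assms(1) by (simp add: complex_eq_iff)
qed

lemma norm_exp_i: "norm (exp (\<i> * w)) = exp (- Im w)"
  by simp

text \<open>
  At a horizontal distance between \<open>\<pi>/2\<close> and \<open>3\<pi>/2\<close> from the pole the number \<open>e = exp (\<i> w)\<close> has
  \<open>Re e \<le> 0\<close>, hence \<open>\<bar>e - 1\<bar>\<close> is at least 1 and at least \<open>\<bar>e\<bar>\<close>.
\<close>

lemma cyl_kernel_side:
  assumes "- (3 * pi / 2) \<le> Re w" "Re w \<le> - (pi / 2)"
  shows "norm (cyl_kernel w) \<le> min 1 (exp (- Im w))"
proof -
  define e where "e = exp (\<i> * w)"
  have "cos (Re w) \<le> 0"
  proof -
    have "cos (Re w) = - cos (Re w + pi)" by simp
    moreover have "cos (Re w + pi) \<ge> 0" using assms by (intro cos_ge_zero) auto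
    ultimately show ?thesis by linarith
  qed
  then have Re: "Re e \<le> 0" by (simp add: e_def Re_exp mult_nonneg_nonpos)
  have 1: "norm (e - 1) \<ge> 1" using abs_Re_le_cmod[of "e - 1"] Re by simp
  have "(norm (e - 1))\<^sup>2 \<ge> (norm e)\<^sup>2"
    using Re by (simp add: cmod_power2 power2_diff)
  then have 2: "norm (e - 1) \<ge> norm e" by (rule power2_le_imp_le) simp
  have eq: "norm (cyl_kernel w) = norm e / norm (e - 1)"
    by (simp add: cyl_kernel_def e_def norm_mult norm_divide)
  have "norm e / norm (e - 1) \<le> 1" using 1 2 by (simp add: divide_le_eq)
  moreover have "norm e / norm (e - 1) \<le> norm e" using 1 by (simp add: divide_le_eq mult_le_cancel_left1)
  moreover have "norm e = exp (- Im w)" by (simp add: e_def)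
  ultimately show ?thesis by (simp add: eq)
qed

lemma cyl_kernel_top:
  assumes "Im w \<ge> 1"
  shows "norm (cyl_kernel w) \<le> 2 * exp (- Im w)"
proof -
  define e where "e = exp (\<i> * w)"
  have "norm e = exp (- Im w)" by (simp add: e_def)
  also have "\<dots> \<le> exp (- 1)" using assms by simp
  also have "\<dots> \<le> 1 / 2" using exp_ge_add_one_self[of 1] by (simp add: exp_minus field_simps)
  finally have "norm (e - 1) \<ge> 1 / 2"
    using norm_triangle_ineq2[of 1 e] by (simp add: norm_minus_commute)
  then have "norm e / norm (e - 1) \<le> norm e / (1 / 2)"
    by (intro divide_left_mono) (auto intro: mult_pos_pos)
  then show ?thesis by (simp add: cyl_kernel_def e_def norm_mult norm_divide)
qed

lemma cyl_kernel_bottom: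
  assumes "Im w \<le> - 1"
  shows "norm (cyl_kernel w - \<i>) \<le> 2 * exp (Im w)"
proof -
  define e where "e = exp (\<i> * w)"
  have ne: "norm e = exp (- Im w)" by (simp add: e_def)
  have "2 \<le> exp (1::real)" using exp_ge_add_one_self[of 1] by simp
  also have "\<dots> \<le> norm e" unfolding ne using assms by simp
  finally have 2: "norm e \<ge> 2" .
  then have 1: "norm (e - 1) \<ge> norm e / 2"
    using norm_triangle_ineq2[of e 1] by simp
  then have "e \<noteq> 1" using 2 by auto
  then have "cyl_kernel w - \<i> = \<i> / (e - 1)"
    by (simp add: cyl_kernel_def e_def[symmetric] field_simps)
  then have "norm (cyl_kernel w - \<i>) = 1 / norm (e - 1)" by (simp add: norm_divide)
  also have "\<dots> \<le> 1 / (norm e / 2)"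
    using 1 2 by (intro divide_left_mono) (auto intro!: mult_pos_pos)
  also have "\<dots> = 2 * exp (Im w)" by (simp add: ne exp_minus field_simps)
  finally show ?thesis .
qed

lemma cyl_kernel_residue_limit: "((\<lambda>w. cyl_kernel (w - z) * (w - z)) \<longlongrightarrow> 1) (at z)"
proof -
  have "((\<lambda>w. exp (\<i> * w)) has_field_derivative exp (\<i> * 0) * \<i>) (at 0)"
    by (rule DERIV_fun_exp, rule DERIV_cmult_Id)
  then have "((\<lambda>w. (exp (\<i> * w) - 1) / w) \<longlongrightarrow> \<i>) (at 0)"
    by (simp add: DERIV_def)
  moreover have "((\<lambda>w. \<i> * exp (\<i> * w)) \<longlongrightarrow> \<i> * exp (\<i> * 0)) (at 0)"
    by (intro tendsto_intros)
  ultimately have "((\<lambda>w. \<i> * exp (\<i> * w) / ((exp (\<i> * w) - 1) / w)) \<longlongrightarrow> \<i> * exp (\<i> * 0) / \<i>) (at 0)"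
    by (intro tendsto_divide) auto
  then have "((\<lambda>w. cyl_kernel w * w) \<longlongrightarrow> 1) (at 0)"
    by (simp add: cyl_kernel_def)
  then show ?thesis
    using LIM_offset_zero_iff[of z "\<lambda>w. cyl_kernel (w - z) * (w - z)"] by simp
qed

text \<open>
  The residue theorem on a rectangle one period wide. As the kernel is periodic, the two vertical
  sides combine into one integral over the jump of \<open>F\<close>, which would vanish for a periodic \<open>F\<close>.
\<close>

lemma cylinder_representation:
  assumes holo: "F holomorphic_on {z. \<bar>Re z - x0\<bar> < 3 * pi / 2 \<and> Im z < - s0}"
    and s0: "0 < s1" "s0 < s1"
    and \<psi>: "\<bar>Re \<psi> - x0\<bar> \<le> pi / 2" "s1 < - Im \<psi>" "- Im \<psi> < S"
  shows "2 * of_real pi * \<i> * F \<psi> =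
     contour_integral (period_path x0 (- S)) (\<lambda>\<zeta>. cyl_kernel (\<zeta> - \<psi>) * F \<zeta>)
   - contour_integral (period_path x0 (- s1)) (\<lambda>\<zeta>. cyl_kernel (\<zeta> - \<psi>) * F \<zeta>)
   + \<i> * integral {- S..- s1} (\<lambda>y. cyl_kernel (Complex (x0 - pi) y - \<psi>) * (F (Complex (x0 + pi) y) - F (Complex (x0 - pi) y)))"
proof -
  define A where "A = {z. \<bar>Re z - x0\<bar> < 3 * pi / 2 \<and> Im z < - s0}"
  define G where "G = (\<lambda>\<zeta>. cyl_kernel (\<zeta> - \<psi>) * F \<zeta>)"
  have A_eq: "A = {z. Re z < x0 + 3 * pi / 2} \<inter> {z. Re z > x0 - 3 * pi / 2} \<inter> {z. Im z < - s0}"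
    unfolding A_def by (rule set_eqI, simp only: mem_Collect_eq Int_iff abs_less_iff) linarith
  have A: "open A" "convex A"
    unfolding A_eq by (intro open_Int convex_Int open_halfspace_Re_lt open_halfspace_Re_gt
        open_halfspace_Im_lt convex_halfspace_Re_lt convex_halfspace_Re_gt convex_halfspace_Im_lt)+
  have \<psi>A: "\<psi> \<in> A" using \<psi> s0 pi_gt_zero unfolding A_def mem_Collect_eq by (intro conjI; linarith)
  have ne: "exp (\<i> * (\<zeta> - \<psi>)) - 1 \<noteq> 0" if "\<zeta> \<in> A - {\<psi>}" for \<zeta>
  proof (rule exp_i_minus_1_ne_0)
    show "\<bar>Re (\<zeta> - \<psi>)\<bar> < 2 * pi"
      using that \<psi>(1) unfolding A_def minus_complex.sel Diff_iff mem_Collect_eq by linarith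
  qed (use that in auto)
  have FA: "F holomorphic_on A" using holo by (simp add: A_def)
  have G: "G holomorphic_on A - {\<psi>}"
    unfolding G_def cyl_kernel_def
    by (intro holomorphic_intros holomorphic_on_subset[OF FA]) (use ne in auto)
  have cont: "continuous_on (A - {\<psi>}) G" by (rule holomorphic_on_imp_continuous_on[OF G])
  have res: "residue G \<psi> = F \<psi>"
  proof (rule residue_simple'[OF A(1) \<psi>A G])
    have "(F \<longlongrightarrow> F \<psi>) (at \<psi>)"
      using holomorphic_on_imp_continuous_on[OF FA] A(1) \<psi>A
      by (simp add: continuous_on_eq_continuous_at isCont_def)
    then show "((\<lambda>w. G w * (w - \<psi>)) \<longlongrightarrow> F \<psi>) (at \<psi>)"
      using tendsto_mult[OF cyl_kernel_residue_limit] by (fastforce simp: G_def mult_ac)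
  qed
  define a1 a2 a3 a4 where "a1 = Complex (x0 - pi) (- S)" and "a2 = Complex (x0 + pi) (- S)"
    and "a3 = Complex (x0 + pi) (- s1)" and "a4 = Complex (x0 - pi) (- s1)"
  note adefs = a1_def a2_def a3_def a4_def
  have S: "s1 < S" using \<psi> by simp
  have boxA: "cbox a1 a3 \<subseteq> A"
  proof
    fix z assume "z \<in> cbox a1 a3"
    then show "z \<in> A"
      using s0 pi_gt_zero unfolding A_def adefs in_cbox_complex_iff complex.sel mem_Collect_eq atLeastAtMost_iff
      by (intro conjI; linarith)
  qed
  have box: "\<psi> \<in> box a1 a3"
    unfolding adefs in_box_complex_iff complex.sel greaterThanLessThan_iff using \<psi> pi_gt_zero by (intro conjI; linarith)
  have pimg: "path_image (rectpath a1 a3) = cbox a1 a3 - box a1 a3"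
    by (rule path_image_rectpath_cbox_minus_box) (use S pi_gt_zero in \<open>auto simp: adefs\<close>)
  then have "path_image (rectpath a1 a3) \<subseteq> A - {\<psi>}" using boxA box by auto
  have "contour_integral (rectpath a1 a3) G = 2 * pi * \<i> * (\<Sum>p\<in>{\<psi>}. winding_number (rectpath a1 a3) p * residue G p)"
  proof (rule Residue_theorem)
    show "connected A" using A(2) by (rule convex_connected)
    show "\<forall>z. z \<notin> A \<longrightarrow> winding_number (rectpath a1 a3) z = 0"
      by (intro allI impI winding_number_rectpath_outside) (use boxA S pi_gt_zero in \<open>auto simp: adefs\<close>)
  qed (use A G \<open>path_image (rectpath a1 a3) \<subseteq> A - {\<psi>}\<close> in auto)
  then have total: "contour_integral (rectpath a1 a3) G = 2 * of_real pi * \<i> * F \<psi>"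
    using res winding_number_rectpath[OF box] by simp
  have rect: "rectpath a1 a3 = linepath a1 a2 +++ linepath a2 a3 +++ linepath a3 a4 +++ linepath a4 a1"
    by (simp add: rectpath_def Let_def adefs)
  have segs: "closed_segment a1 a2 \<subseteq> A - {\<psi>}" "closed_segment a2 a3 \<subseteq> A - {\<psi>}"
    "closed_segment a3 a4 \<subseteq> A - {\<psi>}" "closed_segment a4 a1 \<subseteq> A - {\<psi>}"
    using \<open>path_image (rectpath a1 a3) \<subseteq> A - {\<psi>}\<close> unfolding rect by (auto simp: path_image_join)
  have int: "G contour_integrable_on linepath a b" if "closed_segment a b \<subseteq> A - {\<psi>}" for a b
    by (rule contour_integrable_continuous_linepath) (rule continuous_on_subset[OF cont that])
  have "contour_integral (rectpath a1 a3) G = contour_integral (linepath a1 a2) G + (contour_integral (linepath a2 a3) G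
      + (contour_integral (linepath a3 a4) G + contour_integral (linepath a4 a1) G))"
    unfolding rect using segs by (simp add: int)
  also have "contour_integral (linepath a3 a4) G = - contour_integral (linepath a4 a3) G"
    by (rule contour_integral_reverse_linepath)
       (metis closed_segment_commute continuous_on_subset[OF cont] segs(3))
  also have "contour_integral (linepath a4 a1) G = - contour_integral (linepath a1 a4) G"
    by (rule contour_integral_reverse_linepath)
       (metis closed_segment_commute continuous_on_subset[OF cont] segs(4))
  also have "contour_integral (linepath a2 a3) G = \<i> * integral {- S..- s1} (\<lambda>y. G (Complex (x0 + pi) y))"
    by (rule contour_integral_linepath_same_Re) (use S in \<open>auto simp: adefs\<close>)
  also have "contour_integral (linepath a1 a4) G = \<i> * integral {- S..- s1} (\<lambda>y. G (Complex (x0 - pi) y))"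
    by (rule contour_integral_linepath_same_Re) (use S in \<open>auto simp: adefs\<close>)
  also have "contour_integral (linepath a1 a2) G + (\<i> * integral {- S..- s1} (\<lambda>y. G (Complex (x0 + pi) y))
       + (- contour_integral (linepath a4 a3) G + - (\<i> * integral {- S..- s1} (\<lambda>y. G (Complex (x0 - pi) y)))))
     = contour_integral (linepath a1 a2) G - contour_integral (linepath a4 a3) G
       + \<i> * (integral {- S..- s1} (\<lambda>y. G (Complex (x0 + pi) y)) - integral {- S..- s1} (\<lambda>y. G (Complex (x0 - pi) y)))"
    by (simp add: algebra_simps)
  also have "integral {- S..- s1} (\<lambda>y. G (Complex (x0 + pi) y)) - integral {- S..- s1} (\<lambda>y. G (Complex (x0 - pi) y))
     = integral {- S..- s1} (\<lambda>y. G (Complex (x0 + pi) y) - G (Complex (x0 - pi) y))"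
  proof (rule integral_diff[symmetric])
    have vert: "(\<lambda>y. G (Complex c y)) integrable_on {- S..- s1}" if c: "c = x0 + pi \<or> c = x0 - pi" for c
    proof (rule integrable_continuous_interval, rule continuous_on_compose2[OF cont])
      show "continuous_on {- S..- s1} (Complex c)"
        by (intro continuous_intros continuous_on_Complex)
      show "Complex c ` {- S..- s1} \<subseteq> A - {\<psi>}"
      proof (rule image_subsetI)
        fix y assume y: "y \<in> {- S..- s1}"
        have "c - x0 = pi \<or> c - x0 = - pi" using c by auto
        then have "\<bar>c - x0\<bar> = pi" using pi_gt_zero by auto
        then have "Complex c y \<in> A" using y s0 pi_gt_zero by (simp add: A_def)
        moreover have "c \<noteq> Re \<psi>" using \<open>\<bar>c - x0\<bar> = pi\<close> \<psi>(1) pi_gt_zero by auto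
        ultimately show "Complex c y \<in> A - {\<psi>}" by auto
      qed
    qed
    show "(\<lambda>y. G (Complex (x0 + pi) y)) integrable_on {- S..- s1}"
      "(\<lambda>y. G (Complex (x0 - pi) y)) integrable_on {- S..- s1}" by (auto intro: vert)
  qed
  also have "(\<lambda>y. G (Complex (x0 + pi) y) - G (Complex (x0 - pi) y))
     = (\<lambda>y. cyl_kernel (Complex (x0 - pi) y - \<psi>) * (F (Complex (x0 + pi) y) - F (Complex (x0 - pi) y)))"
  proof
    fix y
    have "Complex (x0 + pi) y - \<psi> = Complex (x0 - pi) y - \<psi> + of_real (2 * pi)"
      by (simp add: complex_eq_iff)
    then have "cyl_kernel (Complex (x0 + pi) y - \<psi>) = cyl_kernel (Complex (x0 - pi) y - \<psi>)"
      by (simp only: cyl_kernel_periodic)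
    then show "G (Complex (x0 + pi) y) - G (Complex (x0 - pi) y)
      = cyl_kernel (Complex (x0 - pi) y - \<psi>) * (F (Complex (x0 + pi) y) - F (Complex (x0 - pi) y))"
      unfolding G_def by (simp only: right_diff_distrib)
  qed
  finally show ?thesis unfolding total by (simp only: G_def adefs)
qed

lemma horizontal_segment:
  assumes "\<zeta> \<in> period_segment x0 y"
  shows "\<bar>Re \<zeta> - x0\<bar> \<le> pi \<and> Im \<zeta> = y"
proof -
  have "\<exists>u. 0 \<le> u \<and> u \<le> 1 \<and> \<zeta> = (1 - u) *\<^sub>R Complex (x0 - pi) y + u *\<^sub>R Complex (x0 + pi) y"
    by (rule in_segment(1)[THEN iffD1, OF assms])
  then obtain u where u: "0 \<le> u" "u \<le> 1" "\<zeta> = (1 - u) *\<^sub>R Complex (x0 - pi) y + u *\<^sub>R Complex (x0 + pi) y"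
    by (elim exE conjE)
  have "Re \<zeta> = (1 - u) * (x0 - pi) + u * (x0 + pi)" "Im \<zeta> = (1 - u) * y + u * y"
    unfolding u(3) by simp_all
  then have "Re \<zeta> - x0 = (2 * u - 1) * pi" "Im \<zeta> = y" by algebra+
  moreover have "\<bar>2 * u - 1\<bar> \<le> 1" using u by auto
  ultimately show ?thesis by (simp add: abs_mult)
qed

lemma norm_horizontal_segment: "norm (Complex (x0 + pi) y - Complex (x0 - pi) y) = 2 * pi"
proof -
  have "Complex (x0 + pi) y - Complex (x0 - pi) y = of_real (2 * pi)" by (simp add: complex_eq_iff)
  then show ?thesis using pi_gt_zero by (simp only: norm_of_real)
qed

lemma norm_mean_at_depth_le:
  assumes "continuous_on (period_segment x0 (- S)) F"
    and bound: "\<And>u. \<bar>u - x0\<bar> \<le> pi \<Longrightarrow> norm (F (Complex u (- S))) \<le> B"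
  shows "norm (mean_at_depth F x0 S) \<le> B"
proof -
  have B: "B \<ge> 0" using bound[of x0] pi_gt_zero by (auto intro: order_trans[OF norm_ge_zero])
  have "norm (contour_integral (period_path x0 (- S)) F) \<le> B * (2 * pi)"
    unfolding norm_horizontal_segment[of x0 "- S", symmetric]
  proof (rule contour_integral_bound_linepath)
    fix \<zeta> assume "\<zeta> \<in> period_segment x0 (- S)"
    then have z: "\<bar>Re \<zeta> - x0\<bar> \<le> pi" "Im \<zeta> = - S" using horizontal_segment by auto
    show "norm (F \<zeta>) \<le> B" using bound[OF z(1)] z(2) by (metis complex_surj)
  qed (use B assms(1) in \<open>auto intro: contour_integrable_continuous_linepath\<close>)
  then show ?thesis by (simp add: mean_at_depth_def norm_divide divide_le_eq)
qed

text \<open>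
  The three terms of the bound come from the top side, where the kernel is exponentially small, from the
  jump between the vertical sides, and from the difference between the kernel and its limit \<open>\<i>\<close> on
  the bottom side. The factor \<open>1 / \<sigma>\<^sup>2\<close> makes the jump integrable with the small integral \<open>1 / s1\<close>, and the
  condition on \<open>\<omega>\<close> says that the kernel carries the weight \<open>\<omega>\<close> from depth \<open>\<sigma>\<close> to depth \<open>s\<close> without loss.
\<close>

lemma almost_periodic_near_mean:
  assumes holo: "F holomorphic_on {z. \<bar>Re z - x0\<bar> < 3 * pi / 2 \<and> Im z < - s0}"
    and s0: "0 < s1" "s0 < s1"
    and sides: "\<And>\<sigma>. \<sigma> \<ge> s1 \<Longrightarrow>
      norm (F (Complex (x0 + pi) (- \<sigma>)) - F (Complex (x0 - pi) (- \<sigma>))) \<le> \<omega> \<sigma> / \<sigma>\<^sup>2"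
    and \<omega>: "\<And>\<sigma>. \<sigma> \<ge> s1 \<Longrightarrow> \<omega> \<sigma> * min 1 (exp (\<sigma> - s)) \<le> W"
    and top: "\<And>u. \<bar>u - x0\<bar> \<le> pi \<Longrightarrow> norm (F (Complex u (- s1))) \<le> B"
    and bottom: "\<And>u. \<bar>u - x0\<bar> \<le> pi \<Longrightarrow> norm (F (Complex u (- S))) \<le> B'"
    and \<psi>: "\<bar>Re \<psi> - x0\<bar> \<le> pi / 2" "Im \<psi> = - s" "s1 + 1 \<le> s" "s + 1 \<le> S"
  shows "norm (F \<psi> - mean_at_depth F x0 S) \<le> 2 * B * exp (- (s - s1)) + W / s1 + 2 * B' * exp (- (S - s))"
proof -
  let ?k = "\<lambda>\<zeta>. cyl_kernel (\<zeta> - \<psi>)"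
  let ?bot = "period_path x0 (- S)"
  let ?top = "period_path x0 (- s1)"
  let ?j = "\<lambda>y. cyl_kernel (Complex (x0 - pi) y - \<psi>) * (F (Complex (x0 + pi) y) - F (Complex (x0 - pi) y))"
  let ?I = "integral {- S..- s1} ?j"
  define A where "A = {z. \<bar>Re z - x0\<bar> < 3 * pi / 2 \<and> Im z < - s0}"
  have FA: "continuous_on A F"
    unfolding A_def by (rule holomorphic_on_imp_continuous_on[OF holo])
  have rep: "2 * of_real pi * \<i> * F \<psi> = contour_integral ?bot (\<lambda>\<zeta>. ?k \<zeta> * F \<zeta>)
      - contour_integral ?top (\<lambda>\<zeta>. ?k \<zeta> * F \<zeta>) + \<i> * ?I"
    by (rule cylinder_representation[OF holo s0]) (use \<psi> in auto)
  have kcont: "continuous_on (period_segment x0 y) ?k"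
    if "y \<noteq> - s" for y
  proof -
    have "exp (\<i> * (\<zeta> - \<psi>)) - 1 \<noteq> 0"
      if "\<zeta> \<in> period_segment x0 y" for \<zeta>
    proof (rule exp_i_minus_1_ne_0)
      show "\<zeta> - \<psi> \<noteq> 0" using horizontal_segment[OF that] \<psi>(2) \<open>y \<noteq> - s\<close> by auto
      show "\<bar>Re (\<zeta> - \<psi>)\<bar> < 2 * pi"
        using horizontal_segment[OF that] \<psi>(1) pi_gt_zero unfolding minus_complex.sel by linarith
    qed
    then show ?thesis unfolding cyl_kernel_def by (intro continuous_intros) auto
  qed
  have Fcont: "continuous_on (period_segment x0 y) F"
    if "y \<le> - s1" for y
  proof (rule continuous_on_subset[OF FA], rule subsetI)
    fix \<zeta> assume "\<zeta> \<in> period_segment x0 y"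
    from horizontal_segment[OF this] show "\<zeta> \<in> A"
      using that s0 pi_gt_zero unfolding A_def mem_Collect_eq by (intro conjI; linarith)
  qed
  have B: "B \<ge> 0" "B' \<ge> 0"
    using top[of x0] bottom[of x0] pi_gt_zero by (auto intro: order_trans[OF norm_ge_zero])
  have T: "norm (contour_integral ?top (\<lambda>\<zeta>. ?k \<zeta> * F \<zeta>)) \<le> (2 * exp (- (s - s1)) * B) * (2 * pi)"
    unfolding norm_horizontal_segment[of x0 "- s1", symmetric]
  proof (rule contour_integral_bound_linepath)
    show "(\<lambda>\<zeta>. ?k \<zeta> * F \<zeta>) contour_integrable_on ?top"
      by (intro contour_integrable_continuous_linepath continuous_on_mult kcont Fcont) (use \<psi> in auto)
    fix \<zeta> assume "\<zeta> \<in> period_segment x0 (- s1)"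
    then have z: "\<bar>Re \<zeta> - x0\<bar> \<le> pi" "Im \<zeta> = - s1" using horizontal_segment by auto
    have "norm (?k \<zeta>) \<le> 2 * exp (- (s - s1))"
      using cyl_kernel_top[of "\<zeta> - \<psi>"] z \<psi> by simp
    moreover have "norm (F \<zeta>) \<le> B" using top[OF z(1)] z(2) by (metis complex_surj)
    ultimately show "norm (?k \<zeta> * F \<zeta>) \<le> 2 * exp (- (s - s1)) * B"
      unfolding norm_mult by (intro mult_mono) auto
  qed (use B in auto)
  have "contour_integral ?bot (\<lambda>\<zeta>. ?k \<zeta> * F \<zeta>) - \<i> * contour_integral ?bot F
      = contour_integral ?bot (\<lambda>\<zeta>. ?k \<zeta> * F \<zeta>) - contour_integral ?bot (\<lambda>\<zeta>. \<i> * F \<zeta>)"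
    by (subst contour_integral_lmul)
       (use \<psi> in \<open>auto intro!: contour_integrable_continuous_linepath Fcont\<close>)
  also have "\<dots> = contour_integral ?bot (\<lambda>\<zeta>. ?k \<zeta> * F \<zeta> - \<i> * F \<zeta>)"
    by (rule contour_integral_diff[symmetric]; intro contour_integrable_continuous_linepath continuous_intros kcont Fcont)
       (use \<psi> in auto)
  also have "\<dots> = contour_integral ?bot (\<lambda>\<zeta>. (?k \<zeta> - \<i>) * F \<zeta>)"
    by (simp add: left_diff_distrib)
  also have "norm \<dots> \<le> (2 * exp (- (S - s)) * B') * (2 * pi)"
    unfolding norm_horizontal_segment[of x0 "- S", symmetric]
  proof (rule contour_integral_bound_linepath)
    show "(\<lambda>\<zeta>. (?k \<zeta> - \<i>) * F \<zeta>) contour_integrable_on ?bot"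
      by (intro contour_integrable_continuous_linepath continuous_intros kcont Fcont) (use \<psi> in auto)
    fix \<zeta> assume "\<zeta> \<in> period_segment x0 (- S)"
    then have z: "\<bar>Re \<zeta> - x0\<bar> \<le> pi" "Im \<zeta> = - S" using horizontal_segment by auto
    have "norm (?k \<zeta> - \<i>) \<le> 2 * exp (- (S - s))"
      using cyl_kernel_bottom[of "\<zeta> - \<psi>"] z \<psi> by simp
    moreover have "norm (F \<zeta>) \<le> B'" using bottom[OF z(1)] z(2) by (metis complex_surj)
    ultimately show "norm ((?k \<zeta> - \<i>) * F \<zeta>) \<le> 2 * exp (- (S - s)) * B'"
      unfolding norm_mult by (intro mult_mono) auto
  qed (use B in auto)
  finally have Bo: "norm (contour_integral ?bot (\<lambda>\<zeta>. ?k \<zeta> * F \<zeta>) - \<i> * contour_integral ?bot F)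
     \<le> (2 * exp (- (S - s)) * B') * (2 * pi)" .
  have W: "W \<ge> 0"
  proof -
    have "0 \<le> \<omega> s1 / s1\<^sup>2" using sides[of s1] norm_ge_zero order_trans by blast
    then have "0 \<le> \<omega> s1" using s0 by (simp add: zero_le_divide_iff)
    then have "0 \<le> \<omega> s1 * min 1 (exp (s1 - s))" by simp
    then show ?thesis using \<omega>[of s1] by linarith
  qed
  have antider: "((\<lambda>y. W / y\<^sup>2) has_integral (- W / (- s1) - (- W / (- S)))) {- S..- s1}"
  proof (rule fundamental_theorem_of_calculus)
    show "- S \<le> - s1" using \<psi> by simp
    fix y assume "y \<in> {- S..- s1}"
    then have "y \<noteq> 0" using s0 by auto
    then have "((\<lambda>y. - W / y) has_real_derivative W / y\<^sup>2) (at y within {- S..- s1})"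
      by (auto intro!: derivative_eq_intros simp: power2_eq_square)
    then show "((\<lambda>y. - W / y) has_vector_derivative W / y\<^sup>2) (at y within {- S..- s1})"
      by (simp add: has_real_derivative_iff_has_vector_derivative)
  qed
  have Ibd: "norm ?I \<le> integral {- S..- s1} (\<lambda>y. W / y\<^sup>2)"
  proof (rule integral_norm_bound_integral)
    have vcont: "continuous_on {- S..- s1} (\<lambda>y. F (Complex c y))" if "c = x0 + pi \<or> c = x0 - pi" for c
      by (rule continuous_on_compose2[OF FA])
         (use that s0 pi_gt_zero in \<open>auto simp: A_def abs_less_iff intro!: continuous_on_Complex continuous_intros\<close>)
    have "exp (\<i> * (Complex (x0 - pi) y - \<psi>)) - 1 \<noteq> 0" for y
    proof (rule exp_i_minus_1_ne_0)
      have "Re (Complex (x0 - pi) y - \<psi>) < 0" "\<bar>Re (Complex (x0 - pi) y - \<psi>)\<bar> < 2 * pi"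
        using \<psi>(1) pi_gt_zero unfolding minus_complex.sel complex.sel by linarith+
      then show "Complex (x0 - pi) y - \<psi> \<noteq> 0" "\<bar>Re (Complex (x0 - pi) y - \<psi>)\<bar> < 2 * pi"
        by auto
    qed
    then have "continuous_on {- S..- s1} (\<lambda>y. cyl_kernel (Complex (x0 - pi) y - \<psi>))"
      unfolding cyl_kernel_def by (intro continuous_intros continuous_on_Complex) auto
    then show "?j
        integrable_on {- S..- s1}"
      by (intro integrable_continuous_interval continuous_on_mult continuous_on_diff vcont) auto
    show "(\<lambda>y. W / y\<^sup>2) integrable_on {- S..- s1}" using antider by blast
    fix y assume y: "y \<in> {- S..- s1}"
    define \<sigma> where "\<sigma> = - y"
    have \<sigma>: "\<sigma> \<ge> s1" "\<sigma> > 0" using y s0 by (auto simp: \<sigma>_def)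
    have "norm (cyl_kernel (Complex (x0 - pi) y - \<psi>)) \<le> min 1 (exp (\<sigma> - s))"
    proof -
      have "- (3 * pi / 2) \<le> Re (Complex (x0 - pi) y - \<psi>)" "Re (Complex (x0 - pi) y - \<psi>) \<le> - (pi / 2)"
        using \<psi>(1) unfolding minus_complex.sel complex.sel by linarith+
      from cyl_kernel_side[OF this]
      have "norm (cyl_kernel (Complex (x0 - pi) y - \<psi>)) \<le> min 1 (exp (- Im (Complex (x0 - pi) y - \<psi>)))" .
      also have "- Im (Complex (x0 - pi) y - \<psi>) = \<sigma> - s" using \<psi>(2) by (simp add: \<sigma>_def)
      finally show ?thesis .
    qed
    moreover have "norm (F (Complex (x0 + pi) y) - F (Complex (x0 - pi) y)) \<le> \<omega> \<sigma> / \<sigma>\<^sup>2"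
      using sides[OF \<sigma>(1)] by (simp add: \<sigma>_def)
    ultimately have "norm (?j y)
        \<le> min 1 (exp (\<sigma> - s)) * (\<omega> \<sigma> / \<sigma>\<^sup>2)"
      unfolding norm_mult by (intro mult_mono) auto
    also have "\<dots> = (\<omega> \<sigma> * min 1 (exp (\<sigma> - s))) / \<sigma>\<^sup>2" by simp
    also have "\<dots> \<le> W / \<sigma>\<^sup>2" by (intro divide_right_mono \<omega> \<sigma>) auto
    finally show "norm (?j y) \<le> W / y\<^sup>2"
      by (simp add: \<sigma>_def)
  qed
  also have "\<dots> = W / s1 - W / S" using integral_unique[OF antider] by simp
  also have "\<dots> \<le> W / s1" using W \<psi> s0 by simp
  finally have I: "norm ?I \<le> W / s1" .
  have "2 * of_real pi * \<i> * (F \<psi> - mean_at_depth F x0 S)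
      = (contour_integral ?bot (\<lambda>\<zeta>. ?k \<zeta> * F \<zeta>) - \<i> * contour_integral ?bot F)
        - contour_integral ?top (\<lambda>\<zeta>. ?k \<zeta> * F \<zeta>) + \<i> * ?I"
    unfolding right_diff_distrib rep by (simp add: mean_at_depth_def field_simps)
  then have "norm (2 * of_real pi * \<i> * (F \<psi> - mean_at_depth F x0 S))
      \<le> norm (contour_integral ?bot (\<lambda>\<zeta>. ?k \<zeta> * F \<zeta>) - \<i> * contour_integral ?bot F
            - contour_integral ?top (\<lambda>\<zeta>. ?k \<zeta> * F \<zeta>)) + norm (\<i> * ?I)"
    by (simp only: norm_triangle_ineq)
  also have "\<dots> \<le> norm (contour_integral ?bot (\<lambda>\<zeta>. ?k \<zeta> * F \<zeta>) - \<i> * contour_integral ?bot F)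
            + norm (contour_integral ?top (\<lambda>\<zeta>. ?k \<zeta> * F \<zeta>)) + norm (\<i> * ?I)"
    by (intro add_right_mono norm_triangle_ineq4)
  also have "\<dots> \<le> (2 * exp (- (S - s)) * B') * (2 * pi) + (2 * exp (- (s - s1)) * B) * (2 * pi) + W / s1"
    by (intro add_mono Bo T) (use I in \<open>simp add: norm_mult\<close>)
  also have "\<dots> \<le> (2 * exp (- (S - s)) * B') * (2 * pi) + (2 * exp (- (s - s1)) * B) * (2 * pi) + (W / s1) * (2 * pi)"
    using mult_left_mono[of 1 "2 * pi" "W / s1"] W s0 pi_ge_two by simp
  also have "\<dots> = (2 * pi) * (2 * B * exp (- (s - s1)) + W / s1 + 2 * B' * exp (- (S - s)))"
    by (simp only: algebra_simps)
  finally have "(2 * pi) * norm (F \<psi> - mean_at_depth F x0 S)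
      \<le> (2 * pi) * (2 * B * exp (- (s - s1)) + W / s1 + 2 * B' * exp (- (S - s)))"
    by (simp only: norm_mult norm_ii norm_of_real norm_numeral mult_1_right abs_of_pos[OF pi_gt_zero])
  then show ?thesis using pi_gt_zero by simp
qed

section \<open>Almost periodic functions in a half-strip\<close>

lemma power_le_exp:
  assumes "c > 0" "x \<ge> 0"
  shows "x ^ n \<le> (real (Suc n) / c) ^ n * exp (c * x)"
proof -
  define a where "a = c / real (Suc n)"
  have a: "a > 0" using assms by (simp add: a_def)
  have "a * x \<le> exp (a * x)" using exp_ge_add_one_self[of "a * x"] by linarith
  then have "(a * x) ^ n \<le> exp (a * x) ^ n" using a assms by (intro power_mono) auto
  also have "\<dots> = exp (real n * (a * x))" by (rule exp_of_nat_mult[symmetric])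
  also have "\<dots> \<le> exp (c * x)"
  proof -
    have "real n * a \<le> c" using assms by (simp add: a_def divide_le_eq algebra_simps)
    then show ?thesis using assms by (simp add: mult.assoc[symmetric] mult_right_mono)
  qed
  finally have "x ^ n \<le> exp (c * x) / a ^ n"
    using a by (simp add: power_mult_distrib le_divide_eq mult.commute)
  also have "\<dots> = (1 / a) ^ n * exp (c * x)" by (simp add: power_divide)
  finally show ?thesis by (simp add: a_def)
qed

lemma le_of_le_add_inverse_sq:
  fixes a b :: real
  assumes "\<And>S. S \<ge> m \<Longrightarrow> a \<le> b + K / S\<^sup>2"
  shows "a \<le> b"
proof (rule tendsto_lowerbound[where F = at_top])
  have "((\<lambda>S. K / S\<^sup>2) \<longlongrightarrow> 0) at_top"
    by (intro tendsto_divide_0[OF tendsto_const] filterlim_at_top_imp_at_infinity filterlim_pow_at_top filterlim_ident) auto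
  then show "((\<lambda>S. b + K / S\<^sup>2) \<longlongrightarrow> b) at_top"
    using tendsto_add[OF tendsto_const] by fastforce
  show "\<forall>\<^sub>F S in at_top. a \<le> b + K / S\<^sup>2"
    using eventually_ge_at_top[of m] by eventually_elim (rule assms)
qed auto

text \<open>
  The representation is good only within half a period of the axis of its rectangle; the two windows
  centred at \<open>\<plusminus>\<pi>/2\<close> together cover a whole period.
\<close>

lemma half_period_window:
  fixes x :: real
  assumes "\<bar>x\<bar> \<le> pi"
  obtains x0 where "\<bar>x - x0\<bar> \<le> pi / 2" "x0 = pi / 2 \<or> x0 = - (pi / 2)"
proof (cases "x \<ge> 0")
  case True
  then have "\<bar>x - pi / 2\<bar> \<le> pi / 2" using assms by linarith
  then show ?thesis using that by blast
next
  case False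
  then have "\<bar>x - - (pi / 2)\<bar> \<le> pi / 2" using assms by linarith
  then show ?thesis using that by blast
qed

lemma half_period_window_subset:
  assumes "\<bar>x0\<bar> = pi / 2"
  shows "{z. \<bar>Re z - x0\<bar> < 3 * pi / 2 \<and> Im z < - s0} \<subseteq> {z. \<bar>Re z\<bar> < 2 * pi \<and> Im z < - s0}"
proof
  fix z assume "z \<in> {z. \<bar>Re z - x0\<bar> < 3 * pi / 2 \<and> Im z < - s0}"
  then show "z \<in> {z. \<bar>Re z\<bar> < 2 * pi \<and> Im z < - s0}"
    using assms unfolding mem_Collect_eq by (intro conjI; linarith)
qed

text \<open>
  An exactly periodic function that tends to 0 at the lower end has only the Fourier modes
  \<open>exp (- \<i> n \<psi>)\<close> with \<open>n \<ge> 1\<close>, hence is \<open>O(exp (Im \<psi>))\<close>. Here the jump over a period is a small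
  multiple of the function itself. With \<open>N\<close> the supremum of \<open>\<parallel>g\<parallel>\<close> divided by the weight \<open>exp (Im \<psi>) + \<kappa>\<close>, the
  representation gives \<open>N \<le> L + N / 2\<close> once the rectangle starts deep enough, with \<open>L\<close> independent of \<open>\<kappa>\<close>;
  then \<open>\<kappa>\<close> tends to 0.
\<close>

lemma almost_periodic_exp_decay:
  fixes g :: "complex \<Rightarrow> complex ^ 'n"
  assumes holo: "\<And>i. (\<lambda>\<psi>. g \<psi> $ i) holomorphic_on {z. \<bar>Re z\<bar> < 2 * pi \<and> Im z < - s0}"
    and "s0 > 0"
    and jump: "\<And>\<psi>. \<bar>Re \<psi> + pi\<bar> \<le> pi / 2 \<Longrightarrow> Im \<psi> < - s0 \<Longrightarrow>
       norm (g (\<psi> + of_real (2 * pi)) - g \<psi>) \<le> A / (Im \<psi>)\<^sup>2 * norm (g \<psi>) \<and>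
       norm (g (\<psi> + of_real (2 * pi)) - g \<psi>) \<le> A / (Im \<psi>)\<^sup>2 * norm (g (\<psi> + of_real (2 * pi)))"
    and decay: "\<And>\<psi>. \<bar>Re \<psi>\<bar> \<le> 3 * pi / 2 \<Longrightarrow> Im \<psi> < - s0 \<Longrightarrow> norm (g \<psi>) \<le> A / (Im \<psi>)\<^sup>2"
  obtains C s1 where "s1 > s0" "C \<ge> 0"
    "\<forall>\<psi>. \<bar>Re \<psi>\<bar> \<le> pi \<longrightarrow> Im \<psi> \<le> - s1 \<longrightarrow> norm (g \<psi>) \<le> C * exp (Im \<psi>)"
proof -
  define n where "n = real CARD('n)"
  have n: "n \<ge> 1" by (simp add: n_def Suc_le_eq)
  have A: "A \<ge> 0"
  proof -
    have "0 \<le> A / (Im (Complex 0 (- (s0 + 1))))\<^sup>2"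
      by (rule order_trans[OF norm_ge_zero decay]) auto
    then show ?thesis using \<open>s0 > 0\<close> by (simp add: zero_le_divide_iff)
  qed
  \<comment> \<open>This depth makes the contribution of the jump at most half of the weighted supremum.\<close>
  define s1 where "s1 = s0 + 1 + 2 * n * A"
  have nA: "0 \<le> n * A" using n A by simp
  have s1: "s1 > s0" "s1 > 0" using \<open>s0 > 0\<close> nA by (auto simp: s1_def)
  have "n * A / s1 \<le> 1 / 2" using s1 \<open>s0 > 0\<close> nA by (simp add: divide_le_eq s1_def)
  then have half: "n * (A * N / s1) \<le> N / 2" if "N \<ge> 0" for N
    using mult_right_mono[of "n * A / s1" "1 / 2" N] that by (simp add: mult_ac)
  define B where "B = A / s1\<^sup>2"
  have B: "norm (g \<psi>) \<le> B" if "\<bar>Re \<psi>\<bar> \<le> 3 * pi / 2" "Im \<psi> \<le> - s1" for \<psi>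
  proof -
    have "norm (g \<psi>) \<le> A / (Im \<psi>)\<^sup>2" using that s1 by (intro decay) auto
    also have "\<dots> \<le> A / s1\<^sup>2"
      using that s1 A by (intro divide_left_mono) (auto simp: abs_le_square_iff[symmetric])
    finally show ?thesis by (simp add: B_def)
  qed
  have B0: "B \<ge> 0" using A by (simp add: B_def)
  define L where "L = n * (2 * B * exp s1) + B * exp (s1 + 1)"
  have L: "L \<ge> 0" using B0 n by (simp add: L_def)
  define P where "P = {\<psi>. \<bar>Re \<psi>\<bar> \<le> pi \<and> Im \<psi> \<le> - s1}"
  have PB: "norm (g \<psi>) \<le> B" if "\<psi> \<in> P" for \<psi>
  proof (rule B)
    show "\<bar>Re \<psi>\<bar> \<le> 3 * pi / 2" "Im \<psi> \<le> - s1"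
      using that pi_gt_zero unfolding P_def mem_Collect_eq by linarith+
  qed
  \<comment> \<open>The positive \<open>\<kappa>\<close> makes the weighted supremum finite before any exponential decay is known.\<close>
  have weighted: "norm (g \<psi>) \<le> (2 * L) * (exp (Im \<psi>) + \<kappa>)" if \<kappa>: "\<kappa> > 0" and \<psi>P: "\<psi> \<in> P" for \<kappa> \<psi>
  proof -
    define w where "w = (\<lambda>\<psi>. exp (Im \<psi>) + \<kappa>)"
    have w: "w \<psi> > 0" "w \<psi> \<ge> \<kappa>" for \<psi> using \<kappa> by (auto simp: w_def add_pos_pos)
    define N where "N = (SUP \<psi>\<in>P. norm (g \<psi>) / w \<psi>)"
    have bdd: "bdd_above ((\<lambda>\<psi>. norm (g \<psi>) / w \<psi>) ` P)"
    proof (rule bdd_aboveI2)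
      fix \<psi> assume "\<psi> \<in> P"
      then show "norm (g \<psi>) / w \<psi> \<le> B / \<kappa>"
        by (intro frac_le PB B0 w \<kappa>)
    qed
    have N: "norm (g \<psi>) \<le> N * w \<psi>" if "\<psi> \<in> P" for \<psi>
    proof -
      have "norm (g \<psi>) / w \<psi> \<le> N" unfolding N_def by (rule cSUP_upper[OF that bdd])
      then show ?thesis using w(1)[of \<psi>] by (simp add: divide_le_eq)
    qed
    have N0: "N \<ge> 0"
    proof -
      have "0 \<le> norm (g \<psi>) / w \<psi>" using w(1)[of \<psi>] by simp
      also have "\<dots> \<le> N" unfolding N_def by (rule cSUP_upper[OF \<psi>P bdd])
      finally show ?thesis .
    qed
    have step: "norm (g \<psi>) \<le> (L + N / 2) * w \<psi>" if \<psi>: "\<psi> \<in> P" for \<psi>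
    proof -
      define s where "s = - Im \<psi>"
      have w_s: "exp (- s) \<le> w \<psi>" using \<kappa> by (simp add: w_def s_def)
      show ?thesis
      proof (cases "s < s1 + 1")
        case True
        have "norm (g \<psi>) \<le> B * 1" using PB[OF \<psi>] by simp
        also have "\<dots> \<le> B * (exp (s1 + 1) * exp (- s))"
          using True B0 by (intro mult_left_mono) (auto simp: exp_add[symmetric])
        also have "\<dots> = (B * exp (s1 + 1)) * exp (- s)" by simp
        also have "\<dots> \<le> (B * exp (s1 + 1)) * w \<psi>" using w_s B0 by (intro mult_left_mono) auto
        also have "\<dots> \<le> (L + N / 2) * w \<psi>"
          using w(1)[of \<psi>] N0 n B0 by (intro mult_right_mono) (auto simp: L_def)
        finally show ?thesis .
      next
        case False
        then have s: "s1 + 1 \<le> s" by simp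
        have "\<bar>Re \<psi>\<bar> \<le> pi" using \<psi> by (simp add: P_def)
        then obtain x0 where x0: "\<bar>Re \<psi> - x0\<bar> \<le> pi / 2" "x0 = pi / 2 \<or> x0 = - (pi / 2)"
          by (rule half_period_window)
        have x0': "\<bar>x0\<bar> = pi / 2" using x0(2) pi_gt_zero by (elim disjE; linarith)
        have comp: "norm (g \<psi> $ i) \<le> 2 * B * exp s1 * w \<psi> + A * N / s1 * w \<psi>" for i
        proof (rule le_of_le_add_inverse_sq[where m = "s + 1"])
          fix S assume S: "S \<ge> s + 1"
          have near: "norm (g \<psi> $ i - mean_at_depth (\<lambda>\<psi>. g \<psi> $ i) x0 S)
              \<le> 2 * B * exp (- (s - s1)) + (A * N * w \<psi>) / s1 + 2 * (A / S\<^sup>2) * exp (- (S - s))"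
          proof (rule almost_periodic_near_mean[where ?s0.0 = s0 and \<omega> = "\<lambda>\<sigma>. A * N * (exp (- \<sigma>) + \<kappa>)"])
            show "(\<lambda>\<psi>. g \<psi> $ i) holomorphic_on {z. \<bar>Re z - x0\<bar> < 3 * pi / 2 \<and> Im z < - s0}"
              by (rule holomorphic_on_subset[OF holo half_period_window_subset[OF x0']])
          next
            fix \<sigma> assume \<sigma>: "s1 \<le> \<sigma>"
            define \<psi>1 where "\<psi>1 = Complex (x0 - pi) (- \<sigma>)"
            have \<psi>1: "\<bar>Re \<psi>1 + pi\<bar> \<le> pi / 2" "Im \<psi>1 < - s0" "(Im \<psi>1)\<^sup>2 = \<sigma>\<^sup>2"
              using x0' \<sigma> s1 by (auto simp: \<psi>1_def)
            have shift: "Complex (x0 + pi) (- \<sigma>) = \<psi>1 + of_real (2 * pi)"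
              by (simp add: \<psi>1_def complex_eq_iff)
            have "norm (g (\<psi>1 + of_real (2 * pi)) - g \<psi>1) \<le> A / \<sigma>\<^sup>2 * (N * (exp (- \<sigma>) + \<kappa>))"
            proof (cases "x0 = pi / 2")
              case True
              have "\<bar>x0 - pi\<bar> \<le> pi" using True pi_gt_zero by linarith
              then have "\<psi>1 \<in> P" using \<sigma> by (simp add: \<psi>1_def P_def)
              then have "norm (g \<psi>1) \<le> N * (exp (- \<sigma>) + \<kappa>)"
                using N[of \<psi>1] by (simp add: w_def \<psi>1_def)
              then have "A / \<sigma>\<^sup>2 * norm (g \<psi>1) \<le> A / \<sigma>\<^sup>2 * (N * (exp (- \<sigma>) + \<kappa>))"
                using A by (intro mult_left_mono) auto
              then show ?thesis
                using jump[OF \<psi>1(1,2)] unfolding \<psi>1(3) by linarith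
            next
              case False
              then have "\<bar>x0 + pi\<bar> \<le> pi" using x0(2) pi_gt_zero by (elim disjE; linarith)
              then have "\<psi>1 + of_real (2 * pi) \<in> P" using \<sigma> unfolding shift[symmetric] P_def by simp
              then have "norm (g (\<psi>1 + of_real (2 * pi))) \<le> N * (exp (- \<sigma>) + \<kappa>)"
                using N[of "\<psi>1 + of_real (2 * pi)"] by (simp add: w_def \<psi>1_def)
              then have "A / \<sigma>\<^sup>2 * norm (g (\<psi>1 + of_real (2 * pi))) \<le> A / \<sigma>\<^sup>2 * (N * (exp (- \<sigma>) + \<kappa>))"
                using A by (intro mult_left_mono) auto
              then show ?thesis
                using jump[OF \<psi>1(1,2)] unfolding \<psi>1(3) by linarith
            qed
            then show "norm (g (Complex (x0 + pi) (- \<sigma>)) $ i - g (Complex (x0 - pi) (- \<sigma>)) $ i)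
                \<le> A * N * (exp (- \<sigma>) + \<kappa>) / \<sigma>\<^sup>2"
              unfolding shift \<psi>1_def[symmetric]
              using Finite_Cartesian_Product.norm_nth_le[of "g (\<psi>1 + of_real (2 * pi)) - g \<psi>1" i]
              by (simp add: mult_ac)
          next
            fix \<sigma> assume "s1 \<le> \<sigma>"
            have "(exp (- \<sigma>) + \<kappa>) * min 1 (exp (\<sigma> - s)) \<le> w \<psi>"
            proof (cases "\<sigma> \<le> s")
              case True
              have "(exp (- \<sigma>) + \<kappa>) * min 1 (exp (\<sigma> - s)) = exp (- s) + \<kappa> * exp (\<sigma> - s)"
                using True by (simp add: distrib_right exp_add[symmetric])
              also have "\<dots> \<le> w \<psi>" using \<kappa> True by (simp add: w_def s_def mult_le_cancel_left1)
              finally show ?thesis .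
            next
              case False
              then show ?thesis by (simp add: w_def s_def)
            qed
            then show "A * N * (exp (- \<sigma>) + \<kappa>) * min 1 (exp (\<sigma> - s)) \<le> A * N * w \<psi>"
              unfolding mult.assoc[of "A * N"] using A N0 by (intro mult_left_mono) auto
          next
            fix u assume "\<bar>u - x0\<bar> \<le> pi"
            then have u: "\<bar>u\<bar> \<le> 3 * pi / 2" using x0' by linarith
            show "norm (g (Complex u (- s1)) $ i) \<le> B"
              by (rule order_trans[OF Finite_Cartesian_Product.norm_nth_le B]) (use u in auto)
            have "norm (g (Complex u (- S)) $ i) \<le> A / (Im (Complex u (- S)))\<^sup>2"
              by (rule order_trans[OF Finite_Cartesian_Product.norm_nth_le decay]) (use u S s s1 in auto)
            then show "norm (g (Complex u (- S)) $ i) \<le> A / S\<^sup>2" by simp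
          qed (use x0 s s1 S in \<open>auto simp: s_def\<close>)
          have "norm (mean_at_depth (\<lambda>\<psi>. g \<psi> $ i) x0 S) \<le> A / S\<^sup>2"
          proof (rule norm_mean_at_depth_le)
            show "continuous_on (period_segment x0 (- S)) (\<lambda>\<psi>. g \<psi> $ i)"
            proof (rule continuous_on_subset[OF holomorphic_on_imp_continuous_on[OF holo]], rule subsetI,
                rule half_period_window_subset[OF x0', THEN subsetD])
              fix \<zeta> assume "\<zeta> \<in> period_segment x0 (- S)"
              from horizontal_segment[OF this]
              show "\<zeta> \<in> {z. \<bar>Re z - x0\<bar> < 3 * pi / 2 \<and> Im z < - s0}"
                using S s s1 pi_gt_zero unfolding mem_Collect_eq by (intro conjI; linarith)
            qed
            fix u assume "\<bar>u - x0\<bar> \<le> pi"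
            then have u: "\<bar>u\<bar> \<le> 3 * pi / 2" using x0' by linarith
            have "norm (g (Complex u (- S)) $ i) \<le> A / (Im (Complex u (- S)))\<^sup>2"
              by (rule order_trans[OF Finite_Cartesian_Product.norm_nth_le decay]) (use u S s s1 in auto)
            then show "norm (g (Complex u (- S)) $ i) \<le> A / S\<^sup>2" by simp
          qed
          then have "norm (g \<psi> $ i) \<le> (2 * B * exp (- (s - s1)) + (A * N * w \<psi>) / s1
              + 2 * (A / S\<^sup>2) * exp (- (S - s))) + A / S\<^sup>2"
            using near norm_triangle_sub[of "g \<psi> $ i" "mean_at_depth (\<lambda>\<psi>. g \<psi> $ i) x0 S"] by linarith
          also have "\<dots> \<le> 2 * B * exp s1 * w \<psi> + (A * N * w \<psi>) / s1 + 2 * (A / S\<^sup>2) * 1 + A / S\<^sup>2"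
          proof -
            have "2 * B * exp (- (s - s1)) = 2 * B * exp s1 * exp (- s)" by (simp add: exp_diff exp_minus field_simps)
            also have "\<dots> \<le> 2 * B * exp s1 * w \<psi>" using B0 by (intro mult_left_mono w_s) auto
            finally have "2 * B * exp (- (s - s1)) \<le> 2 * B * exp s1 * w \<psi>" .
            moreover have "2 * (A / S\<^sup>2) * exp (- (S - s)) \<le> 2 * (A / S\<^sup>2) * 1"
              using A S by (intro mult_left_mono) auto
            ultimately show ?thesis by linarith
          qed
          finally show "norm (g \<psi> $ i) \<le> 2 * B * exp s1 * w \<psi> + A * N / s1 * w \<psi> + (3 * A) / S\<^sup>2"
            by simp
        qed
        have "norm (g \<psi>) \<le> (\<Sum>i\<in>UNIV. norm (g \<psi> $ i))" by (rule norm_le_sum_norm_vec)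
        also have "\<dots> \<le> (\<Sum>i\<in>(UNIV::'n set). 2 * B * exp s1 * w \<psi> + A * N / s1 * w \<psi>)"
          by (intro sum_mono comp)
        also have "\<dots> = (n * (2 * B * exp s1) + n * (A * N / s1)) * w \<psi>"
          by (simp add: n_def algebra_simps)
        also have "\<dots> \<le> (L + N / 2) * w \<psi>"
          using half[OF N0] w(1)[of \<psi>] B0 by (intro mult_right_mono add_mono) (auto simp: L_def)
        finally show ?thesis .
      qed
    qed
    have "N \<le> L + N / 2"
      unfolding N_def
    proof (rule cSUP_least)
      show "P \<noteq> {}" using \<psi>P by auto
      fix \<psi> assume "\<psi> \<in> P"
      from step[OF this] show "norm (g \<psi>) / w \<psi> \<le> L + (SUP \<psi>\<in>P. norm (g \<psi>) / w \<psi>) / 2"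
        using w(1)[of \<psi>] by (simp add: divide_le_eq N_def)
    qed
    then have "N \<le> 2 * L" by simp
    then have "N * w \<psi> \<le> 2 * L * w \<psi>" using w(1)[of \<psi>] by (intro mult_right_mono) auto
    then show ?thesis using N[OF \<psi>P] by (simp add: w_def)
  qed
  show ?thesis
  proof (rule that[of s1 "2 * L"]; (intro allI impI)?)
    fix \<psi> assume "\<bar>Re \<psi>\<bar> \<le> pi" "Im \<psi> \<le> - s1"
    then have P: "\<psi> \<in> P" by (simp add: P_def)
    show "norm (g \<psi>) \<le> 2 * L * exp (Im \<psi>)"
    proof (rule le_of_le_add_inverse_sq[where m = 1 and K = "2 * L"])
      fix S :: real assume "S \<ge> 1"
      then show "norm (g \<psi>) \<le> 2 * L * exp (Im \<psi>) + 2 * L / S\<^sup>2"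
        using weighted[OF _ P, of "1 / S\<^sup>2"] by (simp add: distrib_left)
    qed
  qed (use s1 L in auto)
qed

text \<open>
  The representation, applied in one window with the bottom side moved to infinity, bounds the
  difference of any two values of \<open>F\<close> by the sum of two exponentials, since both are close to the same mean. Hence
  \<open>F\<close> is Cauchy at the lower end.
\<close>

lemma almost_periodic_limit:
  assumes holo: "F holomorphic_on {z. \<bar>Re z\<bar> < 2 * pi \<and> Im z < - s0}"
    and "s0 > 0" and b: "0 < b" "b \<le> 1"
    and jump: "\<And>\<psi>. \<bar>Re \<psi> + pi\<bar> \<le> pi / 2 \<Longrightarrow> Im \<psi> < - s0 \<Longrightarrow>
       norm (F (\<psi> + of_real (2 * pi)) - F \<psi>) \<le> A * exp (b * Im \<psi>) / (Im \<psi>)\<^sup>2"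
    and bounded: "\<And>\<psi>. \<bar>Re \<psi>\<bar> \<le> 3 * pi / 2 \<Longrightarrow> Im \<psi> < - s0 \<Longrightarrow> norm (F \<psi>) \<le> B"
  obtains \<Theta> C s1 where "\<forall>\<psi>. \<bar>Re \<psi>\<bar> \<le> pi \<longrightarrow> Im \<psi> \<le> - s1 \<longrightarrow> norm (F \<psi> - \<Theta>) \<le> C * exp (b * Im \<psi>)"
proof -
  define s1 where "s1 = s0 + 1"
  have s1: "s1 > s0" "s1 > 0" using \<open>s0 > 0\<close> by (auto simp: s1_def)
  have B0: "B \<ge> 0" by (rule order_trans[OF norm_ge_zero bounded[of "Complex 0 (- s1)"]]) (use s1 in auto)
  have A0: "A \<ge> 0"
  proof -
    have "0 \<le> A * exp (b * Im (Complex (- pi) (- s1))) / (Im (Complex (- pi) (- s1)))\<^sup>2"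
      by (rule order_trans[OF norm_ge_zero jump]) (use s1 in auto)
    then show ?thesis using s1 by (simp add: zero_le_divide_iff zero_le_mult_iff)
  qed
  define K where "K = 2 * B * exp s1 + A / s1"
  define E where "E = (\<lambda>s. K * exp (- b * s))"
  have window: "norm (F \<psi> - F \<psi>') \<le> E (- Im \<psi>) + E (- Im \<psi>')"
    if x0: "x0 = pi / 2 \<or> x0 = - (pi / 2)"
      and \<psi>: "\<bar>Re \<psi> - x0\<bar> \<le> pi / 2" "Im \<psi> \<le> - (s1 + 1)"
      and \<psi>': "\<bar>Re \<psi>' - x0\<bar> \<le> pi / 2" "Im \<psi>' \<le> - (s1 + 1)" for x0 \<psi> \<psi>'
  proof -
    have x0': "\<bar>x0\<bar> = pi / 2" using x0 pi_gt_zero by (elim disjE; linarith)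
    have near: "norm (F \<psi> - mean_at_depth F x0 S) \<le> E (- Im \<psi>) + 2 * B * exp (- (S + Im \<psi>))"
      if \<psi>: "\<bar>Re \<psi> - x0\<bar> \<le> pi / 2" "Im \<psi> \<le> - (s1 + 1)" and S: "S \<ge> 1 - Im \<psi>" for \<psi> S
    proof -
      define s where "s = - Im \<psi>"
      have s: "s1 + 1 \<le> s" "s + 1 \<le> S" using \<psi>(2) S by (auto simp: s_def)
      have "norm (F \<psi> - mean_at_depth F x0 S)
          \<le> 2 * B * exp (- (s - s1)) + (A * exp (- b * s)) / s1 + 2 * B * exp (- (S - s))"
      proof (rule almost_periodic_near_mean[where ?s0.0 = s0 and \<omega> = "\<lambda>\<sigma>. A * exp (- b * \<sigma>)"])
        show "F holomorphic_on {z. \<bar>Re z - x0\<bar> < 3 * pi / 2 \<and> Im z < - s0}"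
          by (rule holomorphic_on_subset[OF holo half_period_window_subset[OF x0']])
      next
        fix \<sigma> assume \<sigma>: "s1 \<le> \<sigma>"
        have shift: "Complex (x0 + pi) (- \<sigma>) = Complex (x0 - pi) (- \<sigma>) + of_real (2 * pi)"
          by (simp add: complex_eq_iff)
        have "norm (F (Complex (x0 - pi) (- \<sigma>) + of_real (2 * pi)) - F (Complex (x0 - pi) (- \<sigma>)))
          \<le> A * exp (b * Im (Complex (x0 - pi) (- \<sigma>))) / (Im (Complex (x0 - pi) (- \<sigma>)))\<^sup>2"
          by (rule jump) (use x0' \<sigma> s1 in auto)
        then show "norm (F (Complex (x0 + pi) (- \<sigma>)) - F (Complex (x0 - pi) (- \<sigma>))) \<le> A * exp (- b * \<sigma>) / \<sigma>\<^sup>2"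
          unfolding shift by simp
      next
        fix \<sigma> assume "s1 \<le> \<sigma>"
        have "exp (- b * \<sigma>) * min 1 (exp (\<sigma> - s)) \<le> exp (- b * s)"
        proof (cases "\<sigma> \<le> s")
          case True
          have "exp (- b * \<sigma>) * min 1 (exp (\<sigma> - s)) \<le> exp (- b * \<sigma>) * exp (\<sigma> - s)"
            by (intro mult_left_mono) auto
          also have "\<dots> = exp (- b * s + (1 - b) * (\<sigma> - s))"
            by (simp add: exp_add[symmetric] algebra_simps)
          also have "\<dots> \<le> exp (- b * s)" using True b by (simp add: mult_nonneg_nonpos)
          finally show ?thesis .
        next
          case False
          then have "b * s \<le> b * \<sigma>" using b by (intro mult_left_mono) auto
          then have "exp (- b * \<sigma>) * min 1 (exp (\<sigma> - s)) \<le> exp (- b * s) * 1"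
            by (intro mult_mono) auto
          then show ?thesis by simp
        qed
        then show "A * exp (- b * \<sigma>) * min 1 (exp (\<sigma> - s)) \<le> A * exp (- b * s)"
          unfolding mult.assoc[of A] using A0 by (intro mult_left_mono) auto
      next
        fix u assume "\<bar>u - x0\<bar> \<le> pi"
            then have u: "\<bar>u\<bar> \<le> 3 * pi / 2" using x0' by linarith
        show "norm (F (Complex u (- s1))) \<le> B" "norm (F (Complex u (- S))) \<le> B"
          by (rule bounded; use u s s1 in auto)+
      qed (use \<psi> s s1 in \<open>auto simp: s_def\<close>)
      also have "2 * B * exp (- (s - s1)) \<le> 2 * B * exp s1 * exp (- b * s)"
      proof -
        have "b * s \<le> 1 * s" using b s s1 by (intro mult_right_mono) auto
        then have "exp (- (s - s1)) \<le> exp s1 * exp (- b * s)"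
          unfolding exp_add[symmetric] by simp
        from mult_left_mono[OF this, of "2 * B"] show ?thesis using B0 by (simp add: mult_ac)
      qed
      finally show ?thesis by (simp add: E_def K_def s_def algebra_simps)
    qed
    show ?thesis
    proof (rule tendsto_lowerbound[where F = at_top])
      have ex: "((\<lambda>S. exp (- (S + a))) \<longlongrightarrow> 0) at_top" for a :: real
      proof -
        have "((\<lambda>S. exp (- a) * exp (- S)) \<longlongrightarrow> exp (- a) * 0) at_top"
          by (intro tendsto_mult tendsto_const filterlim_compose[OF exp_at_bot filterlim_uminus_at_bot_at_top])
        moreover have "exp (- a) * exp (- S) = exp (- (S + a))" for S by (simp add: exp_add[symmetric])
        ultimately show ?thesis by simp
      qed
      have "((\<lambda>S. (E (- Im \<psi>) + 2 * B * exp (- (S + Im \<psi>))) + (E (- Im \<psi>') + 2 * B * exp (- (S + Im \<psi>'))))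
         \<longlongrightarrow> (E (- Im \<psi>) + 2 * B * 0) + (E (- Im \<psi>') + 2 * B * 0)) at_top"
        by (intro tendsto_add tendsto_mult tendsto_const ex)
      then show "((\<lambda>S. (E (- Im \<psi>) + 2 * B * exp (- (S + Im \<psi>))) + (E (- Im \<psi>') + 2 * B * exp (- (S + Im \<psi>'))))
         \<longlongrightarrow> E (- Im \<psi>) + E (- Im \<psi>')) at_top"
        by (simp only: mult_zero_right add_0_right)
      show "\<forall>\<^sub>F S in at_top. norm (F \<psi> - F \<psi>') \<le> (E (- Im \<psi>) + 2 * B * exp (- (S + Im \<psi>))) + (E (- Im \<psi>') + 2 * B * exp (- (S + Im \<psi>')))"
        using eventually_ge_at_top[of "1 - Im \<psi>"] eventually_ge_at_top[of "1 - Im \<psi>'"]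
      proof eventually_elim
        case (elim S)
        then show ?case
          using near[OF \<psi> elim(1)] near[OF \<psi>' elim(2)]
            norm_triangle_ineq4[of "F \<psi> - mean_at_depth F x0 S" "F \<psi>' - mean_at_depth F x0 S"]
          by simp
      qed
    qed auto
  qed
  have E0: "((\<lambda>n. E (real n)) \<longlongrightarrow> 0) sequentially"
  proof -
    have "E (real n) = K * (exp (- b)) ^ n" for n by (simp add: E_def exp_of_nat_mult[symmetric] mult_ac)
    moreover have "((\<lambda>n. K * (exp (- b)) ^ n) \<longlongrightarrow> K * 0) sequentially"
      by (intro tendsto_mult tendsto_const LIMSEQ_realpow_zero) (use b in auto)
    ultimately show ?thesis by simp
  qed
  \<comment> \<open>The imaginary axis lies in both windows, so that one limit serves the whole strip.\<close>
  define f where "f = (\<lambda>n. F (Complex 0 (- real n)))"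
  have f_near: "norm (F \<psi> - f n) \<le> E (- Im \<psi>) + E (real n)"
    if "\<bar>Re \<psi>\<bar> \<le> pi" "Im \<psi> \<le> - (s1 + 1)" "real n \<ge> s1 + 1" for \<psi> n
  proof -
    obtain x0 where x0: "\<bar>Re \<psi> - x0\<bar> \<le> pi / 2" "x0 = pi / 2 \<or> x0 = - (pi / 2)"
      using \<open>\<bar>Re \<psi>\<bar> \<le> pi\<close> by (rule half_period_window)
    have "\<bar>0 - x0\<bar> \<le> pi / 2" using x0(2) pi_gt_zero by (elim disjE; linarith)
    then show ?thesis
      using window[OF x0(2,1) that(2), of "Complex 0 (- real n)"] that(3) by (simp add: f_def)
  qed
  have "Cauchy f"
  proof (rule CauchyI)
    fix e :: real assume e: "e > 0"
    then have "\<forall>\<^sub>F n in sequentially. E (real n) < e / 2" using E0 by (intro order_tendstoD) auto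
    then obtain M where M: "\<And>n. n \<ge> M \<Longrightarrow> E (real n) < e / 2" by (auto simp: eventually_sequentially)
    define M' where "M' = max M (nat \<lceil>s1 + 1\<rceil>)"
    have M': "real n \<ge> s1 + 1" "n \<ge> M" if "n \<ge> M'" for n using that unfolding M'_def by linarith+
    show "\<exists>M. \<forall>m\<ge>M. \<forall>n\<ge>M. norm (f m - f n) < e"
    proof (intro exI[of _ M'] allI impI)
      fix m n assume mn: "m \<ge> M'" "n \<ge> M'"
      have "norm (F (Complex 0 (- real m)) - f n) \<le> E (- Im (Complex 0 (- real m))) + E (real n)"
        by (rule f_near) (use M'(1)[OF mn(1)] M'(1)[OF mn(2)] pi_gt_zero in auto)
      then have "norm (f m - f n) \<le> E (real m) + E (real n)" by (simp add: f_def)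
      then show "norm (f m - f n) < e" using M[OF M'(2)[OF mn(1)]] M[OF M'(2)[OF mn(2)]] by linarith
    qed
  qed
  then obtain \<Theta> where \<Theta>: "f \<longlonglongrightarrow> \<Theta>" using Cauchy_convergent_iff convergent_def by blast
  show ?thesis
  proof (rule that[of "s1 + 1" \<Theta> K], intro allI impI)
    fix \<psi> assume \<psi>: "\<bar>Re \<psi>\<bar> \<le> pi" "Im \<psi> \<le> - (s1 + 1)"
    have "norm (F \<psi> - \<Theta>) \<le> E (- Im \<psi>) + 0"
    proof (rule LIMSEQ_le)
      show "(\<lambda>n. norm (F \<psi> - f n)) \<longlonglongrightarrow> norm (F \<psi> - \<Theta>)" by (intro tendsto_intros \<Theta>)
      show "(\<lambda>n. E (- Im \<psi>) + E (real n)) \<longlonglongrightarrow> E (- Im \<psi>) + 0" by (intro tendsto_intros E0)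
      show "\<exists>N. \<forall>n\<ge>N. norm (F \<psi> - f n) \<le> E (- Im \<psi>) + E (real n)"
      proof (intro exI[of _ "nat \<lceil>s1 + 1\<rceil>"] allI impI)
        fix n assume "n \<ge> nat \<lceil>s1 + 1\<rceil>"
        then have "real n \<ge> s1 + 1" by linarith
        then show "norm (F \<psi> - f n) \<le> E (- Im \<psi>) + E (real n)" by (rule f_near[OF \<psi>])
      qed
    qed
    then show "norm (F \<psi> - \<Theta>) \<le> K * exp (b * Im \<psi>)" by (simp add: E_def)
  qed
qed

section \<open>The first Fourier mode\<close>

lemma norm_vector_scalar_mult: "norm (c *s v) = norm c * norm (v :: complex ^ 'n)"
  by (simp add: norm_vec_def norm_mult L2_set_right_distrib)

text \<open>
  Once \<open>g = O(exp (Im \<psi>))\<close> is known, its jump over a period is quadratic, hence almost of size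
  \<open>exp (2 Im \<psi>)\<close>. So \<open>exp (\<i> \<psi>) g\<close> is bounded with an almost exponentially small jump, and its limit at the lower
  end is the coefficient of the first Fourier mode of \<open>g\<close>.
\<close>

lemma almost_periodic_expansion:
  fixes g :: "complex \<Rightarrow> complex ^ 'n"
  assumes holo: "\<And>i. (\<lambda>\<psi>. g \<psi> $ i) holomorphic_on {z. \<bar>Re z\<bar> < 2 * pi \<and> Im z < - s0}"
    and s0: "s0 \<ge> 1" and A: "A \<ge> 0" and b: "0 < b" "b < 1"
    and jump: "\<And>\<psi>. \<bar>Re \<psi> + pi\<bar> \<le> pi / 2 \<Longrightarrow> Im \<psi> < - s0 \<Longrightarrow>
       norm (g (\<psi> + of_real (2 * pi)) - g \<psi>) \<le> A * \<bar>Im \<psi>\<bar> ^ P * (norm (g \<psi>))\<^sup>2 \<and>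
       norm (g (\<psi> + of_real (2 * pi)) - g \<psi>) \<le> A * \<bar>Im \<psi>\<bar> ^ P * (norm (g (\<psi> + of_real (2 * pi))))\<^sup>2"
    and decay: "\<And>\<psi>. \<bar>Re \<psi>\<bar> \<le> 3 * pi / 2 \<Longrightarrow> Im \<psi> < - s0 \<Longrightarrow> norm (g \<psi>) \<le> A / \<bar>Im \<psi>\<bar> ^ (P + 2)"
  obtains \<Theta> C s1 where "C \<ge> 0" "s1 \<ge> s0"
    "\<forall>\<psi>. \<bar>Re \<psi>\<bar> \<le> pi \<longrightarrow> Im \<psi> \<le> - s1 \<longrightarrow> norm (g \<psi>) \<le> C * exp (Im \<psi>)"
    "\<forall>\<psi>. \<bar>Re \<psi>\<bar> \<le> pi \<longrightarrow> Im \<psi> \<le> - s1 \<longrightarrow> norm (g \<psi> - exp (- \<i> * \<psi>) *s \<Theta>) \<le> C * exp ((1 + b) * Im \<psi>)"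
proof -
  have small: "A * \<bar>Im \<psi>\<bar> ^ P * norm (g \<psi>) \<le> A\<^sup>2 / (Im \<psi>)\<^sup>2"
    if "\<bar>Re \<psi>\<bar> \<le> 3 * pi / 2" "Im \<psi> < - s0" for \<psi>
  proof -
    have "A * \<bar>Im \<psi>\<bar> ^ P * norm (g \<psi>) \<le> A * \<bar>Im \<psi>\<bar> ^ P * (A / \<bar>Im \<psi>\<bar> ^ (P + 2))"
      using A decay[OF that] by (intro mult_left_mono) auto
    also have "\<dots> = A\<^sup>2 / (Im \<psi>)\<^sup>2"
      using that s0 by (simp add: power_add power2_eq_square)
    finally show ?thesis .
  qed
  define A' where "A' = A\<^sup>2 + A"
  have A': "A' \<ge> 0" "A\<^sup>2 \<le> A'" "A \<le> A'" using A by (auto simp: A'_def)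
  have sq: "A * \<bar>Im \<psi>\<bar> ^ P * (norm (g \<psi>))\<^sup>2 \<le> A' / (Im \<psi>)\<^sup>2 * norm (g \<psi>)"
    if "\<bar>Re \<psi>\<bar> \<le> 3 * pi / 2" "Im \<psi> < - s0" for \<psi>
  proof -
    have "A * \<bar>Im \<psi>\<bar> ^ P * (norm (g \<psi>))\<^sup>2 = A * \<bar>Im \<psi>\<bar> ^ P * norm (g \<psi>) * norm (g \<psi>)"
      by (simp add: power2_eq_square)
    also have "\<dots> \<le> A\<^sup>2 / (Im \<psi>)\<^sup>2 * norm (g \<psi>)"
      by (intro mult_right_mono small that) auto
    also have "\<dots> \<le> A' / (Im \<psi>)\<^sup>2 * norm (g \<psi>)"
      by (intro mult_right_mono divide_right_mono A') auto
    finally show ?thesis .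
  qed
  have re: "\<bar>Re \<psi>\<bar> \<le> 3 * pi / 2" "\<bar>Re (\<psi> + of_real (2 * pi))\<bar> \<le> 3 * pi / 2"
    if "\<bar>Re \<psi> + pi\<bar> \<le> pi / 2" for \<psi>
  proof -
    show "\<bar>Re \<psi>\<bar> \<le> 3 * pi / 2" using that pi_gt_zero by linarith
    have "\<bar>Re \<psi> + 2 * pi\<bar> \<le> 3 * pi / 2" using that pi_gt_zero by linarith
    then show "\<bar>Re (\<psi> + of_real (2 * pi))\<bar> \<le> 3 * pi / 2" by simp
  qed
  have jump': "norm (g (\<psi> + of_real (2 * pi)) - g \<psi>) \<le> A' / (Im \<psi>)\<^sup>2 * norm (g \<psi>) \<and>
       norm (g (\<psi> + of_real (2 * pi)) - g \<psi>) \<le> A' / (Im \<psi>)\<^sup>2 * norm (g (\<psi> + of_real (2 * pi)))"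
    if \<psi>: "\<bar>Re \<psi> + pi\<bar> \<le> pi / 2" "Im \<psi> < - s0" for \<psi>
  proof -
    have Im: "Im (\<psi> + of_real (2 * pi)) = Im \<psi>" by simp
    show ?thesis
      using jump[OF \<psi>] sq[OF re(1)[OF \<psi>(1)] \<psi>(2)]
        sq[of "\<psi> + of_real (2 * pi)", unfolded Im, OF re(2)[OF \<psi>(1)] \<psi>(2)]
      by linarith
  qed
  obtain C1 s1 where s1: "s1 > s0" and C1_nonneg: "C1 \<ge> 0" and
    C1_decay: "\<forall>\<psi>. \<bar>Re \<psi>\<bar> \<le> pi \<longrightarrow> Im \<psi> \<le> - s1 \<longrightarrow> norm (g \<psi>) \<le> C1 * exp (Im \<psi>)"
  proof (rule almost_periodic_exp_decay[OF holo _ jump'])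
    show "s0 > 0" using s0 by simp
    fix \<psi> assume \<psi>: "\<bar>Re \<psi>\<bar> \<le> 3 * pi / 2" "Im \<psi> < - s0"
    have "norm (g \<psi>) \<le> A / \<bar>Im \<psi>\<bar> ^ (P + 2)" by (rule decay[OF \<psi>])
    also have "\<dots> \<le> A / \<bar>Im \<psi>\<bar> ^ 2"
      using \<psi> s0 A by (intro divide_left_mono power_increasing mult_pos_pos zero_less_power) auto
    also have "\<dots> \<le> A' / (Im \<psi>)\<^sup>2" by (simp add: divide_right_mono A')
    finally show "norm (g \<psi>) \<le> A' / (Im \<psi>)\<^sup>2" .
  qed blast
  have C1: "C1 \<ge> 0"
    "\<And>\<psi>. \<bar>Re \<psi>\<bar> \<le> pi \<Longrightarrow> Im \<psi> \<le> - s1 \<Longrightarrow> norm (g \<psi>) \<le> C1 * exp (Im \<psi>)"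
    using C1_nonneg C1_decay by auto
  \<comment> \<open>The jump relation carries the bound from the middle period to its two neighbours.\<close>
  define C where "C = (1 + A') * C1"
  have C: "C \<ge> C1" "C \<ge> 0"
    using A' C1(1) by (auto simp: C_def distrib_right)
  have wide: "norm (g \<psi>) \<le> C * exp (Im \<psi>)" if \<psi>: "\<bar>Re \<psi>\<bar> \<le> 3 * pi / 2" "Im \<psi> \<le> - s1" for \<psi>
  proof -
    have le1: "A' / (Im z)\<^sup>2 \<le> A'" if "Im z \<le> - s1" for z
    proof -
      have "1 \<le> (Im z)\<^sup>2" using that s1 s0 power_mono[of 1 "\<bar>Im z\<bar>" 2] by simp
      then show ?thesis using A' by (simp add: divide_le_eq mult_le_cancel_left1)
    qed
    have key: "norm u \<le> C * exp y" if "norm w \<le> C1 * exp y" "norm (u - w) \<le> K * norm w" "K \<le> A'"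
      for u w :: "complex ^ 'n" and K y :: real
    proof -
      have "norm u \<le> norm w + norm (u - w)" by (metis add.commute norm_triangle_sub)
      also have "\<dots> \<le> norm w + A' * norm w"
        using that(2) mult_right_mono[OF that(3), of "norm w"] by simp
      also have "\<dots> = (1 + A') * norm w" by (simp add: algebra_simps)
      also have "\<dots> \<le> (1 + A') * (C1 * exp y)" using A' that(1) by (intro mult_left_mono) auto
      finally show ?thesis by (simp add: C_def)
    qed
    consider "\<bar>Re \<psi>\<bar> \<le> pi" | "Re \<psi> < - pi" | "Re \<psi> > pi" by linarith
    then show ?thesis
    proof cases
      case 1
      then show ?thesis by (intro order_trans[OF C1(2)[OF 1 \<psi>(2)]] mult_right_mono C(1)) auto
    next
      case 2
      have r: "\<bar>Re \<psi> + pi\<bar> \<le> pi / 2" "\<bar>Re \<psi> + 2 * pi\<bar> \<le> pi" using 2 \<psi>(1) by linarith+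
      then have "norm (g (\<psi> + of_real (2 * pi))) \<le> C1 * exp (Im \<psi>)"
        using C1(2)[of "\<psi> + of_real (2 * pi)"] \<psi>(2) by simp
      then show ?thesis
      proof (rule key)
        show "norm (g \<psi> - g (\<psi> + of_real (2 * pi))) \<le> A' / (Im \<psi>)\<^sup>2 * norm (g (\<psi> + of_real (2 * pi)))"
          using jump'[OF r(1)] \<psi>(2) s1 by (simp add: norm_minus_commute)
      qed (rule le1[OF \<psi>(2)])
    next
      case 3
      define z where "z = \<psi> - of_real (2 * pi)"
      have z: "\<psi> = z + of_real (2 * pi)" "Im z = Im \<psi>" "Re z = Re \<psi> - 2 * pi" by (simp_all add: z_def)
      have r: "\<bar>Re z + pi\<bar> \<le> pi / 2" "\<bar>Re z\<bar> \<le> pi" using 3 \<psi>(1) unfolding z(3) by linarith+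
      have "norm (g z) \<le> C1 * exp (Im \<psi>)" using C1(2)[OF r(2)] \<psi>(2) z(2) by simp
      then show ?thesis
      proof (rule key)
        show "norm (g \<psi> - g z) \<le> A' / (Im z)\<^sup>2 * norm (g z)"
          using jump'[OF r(1)] \<psi>(2) s1 unfolding z(1)[symmetric] z(2) by simp
      qed (rule le1, use z \<psi> in simp)
    qed
  qed
  define K where "K = (real (Suc (P + 2)) / (1 - b)) ^ (P + 2)"
  \<comment> \<open>Multiplication by \<open>exp (\<i> \<psi>)\<close> turns the first Fourier mode into a constant.\<close>
  define f where "f = (\<lambda>i \<psi>. exp (\<i> * \<psi>) * g \<psi> $ i)"
  have "\<exists>\<Theta> C s2. \<forall>\<psi>. \<bar>Re \<psi>\<bar> \<le> pi \<longrightarrow> Im \<psi> \<le> - s2 \<longrightarrow> norm (f i \<psi> - \<Theta>) \<le> C * exp (b * Im \<psi>)" for i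
  proof -
    obtain \<Theta> C' s2 where "\<forall>\<psi>. \<bar>Re \<psi>\<bar> \<le> pi \<longrightarrow> Im \<psi> \<le> - s2 \<longrightarrow> norm (f i \<psi> - \<Theta>) \<le> C' * exp (b * Im \<psi>)"
    proof (rule almost_periodic_limit)
      show "f i holomorphic_on {z. \<bar>Re z\<bar> < 2 * pi \<and> Im z < - s1}"
        unfolding f_def by (intro holomorphic_intros holomorphic_on_subset[OF holo]) (use s1 in auto)
      show "s1 > 0" "0 < b" "b \<le> 1" using s0 s1 b by auto
      fix \<psi> assume \<psi>: "\<bar>Re \<psi>\<bar> \<le> 3 * pi / 2" "Im \<psi> < - s1"
      have "norm (f i \<psi>) = exp (- Im \<psi>) * norm (g \<psi> $ i)" by (simp add: f_def norm_mult)
      also have "\<dots> \<le> exp (- Im \<psi>) * (C * exp (Im \<psi>))"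
        by (intro mult_left_mono order_trans[OF Finite_Cartesian_Product.norm_nth_le wide]) (use \<psi> in auto)
      also have "\<dots> = C" by (simp add: exp_minus)
      finally show "norm (f i \<psi>) \<le> C" .
    next
      fix \<psi> assume \<psi>: "\<bar>Re \<psi> + pi\<bar> \<le> pi / 2" "Im \<psi> < - s1"
      define s where "s = - Im \<psi>"
      have s: "s > s1" "s \<ge> 1" using \<psi>(2) s0 s1 by (auto simp: s_def)
      have "exp (\<i> * (\<psi> + of_real (2 * pi))) = exp (\<i> * \<psi>)"
      proof -
        have "\<i> * (\<psi> + of_real (2 * pi)) = \<i> * \<psi> + 2 * of_real pi * \<i>" by (simp add: algebra_simps)
        then show ?thesis by (simp only: exp_add exp_two_pi_i mult_1_right)
      qed
      then have "f i (\<psi> + of_real (2 * pi)) - f i \<psi> = exp (\<i> * \<psi>) * (g (\<psi> + of_real (2 * pi)) - g \<psi>) $ i"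
        unfolding f_def by (simp only: right_diff_distrib vector_minus_component)
      then have "norm (f i (\<psi> + of_real (2 * pi)) - f i \<psi>) = exp s * norm ((g (\<psi> + of_real (2 * pi)) - g \<psi>) $ i)"
        by (simp only: norm_mult norm_exp_i s_def)
      also have "\<dots> \<le> exp s * (A * s ^ P * (norm (g \<psi>))\<^sup>2)"
        using jump[OF \<psi>(1)] \<psi>(2) s s1 Finite_Cartesian_Product.norm_nth_le[of "g (\<psi> + of_real (2 * pi)) - g \<psi>" i]
        by (intro mult_left_mono) (auto simp: s_def)
      also have "\<dots> \<le> exp s * (A * s ^ P * (C * exp (- s))\<^sup>2)"
        using wide[OF re(1)[OF \<psi>(1)]] \<psi>(2) A s by (intro mult_left_mono power_mono) (auto simp: s_def)
      also have "\<dots> = A * C\<^sup>2 * (s ^ (P + 2) * exp (- s)) / s\<^sup>2"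
        using s by (simp add: power_add power2_eq_square exp_minus field_simps)
      also have "\<dots> \<le> A * C\<^sup>2 * (K * exp (- b * s)) / s\<^sup>2"
      proof -
        have "s ^ (P + 2) * exp (- s) \<le> (K * exp ((1 - b) * s)) * exp (- s)"
          unfolding K_def using b s by (intro mult_right_mono power_le_exp) auto
        also have "\<dots> = K * exp (- b * s)" by (simp add: exp_add[symmetric] algebra_simps)
        finally show ?thesis using A by (intro divide_right_mono mult_left_mono) auto
      qed
      also have "\<dots> = A * C\<^sup>2 * K * exp (b * Im \<psi>) / (Im \<psi>)\<^sup>2" by (simp add: s_def)
      finally show "norm (f i (\<psi> + of_real (2 * pi)) - f i \<psi>) \<le> A * C\<^sup>2 * K * exp (b * Im \<psi>) / (Im \<psi>)\<^sup>2" .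
    qed blast
    then show ?thesis by blast
  qed
  then have "\<forall>i. \<exists>\<Theta> C s2. \<forall>\<psi>. \<bar>Re \<psi>\<bar> \<le> pi \<longrightarrow> Im \<psi> \<le> - s2 \<longrightarrow> norm (f i \<psi> - \<Theta>) \<le> C * exp (b * Im \<psi>)"
    by (rule allI)
  then have "\<exists>\<Theta> C s2. \<forall>i \<psi>. \<bar>Re \<psi>\<bar> \<le> pi \<longrightarrow> Im \<psi> \<le> - s2 i \<longrightarrow> norm (f i \<psi> - \<Theta> i) \<le> C i * exp (b * Im \<psi>)"
    by (simp only: choice_iff)
  then obtain \<Theta> D s2 where \<Theta>: "\<And>i \<psi>. \<bar>Re \<psi>\<bar> \<le> pi \<Longrightarrow> Im \<psi> \<le> - s2 i \<Longrightarrow> norm (f i \<psi> - \<Theta> i) \<le> D i * exp (b * Im \<psi>)"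
    by blast
  define E where "E = C + (\<Sum>i\<in>UNIV. \<bar>D i\<bar>)"
  define s3 where "s3 = Max (insert s1 (range s2))"
  have s3: "s3 \<ge> s1" "s3 \<ge> s2 i" for i unfolding s3_def by (rule Max_ge; simp)+
  show ?thesis
  proof (rule that[of E s3 "\<chi> i. \<Theta> i"]; (intro allI impI)?)
    show "E \<ge> 0" using C by (simp add: E_def sum_nonneg)
    show "s3 \<ge> s0" using s3(1) s1 by simp
    fix \<psi> assume \<psi>: "\<bar>Re \<psi>\<bar> \<le> pi" "Im \<psi> \<le> - s3"
    have "norm (g \<psi>) \<le> C1 * exp (Im \<psi>)" by (rule C1(2)) (use \<psi> s3(1) in auto)
    also have "\<dots> \<le> E * exp (Im \<psi>)"
      using C by (intro mult_right_mono) (auto simp: E_def intro: add_increasing2 sum_nonneg)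
    finally show "norm (g \<psi>) \<le> E * exp (Im \<psi>)" .
  next
    fix \<psi> assume \<psi>: "\<bar>Re \<psi>\<bar> \<le> pi" "Im \<psi> \<le> - s3"
    have "norm (g \<psi> - exp (- \<i> * \<psi>) *s (\<chi> i. \<Theta> i)) \<le> (\<Sum>i\<in>UNIV. norm ((g \<psi> - exp (- \<i> * \<psi>) *s (\<chi> i. \<Theta> i)) $ i))"
      by (rule norm_le_sum_norm_vec)
    also have "\<dots> \<le> (\<Sum>i\<in>UNIV. \<bar>D i\<bar> * exp ((1 + b) * Im \<psi>))"
    proof (rule sum_mono)
      fix i
      have e: "exp (- \<i> * \<psi>) * exp (\<i> * \<psi>) = 1" by (simp add: exp_add[symmetric])
      have "(g \<psi> - exp (- \<i> * \<psi>) *s (\<chi> i. \<Theta> i)) $ i = exp (- \<i> * \<psi>) * (f i \<psi> - \<Theta> i)"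
        unfolding f_def right_diff_distrib mult.assoc[symmetric] e by simp
      then have "norm ((g \<psi> - exp (- \<i> * \<psi>) *s (\<chi> i. \<Theta> i)) $ i) = exp (Im \<psi>) * norm (f i \<psi> - \<Theta> i)"
        by (simp only: norm_mult) simp
      also have "\<dots> \<le> exp (Im \<psi>) * (D i * exp (b * Im \<psi>))"
        by (intro mult_left_mono \<Theta>) (use \<psi> s3(2)[of i] in auto)
      also have "\<dots> \<le> exp (Im \<psi>) * (\<bar>D i\<bar> * exp (b * Im \<psi>))"
        by (intro mult_left_mono mult_right_mono) auto
      also have "\<dots> = \<bar>D i\<bar> * exp ((1 + b) * Im \<psi>)" by (simp add: distrib_right exp_add)
      finally show "norm ((g \<psi> - exp (- \<i> * \<psi>) *s (\<chi> i. \<Theta> i)) $ i) \<le> \<bar>D i\<bar> * exp ((1 + b) * Im \<psi>)" .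
    qed
    also have "\<dots> \<le> E * exp ((1 + b) * Im \<psi>)"
      unfolding sum_distrib_right[symmetric] using C by (intro mult_right_mono) (auto simp: E_def)
    finally show "norm (g \<psi> - exp (- \<i> * \<psi>) *s (\<chi> i. \<Theta> i)) \<le> E * exp ((1 + b) * Im \<psi>)" .
  qed
qed

section \<open>Quadratic perturbations of the transport equation\<close>

lemma periodic_int_shift:
  assumes per: "\<And>\<phi>. \<phi> \<in> T_strip h \<Longrightarrow> f (\<phi> + of_real (2 * pi)) = f \<phi>" and "\<phi> \<in> T_strip h"
  shows "f (\<phi> + of_real (2 * pi * of_int n)) = f \<phi>"
proof (induction n rule: int_induct[where k = 0])
  case (step1 n)
  have "\<phi> + of_real (2 * pi * of_int n) \<in> T_strip h" using assms(2) by (simp add: T_strip_def)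
  from per[OF this] show ?case using step1 by (simp add: algebra_simps)
next
  case (step2 n)
  have "\<phi> + of_real (2 * pi * of_int (n - 1)) \<in> T_strip h" using assms(2) by (simp add: T_strip_def)
  from per[OF this] show ?case using step2 by (simp add: algebra_simps)
qed simp

text \<open>
  Along the characteristics \<open>(\<phi> + t, \<tau> + t)\<close> the function \<open>c\<close> is constant up to quadratic terms. Hence it is
  determined, up to such terms, by \<open>g \<psi> = c 0 \<psi>\<close>, and the periodicity in \<open>\<phi>\<close> makes \<open>g\<close> almost periodic in
  \<open>\<psi>\<close>. A general point is joined to the slice \<open>\<phi> = 2 \<pi> n\<close> by a complex segment in the characteristic direction,
  with \<open>n\<close> chosen such that the endpoint lies within half a period of the imaginary axis. In the cone the length of the
  segment is at most a multiple of \<open>- Im \<tau>\<close>, which the decay of \<open>c\<close> absorbs.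
\<close>

lemma quadratic_transport_expansion:
  fixes c c' :: "complex \<Rightarrow> complex \<Rightarrow> complex ^ 'n"
  assumes h: "h > 0"
    and \<Omega>: "convex \<Omega>" "\<And>\<tau>. \<tau> \<in> \<Omega> \<Longrightarrow> \<bar>Re \<tau>\<bar> \<le> k * (- Im \<tau>)"
      "\<And>\<psi>. \<bar>Re \<psi>\<bar> \<le> 2 * pi \<Longrightarrow> Im \<psi> \<le> - R \<Longrightarrow> \<psi> \<in> \<Omega>"
    and R: "R \<ge> 1" and A: "A \<ge> 0" and b: "0 < b" "b < 1"
    and per: "\<And>\<phi> \<tau>. \<phi> \<in> T_strip h \<Longrightarrow> \<tau> \<in> \<Omega> \<Longrightarrow> Im \<tau> \<le> - R \<Longrightarrow> c (\<phi> + of_real (2 * pi)) \<tau> = c \<phi> \<tau>"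
    and deriv: "\<And>\<phi> \<tau> t l. \<phi> + of_real l * t \<in> T_strip h \<Longrightarrow> \<tau> + of_real l * t \<in> \<Omega> \<Longrightarrow> Im (\<tau> + of_real l * t) \<le> - R \<Longrightarrow>
        ((\<lambda>l. c (\<phi> + of_real l * t) (\<tau> + of_real l * t)) has_vector_derivative
          t *s c' (\<phi> + of_real l * t) (\<tau> + of_real l * t)) (at l)"
    and quad: "\<And>\<phi> \<tau>. \<phi> \<in> T_strip h \<Longrightarrow> \<tau> \<in> \<Omega> \<Longrightarrow> Im \<tau> \<le> - R \<Longrightarrow>
        norm (c' \<phi> \<tau>) \<le> A * \<bar>Im \<tau>\<bar> ^ P * (norm (c \<phi> \<tau>))\<^sup>2"
    and decay: "\<And>\<phi> \<tau>. \<phi> \<in> T_strip h \<Longrightarrow> \<tau> \<in> \<Omega> \<Longrightarrow> Im \<tau> \<le> - R \<Longrightarrow> norm (c \<phi> \<tau>) \<le> A / \<bar>Im \<tau>\<bar> ^ (P + 2)"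
    and holo: "\<And>\<tau> i. \<tau> \<in> \<Omega> \<Longrightarrow> Im \<tau> \<le> - R \<Longrightarrow> (\<lambda>\<tau>. c 0 \<tau> $ i) field_differentiable (at \<tau>)"
  shows "\<exists>\<Theta> C R'. \<forall>\<phi>\<in>T_strip h. \<forall>\<tau>\<in>\<Omega>. Im \<tau> \<le> - R' \<longrightarrow>
    norm (c \<phi> \<tau> - exp (- \<i> * (\<tau> - \<phi>)) *s \<Theta>) \<le> C * exp ((1 + b) * Im \<tau>)"
proof -
  have T0: "0 \<in> T_strip h" using h by (simp add: T_strip_def)
  \<comment> \<open>From this depth on \<open>c\<close> is small enough for lemma \<open>quadratic_ode_increment\<close>.\<close>
  define s0 where "s0 = R + 8 * pi * A\<^sup>2"
  have s0: "s0 \<ge> R" "s0 \<ge> 1" using R pi_gt_zero by (auto simp: s0_def add_increasing2)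
  define A1 where "A1 = 8 * pi * A"
  have A1: "A1 \<ge> A" "A1 \<ge> 0"
  proof -
    have "1 * A \<le> (8 * pi) * A" using A pi_ge_two by (intro mult_right_mono) auto
    then show "A1 \<ge> A" by (simp add: A1_def)
    then show "A1 \<ge> 0" using A by simp
  qed
  \<comment> \<open>Going once around the cylinder in \<open>\<phi>\<close> moves the characteristic by one period in \<open>\<tau>\<close>.\<close>
  have jump: "norm (c 0 (\<psi> + of_real (2 * pi)) - c 0 \<psi>) \<le> A1 * \<bar>Im \<psi>\<bar> ^ P * (norm (c 0 \<psi>))\<^sup>2 \<and>
     norm (c 0 (\<psi> + of_real (2 * pi)) - c 0 \<psi>) \<le> A1 * \<bar>Im \<psi>\<bar> ^ P * (norm (c 0 (\<psi> + of_real (2 * pi))))\<^sup>2"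
    if \<psi>: "\<bar>Re \<psi> + pi\<bar> \<le> pi / 2" "Im \<psi> < - s0" for \<psi>
  proof -
    define t :: complex where "t = of_real (2 * pi)"
    define y where "y = (\<lambda>l::real. c (0 + of_real l * t) (\<psi> + of_real l * t))"
    define s where "s = \<bar>Im \<psi>\<bar>"
    have s: "s > s0" "s > 0" "s \<ge> 1" using \<psi>(2) s0 by (auto simp: s_def)
    define K where "K = 2 * pi * A * s ^ P"
    have K0: "K \<ge> 0" using A s by (simp add: K_def)
    have Im: "Im (\<psi> + of_real l * t) = Im \<psi>" "Re (\<psi> + of_real l * t) = Re \<psi> + 2 * pi * l" for l :: real
      by (simp_all add: t_def)
    have T: "0 + of_real l * t \<in> T_strip h" for l :: real using h by (simp add: T_strip_def t_def)
    have D: "\<psi> + of_real l * t \<in> \<Omega>" "Im (\<psi> + of_real l * t) \<le> - R" if "l \<in> {0..1}" for l :: real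
    proof -
      have "0 \<le> 2 * pi * l" "2 * pi * l \<le> 2 * pi"
        using that mult_left_mono[of l 1 "2 * pi"] pi_gt_zero by simp_all
      then have "\<bar>Re (\<psi> + of_real l * t)\<bar> \<le> 2 * pi" unfolding Im using \<psi>(1) by linarith
      moreover show "Im (\<psi> + of_real l * t) \<le> - R" unfolding Im using \<psi>(2) s0 by linarith
      ultimately show "\<psi> + of_real l * t \<in> \<Omega>" by (rule \<Omega>(3))
    qed
    have yc: "norm (y l) \<le> A / s ^ (P + 2)" if "l \<in> {0..1}" for l
      unfolding y_def s_def by (rule decay[OF T D[OF that], unfolded Im])
    have small: "K * norm (y l) \<le> 1 / 2" if "l \<in> {0..1}" for l
    proof -
      have "K * norm (y l) \<le> K * (A / s ^ (P + 2))" using yc[OF that] K0 by (rule mult_left_mono)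
      also have "\<dots> = 2 * pi * A\<^sup>2 / s\<^sup>2" using s by (simp add: K_def power_add power2_eq_square)
      also have "\<dots> \<le> 1 / 2"
      proof -
        have "8 * pi * A\<^sup>2 \<le> s" using s R by (simp add: s0_def)
        also have "s \<le> s\<^sup>2" using s by (simp add: power2_eq_square mult_le_cancel_left1)
        finally have "8 * pi * A\<^sup>2 \<le> s\<^sup>2" .
        moreover have "0 \<le> pi * A\<^sup>2" by simp
        ultimately have "4 * pi * A\<^sup>2 \<le> s\<^sup>2" by linarith
        then show ?thesis using s by (simp add: divide_le_eq)
      qed
      finally show ?thesis .
    qed
    have der: "(y has_vector_derivative t *s c' (0 + of_real l * t) (\<psi> + of_real l * t)) (at l within {0..1})"
      if "l \<in> {0..1}" for l
      unfolding y_def by (rule has_vector_derivative_at_within[OF deriv[OF T D[OF that]]])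
    have bd: "norm (t *s c' (0 + of_real l * t) (\<psi> + of_real l * t)) \<le> K * (norm (y l))\<^sup>2"
      if "l \<in> {0..1}" for l
    proof -
      have "norm (t *s c' (0 + of_real l * t) (\<psi> + of_real l * t)) \<le> 2 * pi * (A * s ^ P * (norm (y l))\<^sup>2)"
        unfolding norm_vector_scalar_mult y_def s_def
        by (intro mult_mono quad[OF T D[OF that], unfolded Im]) (auto simp: t_def)
      then show ?thesis by (simp add: K_def mult_ac)
    qed
    have y0: "y 0 = c 0 \<psi>" by (simp add: y_def)
    have "\<psi> + of_real 1 * t \<in> \<Omega>" "Im (\<psi> + of_real 1 * t) \<le> - R" by (rule D; simp)+
    then have "c (0 + of_real (2 * pi)) (\<psi> + t) = c 0 (\<psi> + t)"
      using per[OF T0, of "\<psi> + t"] by simp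
    then have y1: "y 1 = c 0 (\<psi> + of_real (2 * pi))" by (simp add: y_def t_def)
    have K4: "4 * K = A1 * \<bar>Im \<psi>\<bar> ^ P" by (simp add: K_def A1_def s_def)
    show ?thesis
      using quadratic_ode_increment[OF der bd small K0] unfolding y0 y1 K4 by blast
  qed
  have holo0: "(\<lambda>\<psi>. c 0 \<psi> $ i) holomorphic_on {z. \<bar>Re z\<bar> < 2 * pi \<and> Im z < - s0}" for i
  proof (rule holomorphic_onI, rule field_differentiable_at_within)
    fix \<psi> assume "\<psi> \<in> {z. \<bar>Re z\<bar> < 2 * pi \<and> Im z < - s0}"
    then have "\<bar>Re \<psi>\<bar> \<le> 2 * pi" "Im \<psi> \<le> - R" using s0 by auto
    then show "(\<lambda>\<psi>. c 0 \<psi> $ i) field_differentiable (at \<psi>)" by (intro holo \<Omega>(3))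
  qed
  have g_decay: "norm (c 0 \<psi>) \<le> A1 / \<bar>Im \<psi>\<bar> ^ (P + 2)" if "\<bar>Re \<psi>\<bar> \<le> 3 * pi / 2" "Im \<psi> < - s0" for \<psi>
  proof -
    have r: "\<bar>Re \<psi>\<bar> \<le> 2 * pi" "Im \<psi> \<le> - R" using that s0 pi_gt_zero by linarith+
    have "norm (c 0 \<psi>) \<le> A / \<bar>Im \<psi>\<bar> ^ (P + 2)" by (rule decay[OF T0 \<Omega>(3)[OF r] r(2)])
    also have "\<dots> \<le> A1 / \<bar>Im \<psi>\<bar> ^ (P + 2)" by (intro divide_right_mono A1) auto
    finally show ?thesis .
  qed
  obtain \<Theta> C s1 where C0: "C \<ge> 0" "s1 \<ge> s0"
    "\<forall>\<psi>. \<bar>Re \<psi>\<bar> \<le> pi \<longrightarrow> Im \<psi> \<le> - s1 \<longrightarrow> norm (c 0 \<psi>) \<le> C * exp (Im \<psi>)"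
    "\<forall>\<psi>. \<bar>Re \<psi>\<bar> \<le> pi \<longrightarrow> Im \<psi> \<le> - s1 \<longrightarrow> norm (c 0 \<psi> - exp (- \<i> * \<psi>) *s \<Theta>) \<le> C * exp ((1 + b) * Im \<psi>)"
    by (rule almost_periodic_expansion[OF holo0 s0(2) A1(2) b jump g_decay])
  note C = C0(1,2) C0(3,4)[rule_format]
  define \<kappa> where "\<kappa> = pi + \<bar>k\<bar> + h"
  have \<kappa>: "\<kappa> > 0" using h pi_gt_zero by (simp add: \<kappa>_def add_pos_nonneg add_pos_pos)
  define M where "M = \<kappa> * A * 2 ^ P"
  have M: "M \<ge> 0" using \<kappa> A by (simp add: M_def)
  define R' where "R' = 2 * R + 2 * h + s1 + h + 2 * M * A * 2 ^ (P + 2) + 1"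
  define K where "K = (real (Suc (P + 1)) / (1 - b)) ^ (P + 1)"
  define C' where "C' = 4 * M * C\<^sup>2 * exp (2 * h) * K + C * exp ((1 + b) * h)"
  show ?thesis
  proof (rule exI[of _ \<Theta>], rule exI[of _ C'], rule exI[of _ R'], intro ballI impI)
    fix \<phi> \<tau> assume \<phi>: "\<phi> \<in> T_strip h" and \<tau>: "\<tau> \<in> \<Omega>" "Im \<tau> \<le> - R'"
    define s where "s = - Im \<tau>"
    have MA: "0 \<le> 2 * M * A * 2 ^ (P + 2)" using M A by simp
    have s: "s \<ge> 2 * R" "s \<ge> 2 * h" "s \<ge> s1 + h" "s \<ge> 2 * M * A * 2 ^ (P + 2)" "s \<ge> 1"
      using \<tau>(2) R h C(2) s0 MA unfolding R'_def s_def by linarith+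
    have \<phi>h: "\<bar>Im \<phi>\<bar> < h" using \<phi> by (simp add: T_strip_def)
    define n :: int where "n = - round (Re (\<tau> - \<phi>) / (2 * pi))"
    define \<psi> where "\<psi> = \<tau> - \<phi> + of_real (2 * pi * of_int n)"
    have \<psi>_Re: "\<bar>Re \<psi>\<bar> \<le> pi"
    proof -
      have "Re \<psi> = 2 * pi * (Re (\<tau> - \<phi>) / (2 * pi) - of_int (round (Re (\<tau> - \<phi>) / (2 * pi))))"
        by (simp add: \<psi>_def n_def field_simps)
      then have "\<bar>Re \<psi>\<bar> = 2 * pi * \<bar>of_int (round (Re (\<tau> - \<phi>) / (2 * pi))) - Re (\<tau> - \<phi>) / (2 * pi)\<bar>"
        by (simp add: abs_mult abs_minus_commute)
      also have "\<dots> \<le> 2 * pi * (1 / 2)" by (intro mult_left_mono of_int_round_abs_le) auto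
      finally show ?thesis by simp
    qed
    have \<psi>_Im: "Im \<psi> = Im \<tau> - Im \<phi>" by (simp add: \<psi>_def)
    have \<psi>_deep: "Im \<psi> \<le> - s1" "Im \<psi> \<le> - R" using s R h \<phi>h unfolding \<psi>_Im s_def by linarith+
    have \<psi>\<Omega>: "\<psi> \<in> \<Omega>" by (rule \<Omega>(3)) (use \<psi>_Re \<psi>_deep pi_gt_zero in auto)
    define t where "t = \<psi> - \<tau>"
    have t: "t = of_real (2 * pi * of_int n) - \<phi>" by (simp add: t_def \<psi>_def)
    define y where "y = (\<lambda>l::real. c (\<phi> + of_real l * t) (\<tau> + of_real l * t))"
    have T: "\<phi> + of_real l * t \<in> T_strip h" if "l \<in> {0..1}" for l :: real
    proof -
      have "Im (\<phi> + of_real l * t) = (1 - l) * Im \<phi>" by (simp add: t algebra_simps)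
      then have "\<bar>Im (\<phi> + of_real l * t)\<bar> \<le> 1 * \<bar>Im \<phi>\<bar>"
        using that by (simp only: abs_mult) (intro mult_right_mono; simp)
      then show ?thesis using \<phi>h by (simp add: T_strip_def)
    qed
    have \<Omega>l: "\<tau> + of_real l * t \<in> \<Omega>" if "l \<in> {0..1}" for l :: real
    proof -
      have "\<tau> + of_real l * t = (1 - l) *\<^sub>R \<tau> + l *\<^sub>R \<psi>"
        by (simp add: t_def scaleR_conv_of_real algebra_simps)
      then show ?thesis using convexD_alt[OF \<Omega>(1) \<tau>(1) \<psi>\<Omega>] that by simp
    qed
    have depth: "s / 2 \<le> \<bar>Im (\<tau> + of_real l * t)\<bar>" "\<bar>Im (\<tau> + of_real l * t)\<bar> \<le> 2 * s"
      "Im (\<tau> + of_real l * t) \<le> - R" if "l \<in> {0..1}" for l :: real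
    proof -
      have eq: "Im (\<tau> + of_real l * t) = - s - l * Im \<phi>" by (simp add: t s_def)
      have "\<bar>l * Im \<phi>\<bar> \<le> 1 * h" unfolding abs_mult using that \<phi>h by (intro mult_mono) auto
      then show "s / 2 \<le> \<bar>Im (\<tau> + of_real l * t)\<bar>" "\<bar>Im (\<tau> + of_real l * t)\<bar> \<le> 2 * s"
        "Im (\<tau> + of_real l * t) \<le> - R" unfolding eq using s h R by linarith+
    qed
    define B where "B = M * s ^ (P + 1)"
    have B0: "B \<ge> 0" using M s by (simp add: B_def)
    have t_le: "norm t \<le> \<kappa> * s"
    proof -
      have "norm t \<le> \<bar>Re t\<bar> + \<bar>Im t\<bar>" by (rule cmod_le)
      also have "\<dots> \<le> \<bar>Re \<psi>\<bar> + \<bar>Re \<tau>\<bar> + \<bar>Im \<phi>\<bar>" by (simp add: t_def \<psi>_Im)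
      also have "\<dots> \<le> pi + \<bar>k\<bar> * s + h"
      proof -
        have "\<bar>Re \<tau>\<bar> \<le> k * s" using \<Omega>(2)[OF \<tau>(1)] by (simp add: s_def)
        also have "\<dots> \<le> \<bar>k\<bar> * s" using s by (intro mult_right_mono) auto
        finally show ?thesis using \<psi>_Re \<phi>h by linarith
      qed
      also have "\<dots> \<le> pi * s + \<bar>k\<bar> * s + h * s"
        using s h pi_gt_zero by (intro add_mono) (auto simp: mult_le_cancel_left1)
      finally show ?thesis by (simp add: \<kappa>_def algebra_simps)
    qed
    have der: "(y has_vector_derivative t *s c' (\<phi> + of_real l * t) (\<tau> + of_real l * t)) (at l within {0..1})"
      if "l \<in> {0..1}" for l
      unfolding y_def by (rule has_vector_derivative_at_within[OF deriv[OF T[OF that] \<Omega>l[OF that] depth(3)[OF that]]])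
    have bd: "norm (t *s c' (\<phi> + of_real l * t) (\<tau> + of_real l * t)) \<le> B * (norm (y l))\<^sup>2"
      if "l \<in> {0..1}" for l
    proof -
      have "norm (c' (\<phi> + of_real l * t) (\<tau> + of_real l * t)) \<le> A * \<bar>Im (\<tau> + of_real l * t)\<bar> ^ P * (norm (y l))\<^sup>2"
        unfolding y_def by (rule quad[OF T[OF that] \<Omega>l[OF that] depth(3)[OF that]])
      also have "\<dots> \<le> A * (2 * s) ^ P * (norm (y l))\<^sup>2"
        using A depth(2)[OF that] by (intro mult_right_mono mult_left_mono power_mono) auto
      finally have "norm (t *s c' (\<phi> + of_real l * t) (\<tau> + of_real l * t)) \<le> (\<kappa> * s) * (A * (2 * s) ^ P * (norm (y l))\<^sup>2)"
        unfolding norm_vector_scalar_mult using t_le \<kappa> s by (intro mult_mono) auto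
      then show ?thesis by (simp add: B_def M_def power_mult_distrib mult_ac)
    qed
    have small: "B * norm (y l) \<le> 1 / 2" if "l \<in> {0..1}" for l
    proof -
      have "norm (y l) \<le> A / \<bar>Im (\<tau> + of_real l * t)\<bar> ^ (P + 2)"
        unfolding y_def by (rule decay[OF T[OF that] \<Omega>l[OF that] depth(3)[OF that]])
      also have "\<dots> \<le> A / (s / 2) ^ (P + 2)"
        using A s depth(1)[OF that]
        by (intro divide_left_mono power_mono mult_pos_pos zero_less_power) auto
      finally have "B * norm (y l) \<le> B * (A / (s / 2) ^ (P + 2))" using B0 by (rule mult_left_mono)
      also have "\<dots> = M * A * 2 ^ (P + 2) / s"
        using s by (simp add: B_def power_divide power_add field_simps power2_eq_square)
      also have "\<dots> \<le> 1 / 2" using s(4,5) by (simp add: divide_le_eq)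
      finally show ?thesis .
    qed
    have y0: "y 0 = c \<phi> \<tau>" by (simp add: y_def)
    have y1: "y 1 = c 0 \<psi>"
    proof -
      have "y 1 = c (0 + of_real (2 * pi * of_int n)) \<psi>" by (simp add: y_def t) (simp add: \<psi>_def algebra_simps)
      also have "\<dots> = c 0 \<psi>"
        by (rule periodic_int_shift[of h "\<lambda>\<phi>. c \<phi> \<psi>"]) (use per[OF _ \<psi>\<Omega> \<psi>_deep(2)] T0 in auto)
      finally show ?thesis .
    qed
    have "norm (c 0 \<psi> - c \<phi> \<tau>) \<le> 4 * B * (norm (c 0 \<psi>))\<^sup>2"
      using quadratic_ode_increment(2)[OF der bd small B0] unfolding y0 y1 .
    also have "\<dots> \<le> 4 * B * (C * exp (Im \<psi>))\<^sup>2"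
      using C(3)[OF \<psi>_Re \<psi>_deep(1)] B0 by (intro mult_left_mono power_mono) auto
    also have "\<dots> = 4 * M * C\<^sup>2 * (s ^ (P + 1) * exp (2 * Im \<psi>))"
      by (simp add: B_def power_mult_distrib exp_double[symmetric] mult_ac)
    also have "\<dots> \<le> 4 * M * C\<^sup>2 * ((K * exp ((1 - b) * s)) * exp (2 * (h - s)))"
    proof (intro mult_left_mono mult_mono)
      show "s ^ (P + 1) \<le> K * exp ((1 - b) * s)"
        unfolding K_def using b s by (intro power_le_exp) auto
      show "exp (2 * Im \<psi>) \<le> exp (2 * (h - s))" using \<phi>h by (simp add: \<psi>_Im s_def)
      show "0 \<le> K * exp ((1 - b) * s)" using b by (simp add: K_def)
    qed (use M in auto)
    also have "\<dots> = 4 * M * C\<^sup>2 * exp (2 * h) * K * exp ((1 + b) * Im \<tau>)"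
    proof -
      have "exp ((1 - b) * s) * exp (2 * (h - s)) = exp (2 * h) * exp ((1 + b) * Im \<tau>)"
        unfolding exp_add[symmetric] by (simp add: s_def algebra_simps)
      then show ?thesis by (simp only: mult.assoc)
         (metis (no_types, opaque_lifting) mult.assoc mult.left_commute)
    qed
    finally have 1: "norm (c 0 \<psi> - c \<phi> \<tau>) \<le> 4 * M * C\<^sup>2 * exp (2 * h) * K * exp ((1 + b) * Im \<tau>)" .
    have ex: "exp (- \<i> * \<psi>) = exp (- \<i> * (\<tau> - \<phi>))"
    proof -
      have "- \<i> * \<psi> = - \<i> * (\<tau> - \<phi>) + \<i> * (of_int (- n) * (of_real pi * 2))"
        by (simp add: \<psi>_def algebra_simps)
      then show ?thesis by (simp only: exp_plus_2pin)
    qed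
    have "norm (c 0 \<psi> - exp (- \<i> * \<psi>) *s \<Theta>) \<le> C * exp ((1 + b) * Im \<psi>)"
      by (rule C(4)[OF \<psi>_Re \<psi>_deep(1)])
    also have "\<dots> \<le> C * exp ((1 + b) * h + (1 + b) * Im \<tau>)"
    proof -
      have "(1 + b) * Im \<psi> \<le> (1 + b) * (h + Im \<tau>)" using b \<phi>h by (intro mult_left_mono) (auto simp: \<psi>_Im)
      then show ?thesis using C(1) by (intro mult_left_mono) (auto simp: distrib_left)
    qed
    finally have 2: "norm (c 0 \<psi> - exp (- \<i> * (\<tau> - \<phi>)) *s \<Theta>) \<le> C * exp ((1 + b) * h) * exp ((1 + b) * Im \<tau>)"
      unfolding ex by (simp add: exp_add mult.assoc)
    have "norm (c \<phi> \<tau> - exp (- \<i> * (\<tau> - \<phi>)) *s \<Theta>)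
        \<le> norm (c \<phi> \<tau> - c 0 \<psi>) + norm (c 0 \<psi> - exp (- \<i> * (\<tau> - \<phi>)) *s \<Theta>)"
      unfolding dist_norm[symmetric] by (rule dist_triangle)
    then show "norm (c \<phi> \<tau> - exp (- \<i> * (\<tau> - \<phi>)) *s \<Theta>) \<le> C' * exp ((1 + b) * Im \<tau>)"
      using 1 2 unfolding C'_def distrib_right norm_minus_commute[of "c \<phi> \<tau>"] by linarith
  qed
qed

section \<open>The wedge\<close>

lemma D_wedge_iff:
  assumes "0 < \<theta>" "\<theta> < pi / 4"
  shows "\<tau> \<in> D_wedge \<theta> r \<longleftrightarrow> Im \<tau> < 0 \<and> cos \<theta> * Im \<tau> + sin \<theta> * (Re \<tau> + r) < 0 \<and>
    cos \<theta> * Im \<tau> - sin \<theta> * (Re \<tau> - r) < 0"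
proof (cases "Im \<tau> < 0")
  case True
  then show ?thesis
    using abs_Arg_gt_lower[of "\<tau> + of_real r" \<theta>] abs_Arg_uminus_lower[of "\<tau> - of_real r" \<theta>] assms
    by (auto simp: D_wedge_def D_plus_def D_minus_def add.commute)
qed (auto simp: D_wedge_def)

lemma D_wedge_convex_open:
  assumes "0 < \<theta>" "\<theta> < pi / 4"
  shows "convex (D_wedge \<theta> r)" "open (D_wedge \<theta> r)"
proof -
  have eq: "D_wedge \<theta> r = {\<tau>. Im \<tau> < 0}
      \<inter> {\<tau>. Complex (sin \<theta>) (cos \<theta>) \<bullet> \<tau> < - (r * sin \<theta>)}
      \<inter> {\<tau>. Complex (- sin \<theta>) (cos \<theta>) \<bullet> \<tau> < - (r * sin \<theta>)}"
    by (auto simp: D_wedge_iff[OF assms] inner_complex_def algebra_simps)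
  show "convex (D_wedge \<theta> r)"
    unfolding eq by (intro convex_Int convex_halfspace_lt convex_halfspace_Im_lt)
  show "open (D_wedge \<theta> r)"
    unfolding eq by (intro open_Int open_halfspace_lt open_halfspace_Im_lt)
qed

lemma D_wedge_cone:
  assumes "0 < \<theta>" "\<theta> < pi / 4" "r > 0" "\<tau> \<in> D_wedge \<theta> r"
  shows "\<bar>Re \<tau>\<bar> \<le> (cos \<theta> / sin \<theta>) * (- Im \<tau>)"
proof -
  have sin: "sin \<theta> > 0" using assms by (auto intro!: sin_gt_zero)
  then have "0 < sin \<theta> * r" using assms(3) by simp
  then have "sin \<theta> * Re \<tau> \<le> cos \<theta> * (- Im \<tau>)" "- (sin \<theta> * Re \<tau>) \<le> cos \<theta> * (- Im \<tau>)"
    using assms(4) unfolding D_wedge_iff[OF assms(1,2)] by (auto simp: algebra_simps)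
  then have "sin \<theta> * \<bar>Re \<tau>\<bar> \<le> cos \<theta> * (- Im \<tau>)" by (auto simp: abs_if)
  then have "\<bar>Re \<tau>\<bar> \<le> (cos \<theta> * (- Im \<tau>)) / sin \<theta>"
    using sin by (intro mult_imp_le_div_pos) (simp_all only: mult.commute)
  then show ?thesis by simp
qed

lemma D_wedge_contains_half_strip:
  assumes "0 < \<theta>" "\<theta> < pi / 4" "R > 0" "cos \<theta> * R > sin \<theta> * (2 * pi + r)"
    and "\<bar>Re \<psi>\<bar> \<le> 2 * pi" "Im \<psi> \<le> - R"
  shows "\<psi> \<in> D_wedge \<theta> r"
proof -
  have pos: "sin \<theta> > 0" "cos \<theta> > 0" using assms by (auto intro!: sin_gt_zero cos_gt_zero)
  have "cos \<theta> * Im \<psi> \<le> cos \<theta> * (- R)" using pos assms by (intro mult_left_mono) auto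
  moreover have "sin \<theta> * (Re \<psi> + r) \<le> sin \<theta> * (2 * pi + r)" "sin \<theta> * (- Re \<psi> + r) \<le> sin \<theta> * (2 * pi + r)"
    using pos assms(5) by (intro mult_left_mono; linarith)+
  ultimately show ?thesis
    unfolding D_wedge_iff[OF assms(1,2)] using assms(3,4,6) by (auto simp: algebra_simps)
qed

section \<open>Functions on the strip and their asymptotic expansions\<close>

lemma open_T_strip: "open (T_strip h)"
proof -
  have "T_strip h = {\<phi>. Im \<phi> < h} \<inter> {\<phi>. Im \<phi> > - h}" by (auto simp: T_strip_def)
  then show ?thesis by (simp add: open_Int open_halfspace_Im_lt open_halfspace_Im_gt)
qed

text \<open>
  A joint power series gives differentiability along every complex line of \<open>\<complex>\<^sup>2\<close>, in particular along the
  characteristics.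
\<close>

lemma strip_line_deriv:
  assumes "analytic_strip h D f" "\<phi> + z * a \<in> T_strip h" "\<tau> + z * b \<in> D"
  shows "((\<lambda>z. f (\<phi> + z * a) (\<tau> + z * b)) has_field_derivative
    a * d_phi f (\<phi> + z * a) (\<tau> + z * b) + b * d_tau f (\<phi> + z * a) (\<tau> + z * b)) (at z)"
proof -
  define F where "F = (\<lambda>z :: complex ^ 2. f (z $ 1) (z $ 2))"
  define x where "x = (vector [\<phi>, \<tau>] :: complex ^ 2)"
  define v where "v = (vector [a, b] :: complex ^ 2)"
  have an: "analytic_Cn F {z. z $ 1 \<in> T_strip h \<and> z $ 2 \<in> D}"
    using assms(1) by (simp add: analytic_strip_def F_def)
  have "partials_along_lines F (x + z *s v)"
    unfolding partials_along_lines_def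
    by (intro allI analytic_Cn_line_deriv[OF an]) (use assms in \<open>simp add: x_def v_def\<close>)
  then have *: "((\<lambda>t. F (x + t *s v)) has_field_derivative (\<Sum>k\<in>UNIV. v $ k * partial k F (x + z *s v))) (at z)"
    by (rule partials_along_lines_at)
  have p1: "partial 1 F w = d_phi f (w $ 1) (w $ 2)" for w
    unfolding partial_def d_phi_def F_def by (subst deriv_shift_0') (simp_all add: o_def axis_def)
  have p2: "partial 2 F w = d_tau f (w $ 1) (w $ 2)" for w
    unfolding partial_def d_tau_def F_def by (subst deriv_shift_0') (simp_all add: o_def axis_def)
  show ?thesis
    using * unfolding sum_2 p1 p2 by (simp add: x_def v_def F_def)
qed

lemma strip_characteristic_deriv:
  assumes "analytic_strip h D f" "\<phi> + z * t \<in> T_strip h" "\<tau> + z * t \<in> D"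
  shows "((\<lambda>z. f (\<phi> + z * t) (\<tau> + z * t)) has_field_derivative t * D_op f (\<phi> + z * t) (\<tau> + z * t)) (at z)"
  using strip_line_deriv[OF assms] by (simp add: D_op_def distrib_left)

text \<open>
  The partial sum that stops just before \<open>\<tau>\<close> to the power \<open>- m\<close> is zero.
\<close>

lemma asymp_exp_leading:
  assumes "asymp_exp h D f fhat" "\<And>n. n < m \<Longrightarrow> fls_nth fhat n = 0"
  shows "bigO_strip h D f (\<lambda>\<phi> \<tau>. \<tau> powi (- m))"
proof -
  have "bigO_strip h D (\<lambda>\<phi> \<tau>. f \<phi> \<tau> - (\<Sum>n = fls_subdegree fhat..m - 1. trig_eval (fls_nth fhat n) \<phi> * \<tau> powi (- n)))
        (\<lambda>\<phi> \<tau>. \<tau> powi (- ((m - 1) + 1)))"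
    using assms(1) unfolding asymp_exp_def by blast
  moreover have "(\<Sum>n = fls_subdegree fhat..m - 1. trig_eval (fls_nth fhat n) \<phi> * \<tau> powi (- n)) = 0" for \<phi> \<tau>
    by (rule sum.neutral) (simp add: assms(2) trig_eval_def)
  ultimately show ?thesis by simp
qed

text \<open>
  Both functions have the same partial sums, which cancel in the difference.
\<close>

lemma asymp_exp_diff_flat:
  assumes "asymp_exp h D f fhat" "asymp_exp h D' g fhat" "E \<subseteq> D \<inter> D'"
  shows "bigO_strip h E (\<lambda>\<phi> \<tau>. f \<phi> \<tau> - g \<phi> \<tau>) (\<lambda>\<phi> \<tau>. \<tau> powi (- (N + 1)))"
proof -
  define S where "S = (\<lambda>\<phi> \<tau>. \<Sum>n = fls_subdegree fhat..N. trig_eval (fls_nth fhat n) \<phi> * \<tau> powi (- n))"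
  obtain C R where C: "\<And>\<phi> \<tau>. \<phi> \<in> T_strip h \<Longrightarrow> \<tau> \<in> D \<Longrightarrow> norm \<tau> \<ge> R \<Longrightarrow> norm (f \<phi> \<tau> - S \<phi> \<tau>) \<le> C * norm (\<tau> powi (- (N + 1)))"
    using assms(1) unfolding asymp_exp_def bigO_strip_def S_def by blast
  obtain C' R' where C': "\<And>\<phi> \<tau>. \<phi> \<in> T_strip h \<Longrightarrow> \<tau> \<in> D' \<Longrightarrow> norm \<tau> \<ge> R' \<Longrightarrow> norm (g \<phi> \<tau> - S \<phi> \<tau>) \<le> C' * norm (\<tau> powi (- (N + 1)))"
    using assms(2) unfolding asymp_exp_def bigO_strip_def S_def by blast
  show ?thesis
    unfolding bigO_strip_def
  proof (rule exI[of _ "C + C'"], rule exI[of _ "max R R'"], intro ballI impI)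
    fix \<phi> \<tau> assume *: "\<phi> \<in> T_strip h" "\<tau> \<in> E" "max R R' \<le> norm \<tau>"
    have "norm (f \<phi> \<tau> - g \<phi> \<tau>) \<le> norm (f \<phi> \<tau> - S \<phi> \<tau>) + norm (g \<phi> \<tau> - S \<phi> \<tau>)"
      using norm_triangle_ineq4[of "f \<phi> \<tau> - S \<phi> \<tau>" "g \<phi> \<tau> - S \<phi> \<tau>"] by simp
    also have "\<dots> \<le> C * norm (\<tau> powi (- (N + 1))) + C' * norm (\<tau> powi (- (N + 1)))"
      using * assms(3) by (intro add_mono C C') auto
    finally show "norm (f \<phi> \<tau> - g \<phi> \<tau>) \<le> (C + C') * norm (\<tau> powi (- (N + 1)))"
      by (simp add: distrib_right)
  qed
qed

lemma bigO_strip_uniform: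
  fixes f :: "'i::finite \<Rightarrow> complex \<Rightarrow> complex \<Rightarrow> 'a::real_normed_vector"
  assumes "\<And>i. bigO_strip h D (f i) g"
  obtains C R where "C \<ge> 0" "R \<ge> 1"
    "\<forall>i. \<forall>\<phi>\<in>T_strip h. \<forall>\<tau>\<in>D. norm \<tau> \<ge> R \<longrightarrow> norm (f i \<phi> \<tau>) \<le> C * norm (g \<phi> \<tau>)"
proof -
  have "\<forall>i. \<exists>C R. \<forall>\<phi>\<in>T_strip h. \<forall>\<tau>\<in>D. norm \<tau> \<ge> R \<longrightarrow> norm (f i \<phi> \<tau>) \<le> C * norm (g \<phi> \<tau>)"
    using assms by (simp add: bigO_strip_def)
  then have "\<exists>C R. \<forall>i. \<forall>\<phi>\<in>T_strip h. \<forall>\<tau>\<in>D. norm \<tau> \<ge> R i \<longrightarrow> norm (f i \<phi> \<tau>) \<le> C i * norm (g \<phi> \<tau>)"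
    by (simp only: choice_iff)
  then obtain C R where C: "\<And>i \<phi> \<tau>. \<phi> \<in> T_strip h \<Longrightarrow> \<tau> \<in> D \<Longrightarrow> norm \<tau> \<ge> R i \<Longrightarrow> norm (f i \<phi> \<tau>) \<le> C i * norm (g \<phi> \<tau>)"
    by blast
  define C' where "C' = (\<Sum>i\<in>UNIV. \<bar>C i\<bar>)"
  define R' where "R' = 1 + (\<Sum>i\<in>UNIV. \<bar>R i\<bar>)"
  have C': "C i \<le> C'" for i
    using member_le_sum[of i UNIV "\<lambda>i. \<bar>C i\<bar>"] by (simp add: C'_def)
  have R': "R i \<le> R'" for i
    using member_le_sum[of i UNIV "\<lambda>i. \<bar>R i\<bar>"] by (simp add: R'_def)
  show ?thesis
  proof (rule that[of C' R']; (intro allI ballI impI)?)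
    show "C' \<ge> 0" "R' \<ge> 1" by (auto simp: C'_def R'_def sum_nonneg)
    fix i \<phi> \<tau> assume *: "\<phi> \<in> T_strip h" "\<tau> \<in> D" "R' \<le> norm \<tau>"
    have "norm (f i \<phi> \<tau>) \<le> C i * norm (g \<phi> \<tau>)" by (rule C[OF *(1,2)]) (use R'[of i] *(3) in simp)
    also have "\<dots> \<le> C' * norm (g \<phi> \<tau>)" by (intro mult_right_mono C') auto
    finally show "norm (f i \<phi> \<tau>) \<le> C' * norm (g \<phi> \<tau>)" .
  qed
qed

text \<open>
  A Laurent series has a leading power, and finitely many functions have a common bound for it.
\<close>

lemma asymp_exp_polynomial_growth:
  fixes f :: "'i::finite \<Rightarrow> complex \<Rightarrow> complex \<Rightarrow> complex"
  assumes "\<And>i. asymp_exp h D (f i) (fhat i)"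
  obtains C R and K :: nat where "C \<ge> 0" "R \<ge> 1"
    "\<forall>i. \<forall>\<phi>\<in>T_strip h. \<forall>\<tau>\<in>D. norm \<tau> \<ge> R \<longrightarrow> norm (f i \<phi> \<tau>) \<le> C * norm \<tau> ^ K"
proof -
  define K where "K = Max (range (\<lambda>i. nat (- fls_subdegree (fhat i))))"
  have K: "- fls_subdegree (fhat i) \<le> int K" for i
  proof -
    have "nat (- fls_subdegree (fhat i)) \<le> K" unfolding K_def by (rule Max_ge) auto
    then show ?thesis by linarith
  qed
  have "bigO_strip h D (f i) (\<lambda>\<phi> \<tau>. \<tau> ^ K)" for i
  proof -
    obtain C R where C: "\<And>\<phi> \<tau>. \<phi> \<in> T_strip h \<Longrightarrow> \<tau> \<in> D \<Longrightarrow> norm \<tau> \<ge> R \<Longrightarrow>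
        norm (f i \<phi> \<tau>) \<le> C * norm (\<tau> powi (- fls_subdegree (fhat i)))"
      using asymp_exp_leading[OF assms[of i], of "fls_subdegree (fhat i)"]
      unfolding bigO_strip_def by auto
    show ?thesis
      unfolding bigO_strip_def
    proof (rule exI[of _ "\<bar>C\<bar>"], rule exI[of _ "max R 1"], intro ballI impI)
      fix \<phi> \<tau> assume *: "\<phi> \<in> T_strip h" "\<tau> \<in> D" "max R 1 \<le> norm \<tau>"
      have "norm (f i \<phi> \<tau>) \<le> C * norm (\<tau> powi (- fls_subdegree (fhat i)))" using * by (intro C) auto
      also have "\<dots> \<le> \<bar>C\<bar> * norm (\<tau> powi (- fls_subdegree (fhat i)))" by (intro mult_right_mono) auto
      also have "\<dots> \<le> \<bar>C\<bar> * norm (\<tau> ^ K)"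
        using power_int_increasing[OF K, of "norm \<tau>"] * by (intro mult_left_mono) (auto simp: norm_power_int norm_power)
      finally show "norm (f i \<phi> \<tau>) \<le> \<bar>C\<bar> * norm (\<tau> ^ K)" .
    qed
  qed
  then obtain C R where "C \<ge> 0" "R \<ge> 1"
    "\<forall>i. \<forall>\<phi>\<in>T_strip h. \<forall>\<tau>\<in>D. norm \<tau> \<ge> R \<longrightarrow> norm (f i \<phi> \<tau>) \<le> C * norm (\<tau> ^ K)"
    by (rule bigO_strip_uniform)
  then show ?thesis by (intro that) (auto simp: norm_power)
qed

section \<open>Symplectic frames\<close>

lemma norm_matrix_vector_le:
  fixes M :: "complex ^ 'n ^ 'm"
  assumes "\<And>i j. norm (M $ i $ j) \<le> B"
  shows "norm (M *v x) \<le> real CARD('m) * real CARD('n) * B * norm x"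
proof -
  have B: "B \<ge> 0" by (rule order_trans[OF norm_ge_zero assms])
  have "norm (M *v x) \<le> (\<Sum>i\<in>UNIV. norm ((M *v x) $ i))" by (rule norm_le_sum_norm_vec)
  also have "\<dots> \<le> (\<Sum>i\<in>(UNIV::'m set). \<Sum>j\<in>(UNIV::'n set). B * norm x)"
  proof (rule sum_mono)
    fix i
    show "norm ((M *v x) $ i) \<le> (\<Sum>j\<in>(UNIV::'n set). B * norm x)"
      unfolding matrix_vector_mult_def vec_lambda_beta
    proof (rule sum_norm_le)
      fix j
      show "norm (M $ i $ j * x $ j) \<le> B * norm x"
        unfolding norm_mult by (intro mult_mono assms B Finite_Cartesian_Product.norm_nth_le norm_ge_zero)
    qed
  qed
  finally show ?thesis by (simp add: mult_ac)
qed

text \<open>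
  The inverse of a symplectic matrix \<open>M\<close>. Its entries are linear in those of \<open>M\<close>, and so inherit growth
  bounds and differentiability.
\<close>

definition symplectic_inverse :: "complex ^ 4 ^ 4 \<Rightarrow> complex ^ 4 ^ 4" where
  "symplectic_inverse M = (- J) ** (transpose M ** J)"

lemma J_squared: "(- J) ** J = (mat 1 :: complex ^ 4 ^ 4)"
  by (simp add: vec_eq_iff forall_4 matrix_matrix_mult_def sum_4 J_def vector_4_nth mat_def)

lemma symplectic_inverse:
  assumes "transpose M ** J ** M = J"
  shows "symplectic_inverse M ** M = mat 1" "M ** symplectic_inverse M = mat 1"
proof -
  show 1: "symplectic_inverse M ** M = mat 1"
    unfolding symplectic_inverse_def using assms by (simp add: matrix_mul_assoc[symmetric] J_squared)
  then show "M ** symplectic_inverse M = mat 1" by (rule matrix_left_right_inverse1)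
qed

lemma symplectic_inverse_nth:
  "symplectic_inverse M $ i $ j = (\<Sum>k\<in>UNIV. \<Sum>l\<in>UNIV. (- J) $ i $ k * (M $ l $ k * J $ l $ j))"
  by (simp add: symplectic_inverse_def matrix_matrix_mult_def transpose_def sum_distrib_left)

lemma norm_J_le_1: "norm ((J :: complex ^ 4 ^ 4) $ i $ j) \<le> 1"
  using exhaust_4[of i] exhaust_4[of j] by (auto simp: J_def vector_4_nth)

lemma norm_symplectic_inverse_le:
  assumes "\<And>i j. norm (M $ i $ j) \<le> B"
  shows "norm (symplectic_inverse M $ i $ j) \<le> 16 * B"
proof -
  have B: "B \<ge> 0" by (rule order_trans[OF norm_ge_zero assms])
  have "norm (symplectic_inverse M $ i $ j) \<le> (\<Sum>k\<in>(UNIV::4 set). \<Sum>l\<in>(UNIV::4 set). 1 * (B * 1))"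
    unfolding symplectic_inverse_nth
  proof (intro sum_norm_le)
    fix k l
    have "norm ((- J) $ i $ k :: complex) * (norm (M $ l $ k) * norm (J $ l $ j :: complex)) \<le> 1 * (B * 1)"
      using norm_J_le_1[of i k] by (intro mult_mono assms norm_J_le_1) (simp_all add: B)
    then show "norm ((- J) $ i $ k * (M $ l $ k * J $ l $ j)) \<le> 1 * (B * 1)"
      by (simp only: norm_mult)
  qed
  then show ?thesis by simp
qed

text \<open>
  Differentiating \<open>u c = d\<close>, where \<open>c = W d\<close>, gives \<open>t A u c + u c' = t (A d + q)\<close>; the linear terms cancel. It
  suffices to know that \<open>W\<close> is differentiable, and its derivative need not be computed.
\<close>

lemma variation_of_constants:
  fixes u W :: "complex \<Rightarrow> complex ^ 'n ^ 'n" and d :: "complex \<Rightarrow> complex ^ 'n"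
  assumes d: "\<And>i. ((\<lambda>z. d z $ i) has_field_derivative t * (A *v d z0 + q) $ i) (at z0)"
    and u: "\<And>i j. ((\<lambda>z. u z $ i $ j) has_field_derivative t * (A ** u z0) $ i $ j) (at z0)"
    and W: "\<And>i j. (\<lambda>z. W z $ i $ j) field_differentiable (at z0)"
    and inv: "\<forall>\<^sub>F z in nhds z0. u z ** W z = mat 1"
  shows "((\<lambda>z. (W z *v d z) $ i) has_field_derivative t * (W z0 *v q) $ i) (at z0)"
proof -
  define c where "c = (\<lambda>z. W z *v d z)"
  have "(\<lambda>z. c z $ j) field_differentiable (at z0)" for j
    unfolding c_def matrix_vector_mult_def vec_lambda_beta
    by (intro field_differentiable_sum field_differentiable_mult W)
       (use d in \<open>auto simp: field_differentiable_def\<close>)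
  then obtain c1 where c1: "\<And>j. ((\<lambda>z. c z $ j) has_field_derivative c1 $ j) (at z0)"
  proof -
    assume *: "\<And>j. (\<lambda>z. c z $ j) field_differentiable (at z0)"
      and **: "\<And>c1. (\<And>j. ((\<lambda>z. c z $ j) has_field_derivative c1 $ j) (at z0)) \<Longrightarrow> thesis"
    show thesis
      by (rule **[of "\<chi> j. deriv (\<lambda>z. c z $ j) z0"])
         (use * in \<open>simp add: field_differentiable_derivI\<close>)
  qed
  have inv0: "u z0 ** W z0 = mat 1" using eventually_nhds_x_imp_x[OF inv] .
  have uc: "u z0 *v c z0 = d z0" using inv0 by (simp add: c_def matrix_vector_mul_assoc)
  have "u z0 *v c1 = t *s q"
  proof (rule vec_eq_iff[THEN iffD2], rule allI)
    fix k
    have ev: "\<forall>\<^sub>F z in nhds z0. (\<Sum>j\<in>UNIV. u z $ k $ j * c z $ j) = d z $ k"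
      using inv
    proof eventually_elim
      case (elim z)
      have "u z *v c z = d z" using elim by (simp add: c_def matrix_vector_mul_assoc)
      then show ?case by (simp add: matrix_vector_mult_def vec_eq_iff)
    qed
    have "((\<lambda>z. \<Sum>j\<in>UNIV. u z $ k $ j * c z $ j) has_field_derivative
        (\<Sum>j\<in>UNIV. t * (A ** u z0) $ k $ j * c z0 $ j + c1 $ j * u z0 $ k $ j)) (at z0)"
      by (intro DERIV_sum DERIV_mult u c1)
    then have "((\<lambda>z. d z $ k) has_field_derivative
        (\<Sum>j\<in>UNIV. t * (A ** u z0) $ k $ j * c z0 $ j + c1 $ j * u z0 $ k $ j)) (at z0)"
      using DERIV_cong_ev[OF refl ev refl] by simp
    then have "(\<Sum>j\<in>UNIV. t * (A ** u z0) $ k $ j * c z0 $ j + c1 $ j * u z0 $ k $ j) = t * (A *v d z0 + q) $ k"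
      using d[of k] by (rule DERIV_unique)
    moreover have "(\<Sum>j\<in>UNIV. t * (A ** u z0) $ k $ j * c z0 $ j + c1 $ j * u z0 $ k $ j)
        = t * ((A ** u z0) *v c z0) $ k + (u z0 *v c1) $ k"
      by (simp add: matrix_vector_mult_def sum.distrib sum_distrib_left mult_ac)
    moreover have "(A ** u z0) *v c z0 = A *v d z0"
      by (simp add: matrix_vector_mul_assoc[symmetric] uc)
    ultimately show "(u z0 *v c1) $ k = (t *s q) $ k"
      by (simp add: distrib_left)
  qed
  then have "W z0 *v (u z0 *v c1) = W z0 *v (t *s q)" by simp
  moreover have "W z0 ** u z0 = mat 1" using inv0 by (rule matrix_left_right_inverse1)
  ultimately have "c1 = t *s (W z0 *v q)"
    by (simp add: matrix_vector_mul_assoc vector_scalar_commute)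
  then show ?thesis using c1[of i] by (simp add: c_def)
qed

lemma has_vector_derivative_vecI:
  fixes f :: "real \<Rightarrow> complex ^ 'n"
  assumes "\<And>i. ((\<lambda>x. f x $ i) has_vector_derivative D $ i) F"
  shows "(f has_vector_derivative D) F"
proof -
  have lin: "bounded_linear (\<lambda>x::complex. x *s (axis i 1 :: complex ^ 'n))" for i
    by (intro linear_conv_bounded_linear[THEN iffD1] linearI) (auto simp: vec_eq_iff algebra_simps)
  have "((\<lambda>x. \<Sum>i\<in>UNIV. f x $ i *s axis i 1) has_vector_derivative (\<Sum>i\<in>UNIV. D $ i *s axis i 1)) F"
    by (intro has_vector_derivative_sum bounded_linear.has_vector_derivative[OF lin] assms)
  then show ?thesis by (simp only: basis_expansion)
qed

lemma symplectic_inverse_differentiable: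
  assumes "\<And>i j. (\<lambda>z. M z $ i $ j) field_differentiable (at z0)"
  shows "(\<lambda>z. symplectic_inverse (M z) $ i $ j) field_differentiable (at z0)"
  unfolding symplectic_inverse_nth
  by (intro field_differentiable_sum field_differentiable_mult field_differentiable_const assms)

lemma matrix_vector_differentiable:
  assumes "\<And>i j. (\<lambda>z. M z $ i $ j) field_differentiable (at z0)" "\<And>j. (\<lambda>z. d z $ j) field_differentiable (at z0)"
  shows "(\<lambda>z. (M z *v d z) $ i) field_differentiable (at z0)"
  unfolding matrix_vector_mult_def vec_lambda_beta
  by (intro field_differentiable_sum field_differentiable_mult assms)

lemma norm_powi_minus: "norm ((z::complex) powi (- int n)) = 1 / norm z ^ n"
  by (simp add: power_int_minus norm_inverse norm_power divide_inverse)

section \<open>The splitting of the separatrices\<close>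

theorem theorem3p5:
  fixes \<eta> :: complex and F :: "complex ^ 4 \<Rightarrow> complex" and V :: "(complex ^ 4) set"
    and h \<theta> r \<epsilon> :: real
    and \<Gamma>hat :: "trig fls ^ 4" and Uhat :: "trig fls ^ 4 ^ 4"
    and \<Gamma>p \<Gamma>m :: "complex \<Rightarrow> complex \<Rightarrow> complex ^ 4"
    and U :: "complex \<Rightarrow> complex \<Rightarrow> complex ^ 4 ^ 4"
  assumes "\<eta> \<noteq> 0"
    and "open V" and "0 \<in> V" and "analytic_Cn F V" and "bounded (F ` V)"
    and "\<And>\<alpha>. taylor_coeff F \<alpha> \<noteq> 0 \<Longrightarrow> weighted_order \<alpha> \<ge> 5"
    and "h > 0" and "0 < \<theta>" and "\<theta> < pi / 4" and "r > 0"
    and "formal_separatrix (Ham \<eta> F) \<Gamma>hat"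
    and "parameterization (Ham \<eta> F) V h (D_minus \<theta> r) \<Gamma>hat \<Gamma>m"
    and "parameterization (Ham \<eta> F) V h (D_plus \<theta> r) \<Gamma>hat \<Gamma>p"
    and "formal_fundamental_solution (Ham \<eta> F) \<Gamma>hat Uhat"
    and "normalized_fundamental_solution (Ham \<eta> F) h (D_minus \<theta> r) \<Gamma>m Uhat U"
    and "\<epsilon> > 0"
  shows "\<exists>\<Theta> :: complex ^ 4.
    bigO_strip h (D_wedge \<theta> r)
      (\<lambda>\<phi> \<tau>. \<Gamma>p \<phi> \<tau> - \<Gamma>m \<phi> \<tau> - exp (- \<i> * (\<tau> - \<phi>)) *s (U \<phi> \<tau> *v \<Theta>))
      (\<lambda>\<phi> \<tau>. exp (- (2 - of_real \<epsilon>) * \<i> * (\<tau> - \<phi>)))"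
proof -
  define H where "H = Ham \<eta> F"
  define \<Omega> where "\<Omega> = D_wedge \<theta> r"
  have \<Omega>_sub: "\<Omega> \<subseteq> D_minus \<theta> r" "\<Omega> \<subseteq> D_plus \<theta> r" by (auto simp: \<Omega>_def D_wedge_def)
  have \<Omega>_open: "convex \<Omega>" "open \<Omega>" using D_wedge_convex_open[of \<theta> r] assms by (auto simp: \<Omega>_def)
  define k where "k = cos \<theta> / sin \<theta>"
  have trig: "sin \<theta> > 0" "cos \<theta> > 0" using assms by (auto intro!: sin_gt_zero cos_gt_zero)
  have k: "k > 0" using trig by (simp add: k_def)
  have cone: "\<bar>Re \<tau>\<bar> \<le> k * (- Im \<tau>)" if "\<tau> \<in> \<Omega>" for \<tau>
    using D_wedge_cone[of \<theta> r \<tau>] assms that by (simp add: k_def \<Omega>_def)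
  note pm = assms(12)[unfolded parameterization_def, folded H_def]
  note pp = assms(13)[unfolded parameterization_def, folded H_def]
  note pU = assms(15)[unfolded normalized_fundamental_solution_def, folded H_def]
  have an: "\<And>i. analytic_strip h (D_plus \<theta> r) (\<lambda>\<phi> \<tau>. \<Gamma>p \<phi> \<tau> $ i)"
    "\<And>i. analytic_strip h (D_minus \<theta> r) (\<lambda>\<phi> \<tau>. \<Gamma>m \<phi> \<tau> $ i)"
    "\<And>i j. analytic_strip h (D_minus \<theta> r) (\<lambda>\<phi> \<tau>. U \<phi> \<tau> $ i $ j)"
    using pp pm pU by blast+
  have ode_p: "D_op (\<lambda>\<phi> \<tau>. \<Gamma>p \<phi> \<tau> $ i) \<phi> \<tau> = X_H H (\<Gamma>p \<phi> \<tau>) $ i"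
    if "\<phi> \<in> T_strip h" "\<tau> \<in> D_plus \<theta> r" for \<phi> \<tau> i
    using pp that by blast
  have ode_m: "D_op (\<lambda>\<phi> \<tau>. \<Gamma>m \<phi> \<tau> $ i) \<phi> \<tau> = X_H H (\<Gamma>m \<phi> \<tau>) $ i"
    if "\<phi> \<in> T_strip h" "\<tau> \<in> D_minus \<theta> r" for \<phi> \<tau> i
    using pm that by blast
  have ode_U: "D_op (\<lambda>\<phi> \<tau>. U \<phi> \<tau> $ i $ j) \<phi> \<tau> = (DX_H H (\<Gamma>m \<phi> \<tau>) ** U \<phi> \<tau>) $ i $ j"
    if "\<phi> \<in> T_strip h" "\<tau> \<in> D_minus \<theta> r" for \<phi> \<tau> i j
  proof -
    have "(\<chi> i j. D_op (\<lambda>\<phi> \<tau>. U \<phi> \<tau> $ i $ j) \<phi> \<tau>) = DX_H H (\<Gamma>m \<phi> \<tau>) ** U \<phi> \<tau>"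
      using pU that by blast
    from arg_cong[OF this, of "\<lambda>M. M $ i $ j"] show ?thesis by (simp only: vec_lambda_beta)
  qed
  define \<Delta> where "\<Delta> = (\<lambda>\<phi> \<tau>. \<Gamma>p \<phi> \<tau> - \<Gamma>m \<phi> \<tau>)"
  define W where "W = (\<lambda>\<phi> \<tau>. symplectic_inverse (U \<phi> \<tau>))"
  define c where "c = (\<lambda>\<phi> \<tau>. W \<phi> \<tau> *v \<Delta> \<phi> \<tau>)"
  define Q where "Q = (\<lambda>\<phi> \<tau>. X_H H (\<Gamma>p \<phi> \<tau>) - X_H H (\<Gamma>m \<phi> \<tau>) - DX_H H (\<Gamma>m \<phi> \<tau>) *v \<Delta> \<phi> \<tau>)"
  define c' where "c' = (\<lambda>\<phi> \<tau>. W \<phi> \<tau> *v Q \<phi> \<tau>)"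
  have inv: "W \<phi> \<tau> ** U \<phi> \<tau> = mat 1" "U \<phi> \<tau> ** W \<phi> \<tau> = mat 1"
    if "\<phi> \<in> T_strip h" "\<tau> \<in> \<Omega>" for \<phi> \<tau>
    using that pU \<Omega>_sub symplectic_inverse[of "U \<phi> \<tau>"] by (auto simp: W_def)
  have Uc: "U \<phi> \<tau> *v c \<phi> \<tau> = \<Delta> \<phi> \<tau>" if "\<phi> \<in> T_strip h" "\<tau> \<in> \<Omega>" for \<phi> \<tau>
    using inv(2)[OF that] by (simp add: c_def matrix_vector_mul_assoc)

  \<comment> \<open>The data are at most polynomially large in \<open>\<tau>\<close>, while \<open>\<Delta>\<close> is smaller than every power.\<close>
  obtain CU RU K where CU: "CU \<ge> 0" "RU \<ge> 1" and CU_bound: "\<forall>p. \<forall>\<phi>\<in>T_strip h. \<forall>\<tau>\<in>D_minus \<theta> r.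
      norm \<tau> \<ge> RU \<longrightarrow> norm (U \<phi> \<tau> $ fst p $ snd p) \<le> CU * norm \<tau> ^ K"
    by (rule asymp_exp_polynomial_growth[where fhat = "\<lambda>p. Uhat $ fst p $ snd p"]) (use pU in blast)+
  \<comment> \<open>One factor \<open>W\<close> and, from \<open>Q\<close> being quadratic in \<open>\<Delta> = U c\<close>, two factors \<open>U\<close>.\<close>
  define P where "P = 3 * K"
  have lead: "fls_nth (\<Gamma>hat $ i) n = 0" if "n < 1" for i n
    using assms(11) that exhaust_4[of i] by (auto simp: formal_separatrix_def tau_T_iff)
  obtain Cm Rm where Cm: "Cm \<ge> 0" "Rm \<ge> 1" and Cm_bound: "\<forall>i. \<forall>\<phi>\<in>T_strip h. \<forall>\<tau>\<in>D_minus \<theta> r.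
      norm \<tau> \<ge> Rm \<longrightarrow> norm (\<Gamma>m \<phi> \<tau> $ i) \<le> Cm * norm (\<tau> powi (- 1))"
    by (rule bigO_strip_uniform[OF asymp_exp_leading[OF _ lead]]) (use pm in blast)+
  obtain Cp Rp where Cp: "Cp \<ge> 0" "Rp \<ge> 1" and Cp_bound: "\<forall>i. \<forall>\<phi>\<in>T_strip h. \<forall>\<tau>\<in>D_plus \<theta> r.
      norm \<tau> \<ge> Rp \<longrightarrow> norm (\<Gamma>p \<phi> \<tau> $ i) \<le> Cp * norm (\<tau> powi (- 1))"
    by (rule bigO_strip_uniform[OF asymp_exp_leading[OF _ lead]]) (use pp in blast)+
  \<comment> \<open>The exponent outweighs the factor \<open>W\<close> in \<open>c = W \<Delta>\<close> and leaves the power \<open>- (P + 2)\<close>.\<close>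
  have flat: "bigO_strip h \<Omega> (\<lambda>\<phi> \<tau>. \<Gamma>p \<phi> \<tau> $ i - \<Gamma>m \<phi> \<tau> $ i) (\<lambda>\<phi> \<tau>. \<tau> powi (- (int (K + P + 1) + 1)))" for i
    by (rule asymp_exp_diff_flat[where D = "D_plus \<theta> r" and D' = "D_minus \<theta> r" and fhat = "\<Gamma>hat $ i"])
       (use pp pm \<Omega>_sub in blast)+
  obtain Cd Rd where Cd: "Cd \<ge> 0" "Rd \<ge> 1" and Cd_bound: "\<forall>i. \<forall>\<phi>\<in>T_strip h. \<forall>\<tau>\<in>\<Omega>.
      norm \<tau> \<ge> Rd \<longrightarrow> norm (\<Gamma>p \<phi> \<tau> $ i - \<Gamma>m \<phi> \<tau> $ i) \<le> Cd * norm (\<tau> powi (- (int (K + P + 1) + 1)))"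
    by (rule bigO_strip_uniform[OF flat])
  obtain \<rho> CQ where \<rho>: "\<rho> > 0" and CQ: "CQ \<ge> 0" and CQ_bound: "\<And>x y. x \<in> ball 0 \<rho> \<Longrightarrow> y \<in> ball 0 \<rho> \<Longrightarrow>
    norm (X_H H y - X_H H x - DX_H H x *v (y - x)) \<le> CQ * (norm (y - x))\<^sup>2"
    unfolding H_def using X_H_quadratic_remainder[OF assms(2-4)] by blast
  \<comment> \<open>Beyond this depth all bounds hold, both parameterizations lie in the ball of radius \<open>\<rho>\<close>, and the wedge contains a half-strip two periods wide.\<close>
  define R where "R = RU + Rm + Rp + Rd + (4 * Cm + 4 * Cp) / \<rho> + sin \<theta> * (2 * pi + r) / cos \<theta> + 1"
  have q0: "0 \<le> (4 * Cm + 4 * Cp) / \<rho>" "0 \<le> sin \<theta> * (2 * pi + r) / cos \<theta>"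
    using Cm Cp \<rho> trig assms pi_gt_zero by auto
  have R: "R \<ge> 1" "R \<ge> RU" "R \<ge> Rm" "R \<ge> Rp" "R \<ge> Rd" "R > (4 * Cm + 4 * Cp) / \<rho>" "R > sin \<theta> * (2 * pi + r) / cos \<theta>"
    using q0 CU Cm Cp Cd unfolding R_def by linarith+
  have half_strip: "\<psi> \<in> \<Omega>" if "\<bar>Re \<psi>\<bar> \<le> 2 * pi" "Im \<psi> \<le> - R" for \<psi>
    unfolding \<Omega>_def
  proof (rule D_wedge_contains_half_strip[OF assms(8,9)])
    show "sin \<theta> * (2 * pi + r) < cos \<theta> * R" using R(7) trig by (simp add: divide_less_eq mult.commute)
  qed (use that R in auto)
  have size: "R \<le> norm \<tau>" "\<bar>Im \<tau>\<bar> \<le> norm \<tau>" "norm \<tau> \<le> (1 + k) * \<bar>Im \<tau>\<bar>" if "\<tau> \<in> \<Omega>" "Im \<tau> \<le> - R" for \<tau>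
  proof -
    show *: "\<bar>Im \<tau>\<bar> \<le> norm \<tau>" by (rule abs_Im_le_cmod)
    show "R \<le> norm \<tau>" using * that R by linarith
    have "norm \<tau> \<le> \<bar>Re \<tau>\<bar> + \<bar>Im \<tau>\<bar>" by (rule cmod_le)
    then show "norm \<tau> \<le> (1 + k) * \<bar>Im \<tau>\<bar>" using cone[OF that(1)] that(2) R by (simp add: algebra_simps)
  qed
  have U_le: "norm (U \<phi> \<tau> $ i $ j) \<le> CU * norm \<tau> ^ K"
    if "\<phi> \<in> T_strip h" "\<tau> \<in> \<Omega>" "Im \<tau> \<le> - R" for \<phi> \<tau> i j
    using CU_bound[THEN spec, of "(i, j)"] that \<Omega>_sub size[OF that(2,3)] R by auto
  have U_vec: "norm (U \<phi> \<tau> *v x) \<le> 16 * CU * norm \<tau> ^ K * norm x"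
    if "\<phi> \<in> T_strip h" "\<tau> \<in> \<Omega>" "Im \<tau> \<le> - R" for \<phi> \<tau> x
    using norm_matrix_vector_le[of "U \<phi> \<tau>", OF U_le[OF that]] by (simp add: mult.assoc)
  have W_vec: "norm (W \<phi> \<tau> *v x) \<le> 256 * CU * norm \<tau> ^ K * norm x"
    if "\<phi> \<in> T_strip h" "\<tau> \<in> \<Omega>" "Im \<tau> \<le> - R" for \<phi> \<tau> x
    using norm_matrix_vector_le[OF norm_symplectic_inverse_le[OF U_le[OF that]]]
    by (simp add: W_def mult.assoc)
  have small: "\<Gamma>m \<phi> \<tau> \<in> ball 0 \<rho>" "\<Gamma>p \<phi> \<tau> \<in> ball 0 \<rho>"
    if "\<phi> \<in> T_strip h" "\<tau> \<in> \<Omega>" "Im \<tau> \<le> - R" for \<phi> \<tau>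
  proof -
    have n: "norm \<tau> > 0" "norm \<tau> \<ge> Rm" "norm \<tau> \<ge> Rp" "(4 * Cm + 4 * Cp) / \<rho> < norm \<tau>"
      using size[OF that(2,3)] R by linarith+
    have "4 * Cm + 4 * Cp < \<rho> * norm \<tau>" using n \<rho> by (simp add: divide_less_eq mult.commute)
    then have lt: "4 * Cm / norm \<tau> < \<rho>" "4 * Cp / norm \<tau> < \<rho>"
      using n Cm Cp by (simp_all add: divide_less_eq)
    have powi: "norm (\<tau> powi (- 1)) = 1 / norm \<tau>" using norm_powi_minus[of \<tau> 1] by simp
    have "norm (\<Gamma>m \<phi> \<tau>) \<le> (\<Sum>i\<in>UNIV. norm (\<Gamma>m \<phi> \<tau> $ i))" by (rule norm_le_sum_norm_vec)
    also have "\<dots> \<le> (\<Sum>i\<in>(UNIV::4 set). Cm * (1 / norm \<tau>))"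
      unfolding powi[symmetric] using Cm_bound that n \<Omega>_sub by (intro sum_mono) blast
    finally show "\<Gamma>m \<phi> \<tau> \<in> ball 0 \<rho>" using lt by simp
    have "norm (\<Gamma>p \<phi> \<tau>) \<le> (\<Sum>i\<in>UNIV. norm (\<Gamma>p \<phi> \<tau> $ i))" by (rule norm_le_sum_norm_vec)
    also have "\<dots> \<le> (\<Sum>i\<in>(UNIV::4 set). Cp * (1 / norm \<tau>))"
      unfolding powi[symmetric] using Cp_bound that n \<Omega>_sub by (intro sum_mono) blast
    finally show "\<Gamma>p \<phi> \<tau> \<in> ball 0 \<rho>" using lt by simp
  qed
  define A where "A = 1024 * CU * Cd + 65536 * CU ^ 3 * CQ * (1 + k) ^ P"
  have A_parts: "0 \<le> 1024 * CU * Cd" "0 \<le> 65536 * CU ^ 3 * CQ * (1 + k) ^ P"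
    using CU Cd CQ k by auto
  have decay: "norm (c \<phi> \<tau>) \<le> A / \<bar>Im \<tau>\<bar> ^ (P + 2)"
    if "\<phi> \<in> T_strip h" "\<tau> \<in> \<Omega>" "Im \<tau> \<le> - R" for \<phi> \<tau>
  proof -
    note sz = size[OF that(2,3)]
    have n: "norm \<tau> > 0" "norm \<tau> \<ge> Rd" using sz R by linarith+
    have "norm (\<Delta> \<phi> \<tau>) \<le> (\<Sum>i\<in>UNIV. norm (\<Delta> \<phi> \<tau> $ i))" by (rule norm_le_sum_norm_vec)
    also have "\<dots> \<le> (\<Sum>i\<in>(UNIV::4 set). Cd * norm (\<tau> powi (- (int (K + P + 1) + 1))))"
      using Cd_bound that n by (intro sum_mono) (simp add: \<Delta>_def)
    also have "\<dots> = 4 * (Cd * norm (\<tau> powi (- int (K + (P + 2)))))" by (simp add: algebra_simps)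
    finally have "norm (\<Delta> \<phi> \<tau>) \<le> 4 * (Cd * (1 / norm \<tau> ^ (K + (P + 2))))"
      unfolding norm_powi_minus .
    then have "256 * CU * norm \<tau> ^ K * norm (\<Delta> \<phi> \<tau>)
        \<le> 256 * CU * norm \<tau> ^ K * (4 * (Cd * (1 / norm \<tau> ^ (K + (P + 2)))))"
      using CU by (intro mult_left_mono) auto
    also have "\<dots> = 1024 * CU * Cd / norm \<tau> ^ (P + 2)"
      using n by (simp add: power_add[of _ K])
    also have "\<dots> \<le> 1024 * CU * Cd / \<bar>Im \<tau>\<bar> ^ (P + 2)"
      using sz that R A_parts
      by (intro divide_left_mono power_mono mult_pos_pos zero_less_power) auto
    also have "\<dots> \<le> A / \<bar>Im \<tau>\<bar> ^ (P + 2)"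
      using A_parts by (intro divide_right_mono) (auto simp: A_def)
    finally show ?thesis
      using W_vec[OF that, of "\<Delta> \<phi> \<tau>"] by (simp add: c_def)
  qed
  have quad: "norm (c' \<phi> \<tau>) \<le> A * \<bar>Im \<tau>\<bar> ^ P * (norm (c \<phi> \<tau>))\<^sup>2"
    if "\<phi> \<in> T_strip h" "\<tau> \<in> \<Omega>" "Im \<tau> \<le> - R" for \<phi> \<tau>
  proof -
    note sz = size[OF that(2,3)]
    have "norm (Q \<phi> \<tau>) \<le> CQ * (norm (\<Delta> \<phi> \<tau>))\<^sup>2"
      unfolding Q_def \<Delta>_def by (rule CQ_bound[OF small[OF that]])
    also have "\<dots> \<le> CQ * (16 * CU * norm \<tau> ^ K * norm (c \<phi> \<tau>))\<^sup>2"
      using U_vec[OF that, of "c \<phi> \<tau>"] CQ unfolding Uc[OF that(1,2)] by (intro mult_left_mono power_mono) auto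
    finally have "256 * CU * norm \<tau> ^ K * norm (Q \<phi> \<tau>)
        \<le> 256 * CU * norm \<tau> ^ K * (CQ * (16 * CU * norm \<tau> ^ K * norm (c \<phi> \<tau>))\<^sup>2)"
      using CU by (intro mult_left_mono) auto
    also have "\<dots> = 65536 * CU ^ 3 * CQ * norm \<tau> ^ P * (norm (c \<phi> \<tau>))\<^sup>2"
    proof -
      have "norm \<tau> ^ P = (norm \<tau> ^ K) ^ 3" unfolding P_def power_mult[symmetric] by (simp only: mult.commute)
      moreover have "256 * a * y * (q * (16 * a * y * m)\<^sup>2) = 65536 * a ^ 3 * q * y ^ 3 * m\<^sup>2" for a y q m :: real
        by (simp add: power2_eq_square power3_eq_cube)
      ultimately show ?thesis by (simp only:)
    qed
    also have "\<dots> \<le> 65536 * CU ^ 3 * CQ * ((1 + k) * \<bar>Im \<tau>\<bar>) ^ P * (norm (c \<phi> \<tau>))\<^sup>2"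
      using sz CU CQ by (intro mult_right_mono mult_left_mono power_mono) auto
    also have "\<dots> = 65536 * CU ^ 3 * CQ * (1 + k) ^ P * \<bar>Im \<tau>\<bar> ^ P * (norm (c \<phi> \<tau>))\<^sup>2"
      by (simp add: power_mult_distrib)
    also have "\<dots> \<le> A * \<bar>Im \<tau>\<bar> ^ P * (norm (c \<phi> \<tau>))\<^sup>2"
      using A_parts by (intro mult_right_mono) (auto simp: A_def)
    finally show ?thesis using W_vec[OF that, of "Q \<phi> \<tau>"] by (simp add: c'_def)
  qed

  \<comment> \<open>In the frame \<open>U\<close> the linear part of the equation disappears, and only the remainder \<open>Q\<close> moves \<open>c\<close>.\<close>
  have char: "((\<lambda>z. c (\<phi> + z * t) (\<tau> + z * t) $ i) has_field_derivative
      t * c' (\<phi> + z0 * t) (\<tau> + z0 * t) $ i) (at z0)"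
    if z0: "\<phi> + z0 * t \<in> T_strip h" "\<tau> + z0 * t \<in> \<Omega>" for \<phi> \<tau> t z0 i
  proof -
    let ?f = "\<phi> + z0 * t" and ?u = "\<tau> + z0 * t"
    have m: "?u \<in> D_minus \<theta> r" "?u \<in> D_plus \<theta> r" using z0(2) \<Omega>_sub by auto
    have dU: "((\<lambda>z. U (\<phi> + z * t) (\<tau> + z * t) $ i $ j) has_field_derivative
        t * (DX_H H (\<Gamma>m ?f ?u) ** U ?f ?u) $ i $ j) (at z0)" for i j
      using strip_characteristic_deriv[OF an(3) z0(1) m(1)] by (simp only: ode_U[OF z0(1) m(1)])
    have dp: "((\<lambda>z. \<Gamma>p (\<phi> + z * t) (\<tau> + z * t) $ i) has_field_derivative t * X_H H (\<Gamma>p ?f ?u) $ i) (at z0)" for i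
      using strip_characteristic_deriv[OF an(1) z0(1) m(2)] by (simp only: ode_p[OF z0(1) m(2)])
    have dm: "((\<lambda>z. \<Gamma>m (\<phi> + z * t) (\<tau> + z * t) $ i) has_field_derivative t * X_H H (\<Gamma>m ?f ?u) $ i) (at z0)" for i
      using strip_characteristic_deriv[OF an(2) z0(1) m(1)] by (simp only: ode_m[OF z0(1) m(1)])
    show ?thesis
      unfolding c_def c'_def
    proof (rule variation_of_constants[where A = "DX_H H (\<Gamma>m ?f ?u)"])
      show "((\<lambda>z. \<Delta> (\<phi> + z * t) (\<tau> + z * t) $ i) has_field_derivative
          t * (DX_H H (\<Gamma>m ?f ?u) *v \<Delta> ?f ?u + Q ?f ?u) $ i) (at z0)" for i
        using DERIV_diff[OF dp dm, of i i] by (simp add: \<Delta>_def Q_def right_diff_distrib)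
      show "((\<lambda>z. U (\<phi> + z * t) (\<tau> + z * t) $ i $ j) has_field_derivative
        t * (DX_H H (\<Gamma>m ?f ?u) ** U ?f ?u) $ i $ j) (at z0)" for i j by (rule dU)
      show "(\<lambda>z. W (\<phi> + z * t) (\<tau> + z * t) $ i $ j) field_differentiable (at z0)" for i j
        unfolding W_def by (rule symplectic_inverse_differentiable) (use dU in \<open>auto simp: field_differentiable_def\<close>)
      have "open ((\<lambda>z. \<phi> + z * t) -` T_strip h \<inter> (\<lambda>z. \<tau> + z * t) -` \<Omega>)"
        by (intro open_Int open_vimage open_T_strip \<Omega>_open continuous_intros)
      then have "\<forall>\<^sub>F z in nhds z0. z \<in> (\<lambda>z. \<phi> + z * t) -` T_strip h \<inter> (\<lambda>z. \<tau> + z * t) -` \<Omega>"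
        by (rule eventually_nhds_in_open) (use z0 in auto)
      then show "\<forall>\<^sub>F z in nhds z0. U (\<phi> + z * t) (\<tau> + z * t) ** W (\<phi> + z * t) (\<tau> + z * t) = mat 1"
        by eventually_elim (auto intro: inv)
    qed
  qed
  have deriv: "((\<lambda>l. c (\<phi> + of_real l * t) (\<tau> + of_real l * t)) has_vector_derivative
          t *s c' (\<phi> + of_real l * t) (\<tau> + of_real l * t)) (at l)"
    if "\<phi> + of_real l * t \<in> T_strip h" "\<tau> + of_real l * t \<in> \<Omega>" for \<phi> \<tau> t l
    using has_vector_derivative_real_field[OF char[OF that]] by (intro has_vector_derivative_vecI) simp
  have holo: "(\<lambda>\<tau>. c 0 \<tau> $ i) field_differentiable (at \<tau>)" if "\<tau> \<in> \<Omega>" for \<tau> i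
  proof -
    have m: "\<tau> \<in> D_minus \<theta> r" "\<tau> \<in> D_plus \<theta> r" using that \<Omega>_sub by auto
    have T0: "0 \<in> T_strip h" using assms(7) by (simp add: T_strip_def)
    have fd: "(\<lambda>\<tau>. f 0 \<tau>) field_differentiable (at \<tau>)" if "analytic_strip h D f" "\<tau> \<in> D" for f D
      using strip_line_deriv[of h D f 0 \<tau> 0 0 1] that T0 by (auto simp: field_differentiable_def)
    show ?thesis
      unfolding c_def W_def
    proof (intro matrix_vector_differentiable symplectic_inverse_differentiable)
      show "(\<lambda>\<tau>. U 0 \<tau> $ i $ j) field_differentiable (at \<tau>)" for i j
        by (rule fd[OF an(3) m(1)])
      show "(\<lambda>\<tau>. \<Delta> 0 \<tau> $ j) field_differentiable (at \<tau>)" for j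
        unfolding \<Delta>_def vector_minus_component
        by (intro field_differentiable_diff fd[OF an(1) m(2)] fd[OF an(2) m(1)])
    qed
  qed
  have per: "c (\<phi> + of_real (2 * pi)) \<tau> = c \<phi> \<tau>" if "\<phi> \<in> T_strip h" "\<tau> \<in> \<Omega>" for \<phi> \<tau>
  proof -
    have "periodic_on_strip h (D_plus \<theta> r) \<Gamma>p" "periodic_on_strip h (D_minus \<theta> r) \<Gamma>m"
      "periodic_on_strip h (D_minus \<theta> r) U" using pp pm pU by blast+
    moreover have "\<tau> \<in> D_plus \<theta> r" "\<tau> \<in> D_minus \<theta> r" using that \<Omega>_sub by auto
    ultimately have "\<Gamma>p (\<phi> + of_real (2 * pi)) \<tau> = \<Gamma>p \<phi> \<tau>" "\<Gamma>m (\<phi> + of_real (2 * pi)) \<tau> = \<Gamma>m \<phi> \<tau>"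
      "U (\<phi> + of_real (2 * pi)) \<tau> = U \<phi> \<tau>"
      using that(1) by (simp_all only: periodic_on_strip_def)
    then show ?thesis by (simp only: c_def W_def \<Delta>_def)
  qed

  \<comment> \<open>One \<open>\<delta>\<close> is lost in the expansion of \<open>c\<close>, the other on the growth of \<open>U\<close>.\<close>
  define \<delta> where "\<delta> = min \<epsilon> 1 / 2"
  have \<delta>: "0 < \<delta>" "\<delta> < 1" "2 * \<delta> \<le> \<epsilon>" using assms(16) by (auto simp: \<delta>_def min_def)
  have "\<exists>\<Theta> C R'. \<forall>\<phi>\<in>T_strip h. \<forall>\<tau>\<in>\<Omega>. Im \<tau> \<le> - R' \<longrightarrow>
    norm (c \<phi> \<tau> - exp (- \<i> * (\<tau> - \<phi>)) *s \<Theta>) \<le> C * exp ((1 + (1 - \<delta>)) * Im \<tau>)"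
  proof (rule quadratic_transport_expansion[where R = R and A = A and P = P and k = k and c' = c'])
    show "A \<ge> 0" using A_parts by (simp add: A_def)
  qed (use assms(7) \<Omega>_open cone half_strip R(1) \<delta> per deriv quad decay holo in auto)
  moreover have "1 + (1 - \<delta>) = 2 - \<delta>" by simp
  ultimately obtain \<Theta> C R' where \<Theta>_all: "\<forall>\<phi>\<in>T_strip h. \<forall>\<tau>\<in>\<Omega>. Im \<tau> \<le> - R' \<longrightarrow>
      norm (c \<phi> \<tau> - exp (- \<i> * (\<tau> - \<phi>)) *s \<Theta>) \<le> C * exp ((2 - \<delta>) * Im \<tau>)"
    by (elim exE) (simp only:)
  have \<Theta>: "norm (c \<phi> \<tau> - exp (- \<i> * (\<tau> - \<phi>)) *s \<Theta>) \<le> C * exp ((2 - \<delta>) * Im \<tau>)"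
    if "\<phi> \<in> T_strip h" "\<tau> \<in> \<Omega>" "Im \<tau> \<le> - R'" for \<phi> \<tau>
    using \<Theta>_all that by blast
  define L where "L = (real (Suc K) / \<delta>) ^ K"
  define M where "M = 16 * CU * (1 + k) ^ K * L * \<bar>C\<bar> * exp (\<bar>2 - \<epsilon>\<bar> * h)"
  show ?thesis
    unfolding bigO_strip_def
  proof (rule exI[of _ \<Theta>], rule exI[of _ M], rule exI[of _ "(1 + k) * max R R'"], intro ballI impI)
    fix \<phi> \<tau> assume \<phi>: "\<phi> \<in> T_strip h" and \<tau>: "\<tau> \<in> D_wedge \<theta> r" "norm \<tau> \<ge> (1 + k) * max R R'"
    define s where "s = - Im \<tau>"
    have \<tau>\<Omega>: "\<tau> \<in> \<Omega>" using \<tau>(1) by (simp add: \<Omega>_def)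
    have "Im \<tau> < 0" using \<tau>(1) by (simp add: D_wedge_def)
    have "(1 + k) * max R R' \<le> \<bar>Re \<tau>\<bar> + \<bar>Im \<tau>\<bar>" using \<tau>(2) cmod_le[of \<tau>] by linarith
    also have "\<dots> \<le> (1 + k) * s" using cone[OF \<tau>\<Omega>] \<open>Im \<tau> < 0\<close> by (simp add: s_def algebra_simps)
    finally have "max R R' \<le> s" using k by simp
    then have deep: "Im \<tau> \<le> - R" "Im \<tau> \<le> - R'" by (auto simp: s_def)
    have s: "s \<ge> 0" "\<bar>Im \<tau>\<bar> = s" using \<open>Im \<tau> < 0\<close> by (auto simp: s_def)
    let ?e = "exp (- \<i> * (\<tau> - \<phi>))"
    have "\<Gamma>p \<phi> \<tau> - \<Gamma>m \<phi> \<tau> - ?e *s (U \<phi> \<tau> *v \<Theta>) = U \<phi> \<tau> *v (c \<phi> \<tau> - ?e *s \<Theta>)"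
      using Uc[OF \<phi> \<tau>\<Omega>] by (simp add: matrix_vector_mult_diff_distrib vector_scalar_commute \<Delta>_def)
    also have "norm \<dots> \<le> 16 * CU * norm \<tau> ^ K * norm (c \<phi> \<tau> - ?e *s \<Theta>)"
      by (rule U_vec[OF \<phi> \<tau>\<Omega> deep(1)])
    also have "\<dots> \<le> 16 * CU * ((1 + k) ^ K * (L * exp (\<delta> * s))) * (\<bar>C\<bar> * exp ((2 - \<delta>) * Im \<tau>))"
    proof (intro mult_mono mult_left_mono)
      have "norm \<tau> ^ K \<le> ((1 + k) * s) ^ K"
        using size(3)[OF \<tau>\<Omega> deep(1)] s by (intro power_mono) auto
      also have "\<dots> = (1 + k) ^ K * s ^ K" by (rule power_mult_distrib)
      also have "\<dots> \<le> (1 + k) ^ K * (L * exp (\<delta> * s))"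
        unfolding L_def using power_le_exp[OF \<delta>(1) s(1), of K] k by (intro mult_left_mono) auto
      finally show "norm \<tau> ^ K \<le> (1 + k) ^ K * (L * exp (\<delta> * s))" .
      have "norm (c \<phi> \<tau> - ?e *s \<Theta>) \<le> C * exp ((2 - \<delta>) * Im \<tau>)" by (rule \<Theta>[OF \<phi> \<tau>\<Omega> deep(2)])
      also have "\<dots> \<le> \<bar>C\<bar> * exp ((2 - \<delta>) * Im \<tau>)" by (intro mult_right_mono) auto
      finally show "norm (c \<phi> \<tau> - ?e *s \<Theta>) \<le> \<bar>C\<bar> * exp ((2 - \<delta>) * Im \<tau>)" .
    qed (use CU k \<delta> in \<open>auto simp: L_def\<close>)
    also have "\<dots> = 16 * CU * (1 + k) ^ K * L * \<bar>C\<bar> * exp ((2 - 2 * \<delta>) * Im \<tau>)"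
    proof -
      have "exp (\<delta> * s) * exp ((2 - \<delta>) * Im \<tau>) = exp ((2 - 2 * \<delta>) * Im \<tau>)"
        by (simp add: exp_add[symmetric] s_def algebra_simps)
      then show ?thesis by (simp add: mult_ac)
    qed
    also have "\<dots> \<le> 16 * CU * (1 + k) ^ K * L * \<bar>C\<bar> * (exp (\<bar>2 - \<epsilon>\<bar> * h) * exp ((2 - \<epsilon>) * (Im \<tau> - Im \<phi>)))"
    proof (rule mult_left_mono)
      have "(2 - 2 * \<delta>) * Im \<tau> \<le> (2 - \<epsilon>) * Im \<tau>"
        using \<delta>(3) \<open>Im \<tau> < 0\<close> by (intro mult_right_mono_neg) auto
      moreover have "(2 - \<epsilon>) * Im \<phi> \<le> \<bar>2 - \<epsilon>\<bar> * h"
      proof -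
        have "(2 - \<epsilon>) * Im \<phi> \<le> \<bar>2 - \<epsilon>\<bar> * \<bar>Im \<phi>\<bar>" unfolding abs_mult[symmetric] by (rule abs_ge_self)
        also have "\<dots> \<le> \<bar>2 - \<epsilon>\<bar> * h" using \<phi> by (intro mult_left_mono) (auto simp: T_strip_def)
        finally show ?thesis .
      qed
      ultimately show "exp ((2 - 2 * \<delta>) * Im \<tau>) \<le> exp (\<bar>2 - \<epsilon>\<bar> * h) * exp ((2 - \<epsilon>) * (Im \<tau> - Im \<phi>))"
        unfolding exp_add[symmetric] exp_le_cancel_iff right_diff_distrib by linarith
      show "0 \<le> 16 * CU * (1 + k) ^ K * L * \<bar>C\<bar>" using CU k \<delta> by (simp add: L_def)
    qed
    also have "exp ((2 - \<epsilon>) * (Im \<tau> - Im \<phi>)) = norm (exp (- (2 - of_real \<epsilon>) * \<i> * (\<tau> - \<phi>)))"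
      by (simp add: algebra_simps)
    finally show "norm (\<Gamma>p \<phi> \<tau> - \<Gamma>m \<phi> \<tau> - ?e *s (U \<phi> \<tau> *v \<Theta>)) \<le> M * norm (exp (- (2 - of_real \<epsilon>) * \<i> * (\<tau> - \<phi>)))"
      by (simp only: M_def mult.assoc)
  qed
qed

end
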